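(* Assume that for some $\bar\delta>0$ and $\nu_0\ge1$, $$\sup_{\boldsymbol{\theta}\in\Theta}\ \sup_{\gamma\in S^p}h(\delta,\gamma;\boldsymbol{\theta})\le2\nu_0^2\delta^2,\qquad|\delta|\le\bar\delta .$$ Suppose that there are constants $\epsilon>0$ and $\nu_1\ge1$ such that $\mathfrak{A}_\epsilon v(\boldsymbol{\theta})\le\nu_1$ for each $\boldsymbol{\theta}\in\Theta$. Let also for some $s,\rho\in[0,1)$ such that $\epsilon\rho/(1-\rho)\le n^{1/2}\bar\delta$ $$\mathfrak{H}_\epsilon(\rho,s):=\log\left(\omega_p^{-1}\epsilon^{-p}\int_\Theta\sqrt{\det\{nv(\boldsymbol{\theta})\}}\,\exp\{-\rho(1-s)\,n\,\mathfrak{m}_\epsilon(\boldsymbol{\theta},\boldsymbol{\theta}_0)\}\,d\boldsymbol{\theta}\right)<\infty,$$ where $\mathfrak{m}_\epsilon(\boldsymbol{\theta},\boldsymbol{\theta}_0)=\inf_{\boldsymbol{\theta}'\in\mathcal{B}(\epsilon,\boldsymbol{\theta})}\mathfrak{m}(\boldsymbol{\theta}',\boldsymbol{\theta}_0)$ and $\omega_p$ is the Lebesgue measure of the unit ball in $\mathbb{R}^p$. Then $$\log\mathfrak{Q}(\rho,s)\le(1-\rho)\mathbb{Q}_p+\frac{2\nu_0^2\epsilon^2\rho^2}{1-\rho}+2p\log(\nu_1)+\mathfrak{H}_\epsilon(\rho,s).$$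
   Context: $Y_1,\dots,Y_n$ are i.i.d. with distribution $P$ (expectation $E$; $\mathbb{E}$ is expectation under the joint law). $\{P_{\boldsymbol{\theta}},\boldsymbol{\theta}\in\Theta\}$, $\Theta\subset\mathbb{R}^p$ convex, is a parametric family (not necessarily containing $P$); $P$ and all $P_{\boldsymbol{\theta}}$ are dominated by a measure $P_0$, $p(y,\boldsymbol{\theta})=dP_{\boldsymbol{\theta}}/dP_0(y)$. Put $\ell(y,\boldsymbol{\theta})=\log p(y,\boldsymbol{\theta})$, $\ell(y,\boldsymbol{\theta},\boldsymbol{\theta}')=\ell(y,\boldsymbol{\theta})-\ell(y,\boldsymbol{\theta}')$, $L(\boldsymbol{\theta})=\sum_{i=1}^n\ell(Y_i,\boldsymbol{\theta})$ (a separable random field whose expectation exists for all $\boldsymbol{\theta}$), $L(\boldsymbol{\theta},\boldsymbol{\theta}')=L(\boldsymbol{\theta})-L(\boldsymbol{\theta}')$; $\boldsymbol{\theta}_0\in\Theta$ maximizes $\boldsymbol{\theta}\mapsto\mathbb{E}L(\boldsymbol{\theta})$. A positive function $\mu(\cdot)$ on $\Theta$ is fixed with $E\exp\{\mu(\boldsymbol{\theta})\ell(Y_1,\boldsymbol{\theta},\boldsymbol{\theta}_0)\}<\infty$ for all $\boldsymbol{\theta}$, and $\mathfrak{m}(\boldsymbol{\theta},\boldsymbol{\theta}_0)=-\log E\exp\{\mu(\boldsymbol{\theta})\ell(Y_1,\boldsymbol{\theta},\boldsymbol{\theta}_0)\}$. $\ell(y,\cdot)$ and $\mu(\cdot)$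 are differentiable in $\boldsymbol{\theta}$, with gradient $\nabla$. Put $\zeta_1(\boldsymbol{\theta})=\mu(\boldsymbol{\theta})\{\ell(Y_1,\boldsymbol{\theta},\boldsymbol{\theta}_0)-E\ell(Y_1,\boldsymbol{\theta},\boldsymbol{\theta}_0)\}$, $$v(\boldsymbol{\theta})=E\,\nabla\zeta_1(\boldsymbol{\theta})[\nabla\zeta_1(\boldsymbol{\theta})]^\top,\qquad h(\delta,\gamma;\boldsymbol{\theta})=\log E\exp\Big\{2\delta\frac{\gamma^\top\nabla\zeta_1(\boldsymbol{\theta})}{\sqrt{\gamma^\top v(\boldsymbol{\theta})\gamma}}\Big\},$$ $\gamma$ in the unit sphere $S^p$ of $\mathbb{R}^p$; each $v(\boldsymbol{\theta})$ is non-degenerate. With $V(\boldsymbol{\theta})=nv(\boldsymbol{\theta})$ define $$\mathfrak{S}^2(\boldsymbol{\theta},\boldsymbol{\theta}')=\sup_{t\in[0,1]}(\boldsymbol{\theta}-\boldsymbol{\theta}')^\top V[(1-t)\boldsymbol{\theta}'+t\boldsymbol{\theta}](\boldsymbol{\theta}-\boldsymbol{\theta}'),\quad\mathcal{B}(\epsilon,\boldsymbol{\theta}^\circ)=\{\boldsymbol{\theta}\in\Theta:\mathfrak{S}(\boldsymbol{\theta},\boldsymbol{\theta}^\circ)\le\epsilon\},$$ $$\mathcal{B}'(\epsilon,\boldsymbol{\theta}^\circ)=\{\boldsymbol{\theta}:(\boldsymbol{\theta}-\boldsymbol{\theta}^\circ)^\top V(\boldsymbol{\theta}^\circ)(\boldsymbol{\theta}-\boldsymbol{\theta}^\circ)\le\epsilon^2\},\quad\mathfrak{A}_\epsilon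 v(\boldsymbol{\theta}^\circ)=\sup_{\boldsymbol{\theta},\boldsymbol{\theta}'\in\mathcal{B}'(\epsilon,\boldsymbol{\theta}^\circ)}\ \sup_{\gamma\in S^p}\frac{\gamma^\top v(\boldsymbol{\theta})\gamma}{\gamma^\top v(\boldsymbol{\theta}')\gamma}.$$ For $\rho,s\in[0,1]$, $$\mathfrak{Q}(\rho,s)=\mathbb{E}\sup_{\boldsymbol{\theta}\in\Theta}\exp\big\{\rho[\mu(\boldsymbol{\theta})L(\boldsymbol{\theta},\boldsymbol{\theta}_0)+s\,n\,\mathfrak{m}(\boldsymbol{\theta},\boldsymbol{\theta}_0)]\big\}.$$ $\mathbb{Q}_p=\sum_{k\ge1}2^{-k}\log N_k$, where $N_k$ is the minimal number of Euclidean balls of radius $2^{-k}$ required to cover the Euclidean unit ball in $\mathbb{R}^p$.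
   Formalization: It is assumed that each ellipsoid B'(ε,θ), θ in Θ, lies inside Θ, so that v is defined where A_ε v takes its supremum; without this (v extended, or B' cut to Θ) the bound fails, e.g. for a Gaussian shift on a very short interval with ρ=0. *)

theory Defs
  imports "HOL-Probability.Probability"
begin

text \<open>Logarithms of expectations that may be infinite.  With the real Bochner integral and
  \<open>ln\<close> a divergent exponential moment would silently evaluate to \<open>ln 0 = 0\<close>.\<close>

definition elog :: "ennreal \<Rightarrow> ereal" where
  "elog x = (if x = 0 then - \<infinity> else if x = \<top> then \<infinity> else ereal (ln (enn2real x)))"

definition eexp :: "ereal \<Rightarrow> ennreal" where
  "eexp x = (if x = \<infinity> then \<top> else if x = - \<infinity> then 0 else ennreal (exp (real_of_ereal x)))"

text \<open>Throughout, \<open>p y \<theta>\<close> is the density at \<open>y\<close> of the member of the family with parameter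
  \<open>\<theta>\<close>, and the Euclidean parameter space is \<open>real ^ 'p\<close>, of dimension \<open>CARD('p)\<close>.\<close>

definition loglik :: "('y \<Rightarrow> real ^ 'p \<Rightarrow> real) \<Rightarrow> 'y \<Rightarrow> real ^ 'p \<Rightarrow> real" where
  "loglik p y \<theta> = ln (p y \<theta>)"

definition loglik_diff :: "('y \<Rightarrow> real ^ 'p \<Rightarrow> real) \<Rightarrow> 'y \<Rightarrow> real ^ 'p \<Rightarrow> real ^ 'p \<Rightarrow> real" where
  "loglik_diff p y \<theta> \<theta>' = loglik p y \<theta> - loglik p y \<theta>'"

definition Lik ::
  "('y \<Rightarrow> real ^ 'p \<Rightarrow> real) \<Rightarrow> (nat \<Rightarrow> 'w \<Rightarrow> 'y) \<Rightarrow> nat \<Rightarrow> 'w \<Rightarrow> real ^ 'p \<Rightarrow> real" where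
  "Lik p Y n \<omega> \<theta> = (\<Sum>i<n. loglik p (Y i \<omega>) \<theta>)"

definition Lik_diff ::
  "('y \<Rightarrow> real ^ 'p \<Rightarrow> real) \<Rightarrow> (nat \<Rightarrow> 'w \<Rightarrow> 'y) \<Rightarrow> nat \<Rightarrow> 'w \<Rightarrow> real ^ 'p \<Rightarrow> real ^ 'p \<Rightarrow> real" where
  "Lik_diff p Y n \<omega> \<theta> \<theta>' = Lik p Y n \<omega> \<theta> - Lik p Y n \<omega> \<theta>'"

text \<open>\<open>\<mm>(\<theta>, \<theta>\<^sub>0)\<close>; real-valued because the exponential moment is assumed finite.\<close>

definition rate_m ::
  "'y measure \<Rightarrow> ('y \<Rightarrow> real ^ 'p \<Rightarrow> real) \<Rightarrow> (real ^ 'p \<Rightarrow> real) \<Rightarrow> real ^ 'p \<Rightarrow> real ^ 'p \<Rightarrow> real" where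
  "rate_m P p \<mu> \<theta>0 \<theta> = - ln (\<integral>y. exp (\<mu> \<theta> * loglik_diff p y \<theta> \<theta>0) \<partial>P)"

text \<open>\<open>\<zeta>\<^sub>1(\<theta>)\<close> as a function of the value \<open>y\<close> of the first observation.\<close>

definition zeta1 ::
  "'y measure \<Rightarrow> ('y \<Rightarrow> real ^ 'p \<Rightarrow> real) \<Rightarrow> (real ^ 'p \<Rightarrow> real) \<Rightarrow> real ^ 'p \<Rightarrow> 'y \<Rightarrow> real ^ 'p \<Rightarrow> real" where
  "zeta1 P p \<mu> \<theta>0 y \<theta> = \<mu> \<theta> * (loglik_diff p y \<theta> \<theta>0 - (\<integral>z. loglik_diff p z \<theta> \<theta>0 \<partial>P))"

text \<open>The log-likelihood and \<open>\<mu>\<close> are meaningful on \<open>\<Theta>\<close> only, so derivatives are taken within \<open>\<Theta>\<close>.\<close>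

definition grad_within :: "(real ^ 'p) set \<Rightarrow> (real ^ 'p \<Rightarrow> real) \<Rightarrow> real ^ 'p \<Rightarrow> real ^ 'p" where
  "grad_within \<Theta> f \<theta> = (THE D. (f has_derivative (\<lambda>h. h \<bullet> D)) (at \<theta> within \<Theta>))"

definition grad_zeta1 ::
  "(real ^ 'p) set \<Rightarrow> 'y measure \<Rightarrow> ('y \<Rightarrow> real ^ 'p \<Rightarrow> real) \<Rightarrow> (real ^ 'p \<Rightarrow> real) \<Rightarrow> real ^ 'p
    \<Rightarrow> 'y \<Rightarrow> real ^ 'p \<Rightarrow> real ^ 'p" where
  "grad_zeta1 \<Theta> P p \<mu> \<theta>0 y \<theta> = grad_within \<Theta> (zeta1 P p \<mu> \<theta>0 y) \<theta>"

definition outer :: "real ^ 'p \<Rightarrow> real ^ 'p ^ 'p" where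
  "outer g = (\<chi> i j. g $ i * g $ j)"

definition vmat ::
  "(real ^ 'p) set \<Rightarrow> 'y measure \<Rightarrow> ('y \<Rightarrow> real ^ 'p \<Rightarrow> real) \<Rightarrow> (real ^ 'p \<Rightarrow> real) \<Rightarrow> real ^ 'p
    \<Rightarrow> real ^ 'p \<Rightarrow> real ^ 'p ^ 'p" where
  "vmat \<Theta> P p \<mu> \<theta>0 \<theta> = (\<integral>y. outer (grad_zeta1 \<Theta> P p \<mu> \<theta>0 y \<theta>) \<partial>P)"

definition quad :: "real ^ 'p ^ 'p \<Rightarrow> real ^ 'p \<Rightarrow> real" where
  "quad A x = x \<bullet> (A *v x)"

definition hfun ::
  "(real ^ 'p) set \<Rightarrow> 'y measure \<Rightarrow> ('y \<Rightarrow> real ^ 'p \<Rightarrow> real) \<Rightarrow> (real ^ 'p \<Rightarrow> real) \<Rightarrow> real ^ 'p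
    \<Rightarrow> real \<Rightarrow> real ^ 'p \<Rightarrow> real ^ 'p \<Rightarrow> ereal" where
  "hfun \<Theta> P p \<mu> \<theta>0 \<delta> \<gamma> \<theta> =
     elog (\<integral>\<^sup>+ y. ennreal (exp (2 * \<delta> * ((\<gamma> \<bullet> grad_zeta1 \<Theta> P p \<mu> \<theta>0 y \<theta>)
                                       / sqrt (quad (vmat \<Theta> P p \<mu> \<theta>0 \<theta>) \<gamma>)))) \<partial>P)"

text \<open>\<open>V\<close> and \<open>v\<close> are matrix fields on the parameter space.  \<open>frakS2\<close> is the square
  \<open>\<SS>\<^sup>2\<close>; it may be infinite.\<close>

definition frakS2 :: "(real ^ 'p \<Rightarrow> real ^ 'p ^ 'p) \<Rightarrow> real ^ 'p \<Rightarrow> real ^ 'p \<Rightarrow> ereal" where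
  "frakS2 V \<theta> \<theta>' = (SUP t\<in>{0..1}. ereal (quad (V ((1 - t) *\<^sub>R \<theta>' + t *\<^sub>R \<theta>)) (\<theta> - \<theta>')))"

definition calB ::
  "(real ^ 'p) set \<Rightarrow> (real ^ 'p \<Rightarrow> real ^ 'p ^ 'p) \<Rightarrow> real \<Rightarrow> real ^ 'p \<Rightarrow> (real ^ 'p) set" where
  "calB \<Theta> V \<epsilon> \<theta>c = {\<theta> \<in> \<Theta>. frakS2 V \<theta> \<theta>c \<le> ereal (\<epsilon>\<^sup>2)}"

definition calB' :: "(real ^ 'p \<Rightarrow> real ^ 'p ^ 'p) \<Rightarrow> real \<Rightarrow> real ^ 'p \<Rightarrow> (real ^ 'p) set" where
  "calB' V \<epsilon> \<theta>c = {\<theta>. quad (V \<theta>c) (\<theta> - \<theta>c) \<le> \<epsilon>\<^sup>2}"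

definition frakA ::
  "nat \<Rightarrow> (real ^ 'p \<Rightarrow> real ^ 'p ^ 'p) \<Rightarrow> real \<Rightarrow> real ^ 'p \<Rightarrow> ereal" where
  "frakA n v \<epsilon> \<theta>c =
     (let B = calB' (\<lambda>\<theta>. real n *\<^sub>R v \<theta>) \<epsilon> \<theta>c in
      SUP \<theta>\<in>B. SUP \<theta>'\<in>B. SUP \<gamma>\<in>sphere 0 1. ereal (quad (v \<theta>) \<gamma> / quad (v \<theta>') \<gamma>))"

text \<open>The type argument carries the dimension.  The covering balls are closed and may be centred
  anywhere.\<close>

definition cover_number :: "'p::finite itself \<Rightarrow> nat \<Rightarrow> nat" where
  "cover_number _ k =
     (LEAST m. \<exists>C :: (real ^ 'p) set. finite C \<and> card C = m \<and>
        cball 0 1 \<subseteq> (\<Union>c\<in>C. cball c (1 / 2 ^ k)))"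

definition entropy_Q :: "'p::finite itself \<Rightarrow> real" where
  "entropy_Q T = (\<Sum>k. ln (real (cover_number T (Suc k))) / 2 ^ Suc k)"

text \<open>The infimum may be \<open>-\<infinity>\<close>; for \<open>\<rho> = 0\<close> the product with it below is \<open>0\<close>.\<close>

definition rate_m_eps ::
  "(real ^ 'p) set \<Rightarrow> 'y measure \<Rightarrow> ('y \<Rightarrow> real ^ 'p \<Rightarrow> real) \<Rightarrow> (real ^ 'p \<Rightarrow> real) \<Rightarrow> real ^ 'p
    \<Rightarrow> nat \<Rightarrow> real \<Rightarrow> real ^ 'p \<Rightarrow> ereal" where
  "rate_m_eps \<Theta> P p \<mu> \<theta>0 n \<epsilon> \<theta> =
     (INF \<theta>'\<in>calB \<Theta> (\<lambda>\<theta>. real n *\<^sub>R vmat \<Theta> P p \<mu> \<theta>0 \<theta>) \<epsilon> \<theta>. ereal (rate_m P p \<mu> \<theta>0 \<theta>'))"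

definition frakH_integrand ::
  "(real ^ 'p) set \<Rightarrow> 'y measure \<Rightarrow> ('y \<Rightarrow> real ^ 'p \<Rightarrow> real) \<Rightarrow> (real ^ 'p \<Rightarrow> real) \<Rightarrow> real ^ 'p
    \<Rightarrow> nat \<Rightarrow> real \<Rightarrow> real \<Rightarrow> real \<Rightarrow> real ^ 'p \<Rightarrow> ennreal" where
  "frakH_integrand \<Theta> P p \<mu> \<theta>0 n \<epsilon> \<rho> s \<theta> =
     ennreal (sqrt (det (real n *\<^sub>R vmat \<Theta> P p \<mu> \<theta>0 \<theta>))) *
     eexp (ereal (- (\<rho> * (1 - s) * real n)) * rate_m_eps \<Theta> P p \<mu> \<theta>0 n \<epsilon> \<theta>)"

definition frakH ::
  "(real ^ 'p) set \<Rightarrow> 'y measure \<Rightarrow> ('y \<Rightarrow> real ^ 'p \<Rightarrow> real) \<Rightarrow> (real ^ 'p \<Rightarrow> real) \<Rightarrow> real ^ 'p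
    \<Rightarrow> nat \<Rightarrow> real \<Rightarrow> real \<Rightarrow> real \<Rightarrow> ereal" where
  "frakH \<Theta> P p \<mu> \<theta>0 n \<epsilon> \<rho> s =
     elog (ennreal (1 / (measure lebesgue (ball (0 :: real ^ 'p) 1) * \<epsilon> ^ CARD('p))) *
           (\<integral>\<^sup>+ \<theta>. frakH_integrand \<Theta> P p \<mu> \<theta>0 n \<epsilon> \<rho> s \<theta> \<partial>lebesgue_on \<Theta>))"

definition frakQ ::
  "(real ^ 'p) set \<Rightarrow> 'w measure \<Rightarrow> (nat \<Rightarrow> 'w \<Rightarrow> 'y) \<Rightarrow> 'y measure \<Rightarrow> ('y \<Rightarrow> real ^ 'p \<Rightarrow> real)
    \<Rightarrow> (real ^ 'p \<Rightarrow> real) \<Rightarrow> real ^ 'p \<Rightarrow> nat \<Rightarrow> real \<Rightarrow> real \<Rightarrow> ennreal" where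
  "frakQ \<Theta> M Y P p \<mu> \<theta>0 n \<rho> s =
     (\<integral>\<^sup>+ \<omega>. (SUP \<theta>\<in>\<Theta>. ennreal (exp (\<rho> * (\<mu> \<theta> * Lik_diff p Y n \<omega> \<theta> \<theta>0
                                            + s * real n * rate_m P p \<mu> \<theta>0 \<theta>)))) \<partial>M)"

end

theory Submission
  imports Defs
begin

text \<open>Put \<open>M \<theta> = \<mu> \<theta> L(\<theta>, \<theta>0) + n m(\<theta>)\<close>, where \<open>m\<close> is the rate function; then \<open>E exp (M \<theta>) = 1\<close> for every \<open>\<theta>\<close>, and
\<open>Q(\<rho>, s)\<close> is the expected supremum of \<open>exp (\<rho> M \<theta> - \<rho> (1 - s) n m(\<theta>))\<close>.

\<^bold>\<open>From local to global.\<close>  Let \<open>\<theta>\<close> range over a finite set and let \<open>a \<theta>\<close> be the part of the expected maximum that is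
collected where \<open>\<theta>\<close> is the maximiser, so that the expected maximum is the sum of the \<open>a \<theta>\<close>.  The shares of the points in a
small ellipsoid around \<open>x\<close> add up to at most the expected maximum over this ellipsoid, hence to at most a constant times
\<open>exp (- \<rho> (1 - s) n m\<^sub>\<epsilon>(x))\<close>.  Integrating over \<open>x\<close> with the weight \<open>sqrt (det V(x))\<close>, each \<open>\<theta>\<close> is seen from a set of
centres whose weighted volume is at least \<open>\<omega> \<epsilon>\<^sup>p\<close> up to a power of \<open>\<nu>1\<close> (\<open>finite_bound\<close>).  Passing to the supremum over
the whole parameter set only needs a countable set that is dense in the graph of \<open>m\<close>, because the likelihood is continuous
(\<open>sup_bound\<close>).

\<^bold>\<open>The local bound.\<close>  On one ellipsoid, mapped to the unit ball, \<open>M\<close> is a deterministic drift plus a centred process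
\<open>\<zeta>\<close> whose increments have Gaussian exponential moments: an increment is an integral of derivatives along a segment, so
Jensen's inequality reduces it to the assumption on \<open>h\<close> (\<open>increment_exponential_moment\<close>, \<open>zeta_sum_increment_moment\<close>).
The drift forbids comparing with a fixed pivot.  Instead let \<open>q\<close> be the law of the maximiser under the density
proportional to the maximum of \<open>exp (\<rho> M)\<close>, and compare with the \<open>q\<close>-average of \<open>M\<close>.  Young's inequality with weights
\<open>1 - \<rho>\<close> and \<open>\<rho>\<close> separates the average, which has exponential moment at most \<open>1\<close>, from the centred increments, and Jensen's
inequality shows that penalties \<open>C i\<close> enter only through their mean \<open>\<Sum> q i C i\<close> (\<open>local_maximal_inequality\<close>).

\<^bold>\<open>Centred increments.\<close>  It remains to find penalties with mean at most \<open>2 p ln 2\<close> for which the maximum of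
\<open>exp (H (u i) - \<Sum> q j H (u j) - C i)\<close> has expectation at most \<open>exp A\<close> (\<open>centred_envelope\<close>).  In dimension one the total variation
of \<open>H\<close> along the sorted points does this with \<open>C i = ln 2\<close>.  In higher dimension \<open>u i\<close> is joined to \<open>t u j\<close> by a chain of
random points, smoothed by uniform noise at geometrically growing scales.  The law of a link is dominated by a law that does
not depend on \<open>i\<close>, at the price of a density factor; the logarithms of these factors, weighted with the lengths of the links,
make up \<open>C i\<close> (\<open>noise_chain\<close>, \<open>noisy_chain_bound\<close>).  Finally \<open>2 p ln 2\<close> is a lower bound of the entropy \<open>Q\<^sub>p\<close>, since comparing
volumes gives \<open>N\<^sub>k \<ge> 2\<^sup>k\<^sup>p\<close> (\<open>entropy_Q_ge\<close>).\<close>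

section \<open>Uniform noise in a ball\<close>

definition ball_noise :: "'a::euclidean_space measure" where
  "ball_noise = uniform_measure lborel (cball 0 1)"

lemma sets_ball_noise [measurable_cong, simp]: "sets ball_noise = sets borel"
  by (simp add: ball_noise_def)

lemma space_ball_noise [simp]: "space ball_noise = UNIV"
  by (simp add: ball_noise_def)

lemma emeasure_unit_cball_pos: "emeasure lborel (cball (0::'a::euclidean_space) 1) \<noteq> 0"
  and emeasure_unit_cball_fin: "emeasure lborel (cball (0::'a::euclidean_space) 1) \<noteq> \<infinity>"
  by (auto simp: emeasure_cball unit_ball_vol_pos less_imp_neq[symmetric] ennreal_eq_0_iff not_le)

lemma prob_space_ball_noise: "prob_space ball_noise"
  unfolding ball_noise_def
  by (rule prob_space_uniform_measure) (use emeasure_unit_cball_pos emeasure_unit_cball_fin in auto)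

lemma AE_ball_noise: "AE z in ball_noise. norm z \<le> 1"
  unfolding ball_noise_def by (rule AE_uniform_measureI) (auto simp: dist_norm)

lemma nn_integral_ball_noise:
  fixes h :: "'a::euclidean_space \<Rightarrow> ennreal"
  assumes [measurable]: "h \<in> borel_measurable borel"
  shows "(\<integral>\<^sup>+z. h z \<partial>ball_noise) = (\<integral>\<^sup>+z. h z * indicator (cball 0 1) z \<partial>lborel) / emeasure lborel (cball (0::'a) 1)"
  unfolding ball_noise_def by (subst nn_integral_uniform_measure) auto

lemma nn_integral_affine:
  fixes h :: "'a::euclidean_space \<Rightarrow> ennreal"
  assumes [measurable]: "h \<in> borel_measurable borel" and "c \<noteq> 0"
  shows "(\<integral>\<^sup>+z. h z \<partial>lborel) = ennreal (\<bar>c\<bar> ^ DIM('a)) * (\<integral>\<^sup>+z. h (t + c *\<^sub>R z) \<partial>lborel)"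
  by (subst lborel_affine[OF assms(2), of t])
     (simp add: nn_integral_density nn_integral_distr nn_integral_cmult)

text \<open>The ball of radius \<open>s\<close> about \<open>v\<close> lies in the ball of radius \<open>r\<close> about the origin, so the density of the first uniform law is at
most the volume ratio times that of the second.  The bound does not depend on \<open>v\<close>: this is what later lets one reference law
serve all points at once.\<close>

lemma ball_noise_dominated:
  fixes h :: "'a::euclidean_space \<Rightarrow> ennreal"
  assumes [measurable]: "h \<in> borel_measurable borel" and "0 < s" "norm v + s \<le> r"
  shows "(\<integral>\<^sup>+z. h (v + s *\<^sub>R z) \<partial>ball_noise) \<le> ennreal ((r / s) ^ DIM('a)) * (\<integral>\<^sup>+z. h (r *\<^sub>R z) \<partial>ball_noise)"
proof -
  let ?w = "emeasure lborel (cball (0::'a) 1)"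
  have r: "r > 0" using assms norm_ge_zero[of v] by linarith
  have "(\<integral>\<^sup>+z. h (v + s *\<^sub>R z) \<partial>ball_noise) = (\<integral>\<^sup>+z. h (v + s *\<^sub>R z) * indicator (cball 0 1) z \<partial>lborel) / ?w"
    by (rule nn_integral_ball_noise) measurable
  also have "(\<integral>\<^sup>+z. h (v + s *\<^sub>R z) * indicator (cball 0 1) z \<partial>lborel)
      \<le> (\<integral>\<^sup>+z. h (v + s *\<^sub>R z) * indicator (cball 0 r) (v + s *\<^sub>R z) \<partial>lborel)"
  proof (rule nn_integral_mono)
    fix z :: 'a
    have "norm z \<le> 1 \<Longrightarrow> norm (v + s *\<^sub>R z) \<le> r"
      using assms(2,3) norm_triangle_ineq[of v "s *\<^sub>R z"] mult_left_mono[of "norm z" 1 s] by (simp, linarith)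
    then show "h (v + s *\<^sub>R z) * indicator (cball 0 1) z \<le> h (v + s *\<^sub>R z) * indicator (cball 0 r) (v + s *\<^sub>R z)"
      by (auto simp: indicator_def)
  qed
  finally have A: "(\<integral>\<^sup>+z. h (v + s *\<^sub>R z) \<partial>ball_noise) \<le> (\<integral>\<^sup>+z. h (v + s *\<^sub>R z) * indicator (cball 0 r) (v + s *\<^sub>R z) \<partial>lborel) / ?w"
    by (simp add: divide_right_mono_ennreal)
  have m: "(\<lambda>z. h z * indicator (cball 0 r) z) \<in> borel_measurable borel"
    by (intro borel_measurable_times_ennreal assms(1) borel_measurable_indicator borel_closed closed_cball)
  let ?J = "\<integral>\<^sup>+z. h z * indicator (cball 0 r) z \<partial>lborel"
  have "?J = ennreal (s ^ DIM('a)) * (\<integral>\<^sup>+z. h (v + s *\<^sub>R z) * indicator (cball 0 r) (v + s *\<^sub>R z) \<partial>lborel)"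
    using assms(2) by (subst nn_integral_affine[OF m, of s v]) auto
  moreover have "?J = ennreal (r ^ DIM('a)) * (\<integral>\<^sup>+z. h (0 + r *\<^sub>R z) * indicator (cball 0 r) (0 + r *\<^sub>R z) \<partial>lborel)"
    using r by (subst nn_integral_affine[OF m, of r 0]) auto
  moreover have "(\<integral>\<^sup>+z. h (0 + r *\<^sub>R z) * indicator (cball 0 r) (0 + r *\<^sub>R z) \<partial>lborel) = (\<integral>\<^sup>+z. h (r *\<^sub>R z) * indicator (cball 0 1) z \<partial>lborel)"
    using r by (intro nn_integral_cong) (auto simp: indicator_def)
  ultimately have B: "ennreal (s ^ DIM('a)) * (\<integral>\<^sup>+z. h (v + s *\<^sub>R z) * indicator (cball 0 r) (v + s *\<^sub>R z) \<partial>lborel)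
    = ennreal (r ^ DIM('a)) * (\<integral>\<^sup>+z. h (r *\<^sub>R z) * indicator (cball 0 1) z \<partial>lborel)" by simp
  have "(\<integral>\<^sup>+z. h (v + s *\<^sub>R z) * indicator (cball 0 r) (v + s *\<^sub>R z) \<partial>lborel)
    = ennreal (1 / s ^ DIM('a)) * (ennreal (s ^ DIM('a)) * (\<integral>\<^sup>+z. h (v + s *\<^sub>R z) * indicator (cball 0 r) (v + s *\<^sub>R z) \<partial>lborel))"
    using assms(2) by (simp add: mult.assoc[symmetric] ennreal_mult[symmetric])
  also have "\<dots> = ennreal ((r / s) ^ DIM('a)) * (\<integral>\<^sup>+z. h (r *\<^sub>R z) * indicator (cball 0 1) z \<partial>lborel)"
    unfolding B using assms(2) r by (simp add: mult.assoc[symmetric] ennreal_mult[symmetric] power_divide)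
  finally have "(\<integral>\<^sup>+z. h (v + s *\<^sub>R z) * indicator (cball 0 r) (v + s *\<^sub>R z) \<partial>lborel) / ?w
     = ennreal ((r / s) ^ DIM('a)) * (\<integral>\<^sup>+z. h (r *\<^sub>R z) \<partial>ball_noise)"
    by (subst nn_integral_ball_noise) (auto simp: ennreal_times_divide)
  with A show ?thesis by simp
qed

lemma integrable_ball_noise:
  fixes f :: "'a::euclidean_space \<Rightarrow> real"
  assumes "continuous_on UNIV f" shows "integrable ball_noise f"
proof -
  interpret prob_space "ball_noise :: 'a measure" by (rule prob_space_ball_noise)
  have "compact (f ` cball 0 1)"
    by (intro compact_continuous_image continuous_on_subset[OF assms]) auto
  then obtain B where B: "\<And>x. x \<in> cball 0 1 \<Longrightarrow> norm (f x) \<le> B"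
    by (meson bounded_iff compact_imp_bounded imageI)
  have [measurable]: "f \<in> borel_measurable borel" by (rule borel_measurable_continuous_onI[OF assms])
  show ?thesis
    by (rule integrable_const_bound[of _ B]) (use AE_ball_noise B in auto)
qed

lemma ball_noise_mean: "(\<integral>z. z \<bullet> a \<partial>ball_noise) = (0::real)" for a :: "'a::euclidean_space"
proof -
  have u: "distr (ball_noise :: 'a measure) borel uminus = ball_noise"
  proof (rule measure_eqI)
    fix A assume "A \<in> sets (distr (ball_noise :: 'a measure) borel uminus)"
    then have [measurable]: "A \<in> sets borel" by simp
    have "emeasure (distr ball_noise borel uminus) A = (\<integral>\<^sup>+z. indicator A (- z) \<partial>(ball_noise::'a measure))"
      by (subst nn_integral_indicator[symmetric]) (auto simp: nn_integral_distr simp del: nn_integral_indicator)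
    also have "\<dots> = (\<integral>\<^sup>+z. indicator A (-z) * indicator (cball 0 1) z \<partial>lborel) / emeasure lborel (cball (0::'a) 1)"
      by (rule nn_integral_ball_noise) measurable
    also have "(\<integral>\<^sup>+z. indicator A (-z) * indicator (cball 0 1) z \<partial>lborel) = (\<integral>\<^sup>+z. indicator A z * indicator (cball 0 1) z \<partial>(lborel::'a measure))"
      by (subst nn_integral_affine[where c="-1" and t=0]) (auto intro!: nn_integral_cong simp: indicator_def)
    also have "\<dots> / emeasure lborel (cball (0::'a) 1) = (\<integral>\<^sup>+z. indicator A z \<partial>(ball_noise::'a measure))"
      by (rule nn_integral_ball_noise[symmetric]) measurable
    finally show "emeasure (distr ball_noise borel uminus) A = emeasure (ball_noise::'a measure) A"
      by simp
  qed simp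
  have "(\<integral>z. z \<bullet> a \<partial>ball_noise) = (\<integral>z. z \<bullet> a \<partial>distr (ball_noise :: 'a measure) borel uminus)" by (simp add: u)
  also have "\<dots> = (\<integral>z. - (z \<bullet> a) \<partial>ball_noise)" by (subst integral_distr) auto
  finally show ?thesis by simp
qed

lemma prob_ball_noise_cball:
  assumes "0 \<le> r" "r \<le> 1"
  shows "emeasure (ball_noise :: 'a::euclidean_space measure) {z. norm z \<le> r} = ennreal (r ^ DIM('a))"
proof -
  have "emeasure (ball_noise :: 'a measure) {z. norm z \<le> r} = emeasure lborel (cball (0::'a) 1 \<inter> cball 0 r) / emeasure lborel (cball (0::'a) 1)"
    unfolding ball_noise_def by (subst emeasure_uniform_measure) (auto simp: cball_def dist_norm)
  also have "cball (0::'a) 1 \<inter> cball 0 r = cball 0 r" using assms by auto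
  also have "emeasure lborel (cball (0::'a) r) / emeasure lborel (cball (0::'a) 1) = ennreal (r ^ DIM('a))"
    using assms less_imp_neq[OF unit_ball_vol_pos[of "real DIM('a)"], symmetric]
    by (simp add: emeasure_cball divide_ennreal)
  finally show ?thesis .
qed

text \<open>Layer-cake formula: \<open>|z|\<^sup>2\<close> is the integral of \<open>2 r\<close> over \<open>r < |z|\<close>, and the ball of radius \<open>r\<close> has probability \<open>r\<close> to the
power of the dimension.\<close>

lemma ball_noise_second_moment:
  "(\<integral>z. (norm z)\<^sup>2 \<partial>(ball_noise :: 'a::euclidean_space measure)) = real DIM('a) / (real DIM('a) + 2)"
proof -
  interpret prob_space "ball_noise :: 'a measure" by (rule prob_space_ball_noise)
  let ?N = "ball_noise :: 'a measure" and ?n = "DIM('a)"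
  have sq: "ennreal (x\<^sup>2) = (\<integral>\<^sup>+r. ennreal (2 * r) * indicator {0..1} r * indicator {..<x} r \<partial>lborel)" if "0 \<le> x" "x \<le> 1" for x :: real
  proof -
    have "(\<integral>\<^sup>+r. ennreal (2 * r) * indicator {0..1} r * indicator {..<x} r \<partial>lborel) = (\<integral>\<^sup>+r. ennreal (2 * r) * indicator {0..x} r \<partial>lborel)"
      by (rule nn_integral_cong_AE, rule AE_mp[OF AE_lborel_singleton[of x]]) (use that in \<open>auto simp: indicator_def\<close>)
    also have "\<dots> = ennreal (x\<^sup>2 - 0\<^sup>2)"
      by (rule nn_integral_FTC_Icc[where F="\<lambda>r. r\<^sup>2"]) (use that in \<open>auto intro!: derivative_eq_intros simp: has_real_derivative_iff_has_vector_derivative[symmetric]\<close>)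
    finally show ?thesis by simp
  qed
  have "(\<integral>\<^sup>+z. ennreal ((norm z)\<^sup>2) \<partial>?N) = (\<integral>\<^sup>+z. (\<integral>\<^sup>+r. ennreal (2 * r) * indicator {0..1} r * indicator {..<norm z} r \<partial>lborel) \<partial>?N)"
    by (rule nn_integral_cong_AE, rule AE_mp[OF AE_ball_noise]) (intro AE_I2 impI sq, auto)
  also have "\<dots> = (\<integral>\<^sup>+r. (\<integral>\<^sup>+z. ennreal (2 * r) * indicator {0..1} r * indicator {z. r < norm z} z \<partial>?N) \<partial>lborel)"
  proof -
    interpret pair_sigma_finite ?N lborel ..
    have [measurable]: "Measurable.pred (?N \<Otimes>\<^sub>M lborel) (\<lambda>x. snd x < norm (fst x))" by measurable
    have "(\<integral>\<^sup>+z. (\<integral>\<^sup>+r. ennreal (2 * r) * indicator {0..1} r * indicator {x. snd x < norm (fst x)} (z, r) \<partial>lborel) \<partial>?N) 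
      = (\<integral>\<^sup>+r. (\<integral>\<^sup>+z. ennreal (2 * r) * indicator {0..1} r * indicator {x. snd x < norm (fst x)} (z,r) \<partial>?N) \<partial>lborel)"
      by (rule Fubini'[symmetric]) measurable
    then show ?thesis by (simp add: indicator_def)
  qed
  also have "\<dots> = (\<integral>\<^sup>+r. ennreal (2 * r - 2 * r ^ (?n + 1)) * indicator {0..1} r \<partial>lborel)"
  proof (rule nn_integral_cong)
    fix r :: real
    have "emeasure ?N {z. r < norm z} = ennreal (1 - r ^ ?n)" if "0 \<le> r" "r \<le> 1"
    proof -
      have "{z. r < norm z} = space ?N - {z. norm z \<le> r}" by auto
      then have "emeasure ?N {z. r < norm z} = emeasure ?N (space ?N - {z. norm z \<le> r})" by simp
      also have "\<dots> = 1 - emeasure ?N {z. norm z \<le> r}"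
        by (subst emeasure_compl) (auto simp: emeasure_space_1 simp del: space_ball_noise)
      finally have "emeasure ?N {z. r < norm z} = 1 - emeasure ?N {z. norm z \<le> r}" .
      then show ?thesis using that by (simp add: prob_ball_noise_cball ennreal_minus flip: ennreal_1)
    qed
    moreover have "0 \<le> r \<Longrightarrow> r \<le> 1 \<Longrightarrow> ennreal (2 * r) * ennreal (1 - r ^ ?n) = ennreal (2 * r - 2 * r ^ (?n + 1))"
      by (subst ennreal_mult[symmetric]) (auto simp: power_le_one algebra_simps)
    ultimately show "(\<integral>\<^sup>+z. ennreal (2 * r) * indicator {0..1} r * indicator {z. r < norm z} z \<partial>?N) = ennreal (2 * r - 2 * r ^ (?n + 1)) * indicator {0..1} r"
      by (cases "0 \<le> r \<and> r \<le> 1") (auto simp: nn_integral_cmult_indicator)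
  qed
  also have "\<dots> = ennreal ((1\<^sup>2 - 2 * 1 ^ (?n + 2) / real (?n + 2)) - (0\<^sup>2 - 2 * 0 ^ (?n + 2) / real (?n + 2)))"
  proof -
    have A: "0 \<le> 2 * x - 2 * x ^ (?n + 1)" if "0 \<le> x" "x \<le> 1" for x :: real
      using that power_le_one[of x ?n] by (simp add: mult_left_le)
    have B: "((\<lambda>r. r\<^sup>2 - 2 * r ^ (?n + 2) / real (?n + 2)) has_real_derivative 2 * x - 2 * x ^ (?n + 1)) (at x)" for x :: real
    proof -
      have "((\<lambda>r. r\<^sup>2 - 2 * r ^ (?n + 2) / real (?n + 2)) has_real_derivative 2 * x - 2 * (real (?n+2) * x ^ (?n + 2 - 1)) / real (?n + 2)) (at x)"
        by (rule derivative_eq_intros refl | simp)+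
      also have "2 * x - 2 * (real (?n+2) * x ^ (?n + 2 - 1)) / real (?n + 2) = 2 * x - 2 * x ^ (?n + 1)"
        by (simp add: field_simps)
      finally show ?thesis .
    qed
    show ?thesis by (rule nn_integral_FTC_Icc) (use A B in auto)
  qed
  finally have "(\<integral>\<^sup>+z. ennreal ((norm z)\<^sup>2) \<partial>?N) = ennreal (real ?n / (real ?n + 2))"
    by (simp add: field_simps)
  then show ?thesis by (subst integral_eq_nn_integral) auto
qed

text \<open>The bounded support is recorded because it makes every continuous function integrable.\<close>

definition bounded_prob :: "'a::euclidean_space measure \<Rightarrow> real \<Rightarrow> bool" where
  "bounded_prob \<mu> R \<longleftrightarrow> prob_space \<mu> \<and> sets \<mu> = sets borel \<and> (AE x in \<mu>. norm x \<le> R)"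

lemma bounded_prob_ball_noise: "bounded_prob ball_noise 1"
  by (simp add: bounded_prob_def prob_space_ball_noise AE_ball_noise)

lemma bounded_prob_integrable:
  fixes f :: "'a::euclidean_space \<Rightarrow> real"
  assumes "bounded_prob \<mu> R" "continuous_on UNIV f" shows "integrable \<mu> f"
proof -
  interpret prob_space \<mu> using assms by (simp add: bounded_prob_def)
  have [measurable_cong]: "sets \<mu> = sets borel" and ae: "AE x in \<mu>. norm x \<le> R" using assms by (auto simp: bounded_prob_def)
  have "compact (f ` cball 0 R)"
    by (intro compact_continuous_image continuous_on_subset[OF assms(2)]) auto
  then obtain B where B: "\<And>x. norm x \<le> R \<Longrightarrow> norm (f x) \<le> B"
    by (metis bounded_iff compact_imp_bounded imageI mem_cball_0)
  have [measurable]: "f \<in> borel_measurable borel" by (rule borel_measurable_continuous_onI[OF assms(2)])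
  show ?thesis
    by (rule integrable_const_bound[of _ B]) (use ae B in auto)
qed

lemma bounded_prob_pair:
  assumes "bounded_prob \<mu> R" "bounded_prob \<nu> R'"
  shows "AE x in \<mu> \<Otimes>\<^sub>M \<nu>. norm (fst x) \<le> R \<and> norm (snd x) \<le> R'"
proof -
  interpret m: prob_space \<mu> using assms by (simp add: bounded_prob_def)
  interpret n: prob_space \<nu> using assms by (simp add: bounded_prob_def)
  interpret pair_prob_space \<mu> \<nu> ..
  have [measurable_cong]: "sets \<mu> = sets borel" "sets \<nu> = sets borel" using assms by (auto simp: bounded_prob_def)
  have "AE x in \<mu>. AE y in \<nu>. norm x \<le> R \<and> norm y \<le> R'"
    using assms by (auto simp: bounded_prob_def elim!: eventually_mono)
  then show ?thesis
    by (intro AE_pair_measure) (auto, measurable)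
qed

lemma bounded_prob_pair_integrable:
  fixes f :: "'a::euclidean_space \<times> 'b::euclidean_space \<Rightarrow> real"
  assumes \<mu>: "bounded_prob \<mu> R" and \<nu>: "bounded_prob \<nu> R'" and f: "continuous_on UNIV f"
  shows "integrable (\<mu> \<Otimes>\<^sub>M \<nu>) f"
proof -
  interpret m: prob_space \<mu> using assms by (simp add: bounded_prob_def)
  interpret n: prob_space \<nu> using assms by (simp add: bounded_prob_def)
  interpret pair_prob_space \<mu> \<nu> ..
  have s: "sets (\<mu> \<Otimes>\<^sub>M \<nu>) = sets borel" using assms unfolding borel_prod[symmetric]
    by (intro sets_pair_measure_cong) (auto simp: bounded_prob_def)
  have "compact (f ` (cball 0 R \<times> cball 0 R'))"
    by (intro compact_continuous_image continuous_on_subset[OF f] compact_Times) auto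
  then obtain B where B: "\<And>x. norm (fst x) \<le> R \<Longrightarrow> norm (snd x) \<le> R' \<Longrightarrow> norm (f x) \<le> B"
    by (metis (no_types, lifting) SigmaI bounded_iff compact_imp_bounded imageI mem_cball_0 prod.collapse)
  have "f \<in> borel_measurable borel" by (rule borel_measurable_continuous_onI[OF f])
  then have [measurable]: "f \<in> borel_measurable (\<mu> \<Otimes>\<^sub>M \<nu>)" by (simp add: measurable_cong_sets[OF s refl])
  show ?thesis
    by (rule integrable_const_bound[of _ B]) (rule eventually_mono[OF bounded_prob_pair[OF \<mu> \<nu>]], use B in auto)
qed

lemma bounded_prob_fubini:
  fixes f :: "'a::euclidean_space \<times> 'b::euclidean_space \<Rightarrow> real"
  assumes \<mu>: "bounded_prob \<mu> R" and \<nu>: "bounded_prob \<nu> R'" and f: "continuous_on UNIV f"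
  shows "(\<integral>x. f x \<partial>(\<mu> \<Otimes>\<^sub>M \<nu>)) = (\<integral>x. (\<integral>y. f (x, y) \<partial>\<nu>) \<partial>\<mu>)"
proof -
  interpret m: prob_space \<mu> using assms by (simp add: bounded_prob_def)
  interpret n: prob_space \<nu> using assms by (simp add: bounded_prob_def)
  interpret pair_prob_space \<mu> \<nu> ..
  show "(\<integral>x. f x \<partial>(\<mu> \<Otimes>\<^sub>M \<nu>)) = (\<integral>x. (\<integral>y. f (x, y) \<partial>\<nu>) \<partial>\<mu>)"
    using bounded_prob_pair_integrable[OF assms] by (rule integral_fst'[symmetric])
qed

text \<open>The law of \<open>u + \<Sum>i<m. \<sigma> i X\<^sub>i\<close> with independent \<open>X\<^sub>i\<close>, each uniform in the unit ball.\<close>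

primrec noisy :: "(nat \<Rightarrow> real) \<Rightarrow> 'a::euclidean_space \<Rightarrow> nat \<Rightarrow> 'a measure" where
  "noisy \<sigma> u 0 = return borel u"
| "noisy \<sigma> u (Suc m) = distr (noisy \<sigma> u m \<Otimes>\<^sub>M ball_noise) borel (\<lambda>x. fst x + \<sigma> m *\<^sub>R snd x)"

lemma bounded_prob_noisy:
  assumes "\<And>i. 0 \<le> \<sigma> i"
  shows "bounded_prob (noisy \<sigma> u m) (norm u + (\<Sum>i<m. \<sigma> i))"
proof (induction m)
  case 0
  then show ?case by (auto simp: bounded_prob_def prob_space_return AE_return)
next
  case (Suc m)
  let ?\<mu> = "noisy \<sigma> u m"
  interpret m: prob_space ?\<mu> using Suc by (simp add: bounded_prob_def)
  interpret n: prob_space "ball_noise :: 'a measure" by (rule prob_space_ball_noise)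
  interpret pair_prob_space ?\<mu> "ball_noise :: 'a measure" ..
  have s: "sets ?\<mu> = sets borel" using Suc by (simp add: bounded_prob_def)
  note [measurable_cong] = s
  have "AE x in ?\<mu> \<Otimes>\<^sub>M ball_noise. norm (fst x + \<sigma> m *\<^sub>R snd x) \<le> norm u + (\<Sum>i<Suc m. \<sigma> i)"
  proof (rule eventually_mono[OF bounded_prob_pair[OF Suc bounded_prob_ball_noise]])
    fix x :: "'a \<times> 'a" assume *: "norm (fst x) \<le> norm u + (\<Sum>i<m. \<sigma> i) \<and> norm (snd x) \<le> 1"
    have "norm (fst x + \<sigma> m *\<^sub>R snd x) \<le> norm (fst x) + \<sigma> m * norm (snd x)"
      using norm_triangle_ineq[of "fst x" "\<sigma> m *\<^sub>R snd x"] assms by simp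
    also have "\<sigma> m * norm (snd x) \<le> \<sigma> m * 1" using * assms by (intro mult_left_mono) auto
    finally show "norm (fst x + \<sigma> m *\<^sub>R snd x) \<le> norm u + (\<Sum>i<Suc m. \<sigma> i)" using * by simp
  qed
  then have "AE x in noisy \<sigma> u (Suc m). norm x \<le> norm u + (\<Sum>i<Suc m. \<sigma> i)"
    unfolding noisy.simps by (subst AE_distr_iff) auto
  moreover have "prob_space (noisy \<sigma> u (Suc m))"
    by (simp, rule prob_space_distr) measurable
  ultimately show ?case unfolding bounded_prob_def by (intro conjI) (assumption | simp)+
qed

lemma sets_noisy [measurable_cong, simp]: "sets (noisy \<sigma> u m) = sets borel"
  by (cases m) auto

lemma integral_noisy_Suc:
  fixes f :: "'a::euclidean_space \<Rightarrow> real"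
  assumes \<sigma>: "\<And>i. 0 \<le> \<sigma> i" and f: "continuous_on UNIV f"
  shows "(\<integral>v. f v \<partial>noisy \<sigma> u (Suc m)) = (\<integral>x. f (fst x + \<sigma> m *\<^sub>R snd x) \<partial>(noisy \<sigma> u m \<Otimes>\<^sub>M ball_noise))"
proof -
  have [measurable]: "f \<in> borel_measurable borel" by (rule borel_measurable_continuous_onI[OF f])
  show ?thesis by (simp, subst integral_distr) auto
qed

text \<open>The cross term vanishes because the noise is centred.\<close>

lemma mixed_second_moment:
  fixes \<mu> :: "'a::euclidean_space measure"
  assumes \<mu>: "bounded_prob \<mu> R"
  shows "(\<integral>x. (norm (\<alpha> *\<^sub>R (fst x - a) + \<beta> *\<^sub>R snd x))\<^sup>2 \<partial>(\<mu> \<Otimes>\<^sub>M ball_noise))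
    = \<alpha>\<^sup>2 * (\<integral>v. (norm (v - a))\<^sup>2 \<partial>\<mu>) + \<beta>\<^sup>2 * (real DIM('a) / (real DIM('a) + 2))"
proof -
  let ?q = "real DIM('a) / (real DIM('a) + 2)"
  interpret m: prob_space \<mu> using \<mu> by (simp add: bounded_prob_def)
  interpret n: prob_space "ball_noise :: 'a measure" by (rule prob_space_ball_noise)
  have "(\<integral>x. (norm (\<alpha> *\<^sub>R (fst x - a) + \<beta> *\<^sub>R snd x))\<^sup>2 \<partial>(\<mu> \<Otimes>\<^sub>M ball_noise))
     = (\<integral>v. (\<integral>z. (norm (\<alpha> *\<^sub>R (v - a) + \<beta> *\<^sub>R z))\<^sup>2 \<partial>ball_noise) \<partial>\<mu>)"
    by (subst bounded_prob_fubini[OF \<mu> bounded_prob_ball_noise]) (auto intro!: continuous_intros)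
  also have "\<dots> = (\<integral>v. \<alpha>\<^sup>2 * (norm (v - a))\<^sup>2 + \<beta>\<^sup>2 * ?q \<partial>\<mu>)"
  proof (rule Bochner_Integration.integral_cong[OF refl])
    fix v :: 'a
    have sq: "(norm (\<alpha> *\<^sub>R x + \<beta> *\<^sub>R z))\<^sup>2 = \<alpha>\<^sup>2 * (norm x)\<^sup>2 + (2 * \<alpha> * \<beta>) * (z \<bullet> x) + \<beta>\<^sup>2 * (norm z)\<^sup>2" for x z :: 'a
      unfolding power2_norm_eq_inner by (simp add: inner_add_left inner_add_right inner_commute[of z x] power2_eq_square algebra_simps)
    have "(norm (\<alpha> *\<^sub>R (v - a) + \<beta> *\<^sub>R z))\<^sup>2 = \<alpha>\<^sup>2 * (norm (v - a))\<^sup>2 + (2 * \<alpha> * \<beta>) * (z \<bullet> (v - a)) + \<beta>\<^sup>2 * (norm z)\<^sup>2" for z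
      by (rule sq)
    moreover have "integrable ball_noise (\<lambda>z::'a. z \<bullet> (v - a))" "integrable ball_noise (\<lambda>z::'a. (norm z)\<^sup>2)"
      by (auto intro!: integrable_ball_noise continuous_intros)
    ultimately show "(\<integral>z. (norm (\<alpha> *\<^sub>R (v - a) + \<beta> *\<^sub>R z))\<^sup>2 \<partial>ball_noise) = \<alpha>\<^sup>2 * (norm (v - a))\<^sup>2 + \<beta>\<^sup>2 * ?q"
      by (simp add: ball_noise_mean ball_noise_second_moment n.prob_space[simplified] del: distrib_left_numeral)
  qed
  also have "\<dots> = \<alpha>\<^sup>2 * (\<integral>v. (norm (v - a))\<^sup>2 \<partial>\<mu>) + \<beta>\<^sup>2 * ?q"
  proof -
    have "integrable \<mu> (\<lambda>v. (norm (v - a))\<^sup>2)" by (rule bounded_prob_integrable[OF \<mu>]) (auto intro!: continuous_intros)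
    then show ?thesis by (simp add: m.prob_space)
  qed
  finally show ?thesis .
qed

lemma noisy_second_moment:
  fixes u a :: "'a::euclidean_space"
  assumes \<sigma>: "\<And>i. 0 \<le> \<sigma> i"
  shows "(\<integral>v. (norm (v - a))\<^sup>2 \<partial>noisy \<sigma> u m) = (norm (u - a))\<^sup>2 + real DIM('a) / (real DIM('a) + 2) * (\<Sum>i<m. (\<sigma> i)\<^sup>2)"
proof (induction m)
  case 0
  then show ?case by (simp, subst integral_return) auto
next
  case (Suc m)
  have "(\<integral>v. (norm (v - a))\<^sup>2 \<partial>noisy \<sigma> u (Suc m)) = (\<integral>x. (norm (1 *\<^sub>R (fst x - a) + \<sigma> m *\<^sub>R snd x))\<^sup>2 \<partial>(noisy \<sigma> u m \<Otimes>\<^sub>M ball_noise))"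
    by (subst integral_noisy_Suc[OF \<sigma>]) (auto intro!: continuous_intros Bochner_Integration.integral_cong simp: algebra_simps)
  also have "\<dots> = 1\<^sup>2 * (\<integral>v. (norm (v - a))\<^sup>2 \<partial>noisy \<sigma> u m) + (\<sigma> m)\<^sup>2 * (real DIM('a) / (real DIM('a) + 2))"
    by (rule mixed_second_moment[OF bounded_prob_noisy[OF \<sigma>]])
  finally show ?case unfolding Suc by (simp add: algebra_simps)
qed

text \<open>Conditionally on the earlier noise the last summand alone spreads the law over a ball, so \<open>ball_noise_dominated\<close> applies with
the same radius \<open>r\<close> for every value of the earlier noise.\<close>

lemma noisy_dominated:
  fixes h :: "'a::euclidean_space \<Rightarrow> ennreal"
  assumes [measurable]: "h \<in> borel_measurable borel" and \<sigma>: "\<And>i. 0 \<le> \<sigma> i" "0 < \<sigma> m" 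
    and r: "norm u + (\<Sum>i<Suc m. \<sigma> i) \<le> r"
  shows "(\<integral>\<^sup>+v. h v \<partial>noisy \<sigma> u (Suc m)) \<le> ennreal ((r / \<sigma> m) ^ DIM('a)) * (\<integral>\<^sup>+z. h (r *\<^sub>R z) \<partial>ball_noise)"
proof -
  let ?\<mu> = "noisy \<sigma> u m"
  have b: "bounded_prob ?\<mu> (norm u + (\<Sum>i<m. \<sigma> i))" by (rule bounded_prob_noisy[OF \<sigma>(1)])
  interpret m: prob_space ?\<mu> using b by (simp add: bounded_prob_def)
  interpret n: prob_space "ball_noise :: 'a measure" by (rule prob_space_ball_noise)
  interpret pair_prob_space ?\<mu> "ball_noise :: 'a measure" ..
  have "(\<integral>\<^sup>+v. h v \<partial>noisy \<sigma> u (Suc m)) = (\<integral>\<^sup>+x. h (fst x + \<sigma> m *\<^sub>R snd x) \<partial>(?\<mu> \<Otimes>\<^sub>M ball_noise))"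
    by (simp, subst nn_integral_distr) auto
  also have "\<dots> = (\<integral>\<^sup>+v. (\<integral>\<^sup>+z. h (v + \<sigma> m *\<^sub>R z) \<partial>ball_noise) \<partial>?\<mu>)"
    by (subst n.nn_integral_fst[symmetric]) auto
  also have "\<dots> \<le> (\<integral>\<^sup>+v. ennreal ((r / \<sigma> m) ^ DIM('a)) * (\<integral>\<^sup>+z. h (r *\<^sub>R z) \<partial>ball_noise) \<partial>?\<mu>)"
  proof (rule nn_integral_mono_AE)
    show "AE v in ?\<mu>. (\<integral>\<^sup>+z. h (v + \<sigma> m *\<^sub>R z) \<partial>ball_noise) \<le> ennreal ((r / \<sigma> m) ^ DIM('a)) * (\<integral>\<^sup>+z. h (r *\<^sub>R z) \<partial>ball_noise)"
      using b unfolding bounded_prob_def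
      by (auto elim!: eventually_mono intro!: ball_noise_dominated \<sigma>(2) order_trans[OF _ r])
  qed
  finally show ?thesis by (simp add: m.emeasure_space_1)
qed

section \<open>Chaining through smoothed laws\<close>

text \<open>The second argument is a limit of simple functions; composing with each of them gives a measurable function, and continuity
passes to the limit.\<close>

lemma borel_measurable_caratheodory:
  fixes H :: "'a::euclidean_space \<Rightarrow> 'w \<Rightarrow> real"
  assumes cont: "\<And>w. w \<in> space M \<Longrightarrow> continuous_on UNIV (\<lambda>x. H x w)" and [measurable]: "\<And>x. H x \<in> borel_measurable M"
  shows "(\<lambda>p. H (snd p) (fst p)) \<in> borel_measurable (M \<Otimes>\<^sub>M borel)"
proof -
  have "(\<lambda>x. x) \<in> borel_measurable (borel :: 'a measure)" by simp
  from borel_measurable_implies_sequence_metric[OF this, of 0]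
  obtain F :: "nat \<Rightarrow> 'a \<Rightarrow> 'a" where F: "\<And>i. simple_function borel (F i)" "\<And>x. (\<lambda>i. F i x) \<longlonglongrightarrow> x"
    by auto
  have "(\<lambda>p. H (F i (snd p)) (fst p)) \<in> borel_measurable (M \<Otimes>\<^sub>M borel)" for i
  proof (rule measurable_compose_countable'[where I="range (F i)" and g="\<lambda>p. F i (snd p)" and f="\<lambda>y p. H y (fst p)"])
    have "F i \<in> measurable borel (count_space UNIV)" using F(1)[of i] by (rule measurable_simple_function)
    then have "F i \<in> measurable borel (count_space (range (F i)))"
      by (subst measurable_count_space_eq2) (use F(1)[of i] in \<open>auto simp: simple_function_def\<close>)
    then show "(\<lambda>p. F i (snd p)) \<in> measurable (M \<Otimes>\<^sub>M borel) (count_space (range (F i)))"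
      by (rule measurable_compose[OF measurable_snd])
    show "countable (range (F i))" using F(1)[of i] by (simp add: simple_function_def countable_finite)
  qed measurable
  then show ?thesis
  proof (rule borel_measurable_LIMSEQ_real[rotated])
    fix p :: "'w \<times> 'a" assume "p \<in> space (M \<Otimes>\<^sub>M borel)"
    then have "isCont (\<lambda>x. H x (fst p)) (snd p)"
      using cont[of "fst p"] by (auto simp: space_pair_measure continuous_on_eq_continuous_at)
    then show "(\<lambda>i. H (F i (snd p)) (fst p)) \<longlonglongrightarrow> H (snd p) (fst p)"
      by (rule isCont_tendsto_compose[OF _ F(2)])
  qed
qed

lemma ennreal_integral_le_nn_integral:
  fixes f g :: "'a \<Rightarrow> real"
  assumes "integrable M f" "\<And>x. f x \<le> g x"
  shows "ennreal (\<integral>x. f x \<partial>M) \<le> (\<integral>\<^sup>+x. ennreal (g x) \<partial>M)"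
proof -
  have fin: "(\<integral>\<^sup>+x. ennreal (f x) \<partial>M) < \<infinity>"
    using assms(1) by (auto simp: real_integrable_def top.not_eq_extremum less_top)
  have "(\<integral>x. f x \<partial>M) \<le> enn2real (\<integral>\<^sup>+x. ennreal (f x) \<partial>M)"
    by (subst real_lebesgue_integral_def[OF assms(1)]) simp
  then have "ennreal (\<integral>x. f x \<partial>M) \<le> (\<integral>\<^sup>+x. ennreal (f x) \<partial>M)"
    using fin by (metis ennreal_enn2real ennreal_leI infinity_ennreal_def)
  also have "\<dots> \<le> (\<integral>\<^sup>+x. ennreal (g x) \<partial>M)"
    using assms(2) by (intro nn_integral_mono ennreal_leI)
  finally show ?thesis .
qed

lemma ennreal_add_le: "ennreal (x + y) \<le> ennreal x + ennreal y"
  by (cases "x \<le> 0"; cases "y \<le> 0")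
     (auto simp: ennreal_neg intro!: ennreal_leI simp flip: ennreal_plus)

lemma ennreal_sum_le: "ennreal (\<Sum>i\<in>A. f i) \<le> (\<Sum>i\<in>A. ennreal (f i))"
proof (induction A rule: infinite_finite_induct)
  case (insert x F)
  then show ?case by (simp add: order_trans[OF ennreal_add_le add_left_mono])
qed auto

text \<open>The exponential of twice the increment per unit length.  The value \<open>1\<close> on the diagonal keeps its expectation at most \<open>exp A\<close>
when \<open>A \<ge> 0\<close>.\<close>

definition increment_exp :: "('a::euclidean_space \<Rightarrow> real) \<Rightarrow> 'a \<Rightarrow> 'a \<Rightarrow> real" where
  "increment_exp h a b = (if a = b then 1 else exp (2 * (h a - h b) / dist a b))"

text \<open>The tangent inequality \<open>exp y \<ge> 1 + y\<close> at \<open>y = F - J - X\<close>, where \<open>F\<close> is the increment divided by half the length.  Multiplying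
by half the length makes the increment itself appear.  In use, \<open>J\<close> is the logarithm of a density ratio and \<open>X\<close> the quantity to
be bounded.\<close>

lemma increment_exp_tangent:
  "exp X * (dist a b / 2 * (1 - J - X) + (h a - h b)) \<le> dist a b / 2 * increment_exp h a b * exp (- J)"
proof (cases "a = b")
  case False
  let ?F = "2 * (h a - h b) / dist a b"
  have "1 + (?F - J - X) \<le> exp (?F - J - X)" by (rule exp_ge_add_one_self)
  then have "exp X * (dist a b / 2) * (1 + (?F - J - X)) \<le> exp X * (dist a b / 2) * exp (?F - J - X)"
    by (intro mult_left_mono) auto
  also have "\<dots> = dist a b / 2 * exp ?F * exp (- J)"
    by (simp add: exp_diff exp_minus exp_add field_simps)
  also have "exp X * (dist a b / 2) * (1 + (?F - J - X)) = exp X * (dist a b / 2 * (1 - J - X) + (h a - h b))"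
    using False by (simp add: field_simps)
  finally show ?thesis using False by (simp add: increment_exp_def)
qed simp

text \<open>If the total weight \<open>\<omega>\<close> of the tangent inequalities falls short of \<open>1\<close>, the missing weight is filled with the inequality
\<open>exp X (1 - X) \<le> 1\<close>.\<close>

lemma exp_weighted_gap:
  fixes X \<omega> :: real assumes "\<omega> \<le> 1"
  shows "exp X \<le> exp X * (\<omega> + X - X * \<omega>) + (1 - \<omega>)"
proof -
  have "1 + (- X) \<le> exp (- X)" by (rule exp_ge_add_one_self)
  then have "exp X * (1 - X) \<le> exp X * exp (- X)" by (intro mult_left_mono) auto
  then have "exp X * (1 - X) \<le> 1" by (simp add: exp_minus)
  then have "(1 - \<omega>) * (exp X * (1 - X)) \<le> (1 - \<omega>) * 1" using assms by (intro mult_left_mono) auto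
  then show ?thesis by (simp add: algebra_simps)
qed

text \<open>The chain behind the bound for \<open>exp (H (u i) - \<Sum> q j H (u j))\<close>.  For a pair \<open>(i, j)\<close> it leads from \<open>u i\<close> to \<open>t u j\<close>: its \<open>m\<close>-th point
is \<open>start j + S m (v - start j)\<close>, where \<open>v\<close> has the law \<open>noisy \<sigma> (u i) m\<close>, so that the noise grows while the factor \<open>S m\<close> shrinks
from \<open>1\<close> to \<open>0\<close>.  One more link joins \<open>t u j\<close> to \<open>u j\<close>.  The law \<open>\<nu> m\<close> dominates the \<open>m\<close>-th smoothed law of every point, with density
at most \<open>exp (info m)\<close>; hence the maximum over \<open>i\<close> costs nothing beyond \<open>info\<close>.\<close>

locale noise_chain =
  fixes I :: "'i set" and u :: "'i \<Rightarrow> 'a::euclidean_space" and q :: "'i \<Rightarrow> real"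
    and t :: real and S \<sigma> :: "nat \<Rightarrow> real" and K :: nat
    and info :: "nat \<Rightarrow> real" and \<nu> :: "nat \<Rightarrow> 'a measure" and R :: "nat \<Rightarrow> real"
  assumes I: "finite I" "I \<noteq> {}"
    and q: "\<And>i. i \<in> I \<Longrightarrow> 0 \<le> q i" "(\<Sum>i\<in>I. q i) = 1"
    and u: "\<And>i. i \<in> I \<Longrightarrow> norm (u i) \<le> 1"
    and t: "0 \<le> t" "t \<le> 1"
    and S: "S 0 = 1" "S (Suc K) = 0"
    and \<sigma>: "\<And>m. 0 \<le> \<sigma> m"
    and \<nu>: "\<And>m. bounded_prob (\<nu> m) (R m)"
    and dominated: "\<And>m i h. m \<le> K \<Longrightarrow> i \<in> I \<Longrightarrow> h \<in> borel_measurable borel \<Longrightarrow>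
          (\<integral>\<^sup>+v. h v \<partial>noisy \<sigma> (u i) m) \<le> ennreal (exp (info m)) * (\<integral>\<^sup>+v. h v \<partial>\<nu> m)"
begin

definition start :: "'i \<Rightarrow> 'a" where "start j = t *\<^sub>R u j"
text \<open>The end points of the \<open>m\<close>-th link, as functions of the current smoothed point and of the next noise variable.\<close>

definition upper :: "'i \<Rightarrow> nat \<Rightarrow> 'a \<times> 'a \<Rightarrow> 'a" where
  "upper j m x = start j + S m *\<^sub>R (fst x - start j)"
definition lower :: "'i \<Rightarrow> nat \<Rightarrow> 'a \<times> 'a \<Rightarrow> 'a" where
  "lower j m x = start j + S (Suc m) *\<^sub>R (fst x + \<sigma> m *\<^sub>R snd x - start j)"
definition len :: "'i \<Rightarrow> nat \<Rightarrow> 'a \<times> 'a \<Rightarrow> real" where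
  "len j m x = dist (upper j m x) (lower j m x)"
definition pairs :: "'i \<Rightarrow> nat \<Rightarrow> ('a \<times> 'a) measure" where
  "pairs i m = noisy \<sigma> (u i) m \<Otimes>\<^sub>M ball_noise"
definition ref_pairs :: "nat \<Rightarrow> ('a \<times> 'a) measure" where
  "ref_pairs m = \<nu> m \<Otimes>\<^sub>M ball_noise"
text \<open>Expected half-lengths of the links, averaged over the target \<open>j\<close>: from the point \<open>i\<close>, and under the reference laws.\<close>

definition weight :: "'i \<Rightarrow> nat \<Rightarrow> real" where
  "weight i m = (\<Sum>j\<in>I. q j * (\<integral>x. len j m x / 2 \<partial>pairs i m))"
definition ref_weight :: "nat \<Rightarrow> real" where
  "ref_weight m = (\<Sum>j\<in>I. q j * (\<integral>x. len j m x / 2 \<partial>ref_pairs m))"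

lemma continuous_upper [continuous_intros]: "continuous_on UNIV (upper j m)"
  and continuous_lower [continuous_intros]: "continuous_on UNIV (lower j m)"
  and continuous_len [continuous_intros]: "continuous_on UNIV (len j m)"
  unfolding upper_def lower_def len_def by (intro continuous_intros)+

lemma bounded_noisy: "bounded_prob (noisy \<sigma> (u i) m) (norm (u i) + (\<Sum>i<m. \<sigma> i))"
  by (rule bounded_prob_noisy[OF \<sigma>])

lemma integrable_pairs: "continuous_on UNIV f \<Longrightarrow> integrable (pairs i m) (f :: _ \<Rightarrow> real)"
  unfolding pairs_def by (rule bounded_prob_pair_integrable[OF bounded_noisy bounded_prob_ball_noise])

lemma integrable_ref_pairs: "continuous_on UNIV f \<Longrightarrow> integrable (ref_pairs m) (f :: _ \<Rightarrow> real)"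
  unfolding ref_pairs_def by (rule bounded_prob_pair_integrable[OF \<nu> bounded_prob_ball_noise])

lemma sets_pairs [measurable_cong]: "sets (pairs i m) = sets borel"
  unfolding pairs_def borel_prod[symmetric] by (intro sets_pair_measure_cong) auto

lemma sets_ref_pairs [measurable_cong]: "sets (ref_pairs m) = sets borel"
  using \<nu>[of m] unfolding ref_pairs_def borel_prod[symmetric] bounded_prob_def
  by (intro sets_pair_measure_cong) auto

text \<open>The lower end of one link and the upper end of the next have the same law, so the expected increments telescope.\<close>

lemma telescope:
  fixes h :: "'a \<Rightarrow> real"
  assumes h: "continuous_on UNIV h"
  shows "h (u i) - h (start j) = (\<Sum>m\<le>K. \<integral>x. h (upper j m x) - h (lower j m x) \<partial>pairs i m)"
proof -
  define \<Phi> where "\<Phi> m = (\<integral>v. h (start j + S m *\<^sub>R (v - start j)) \<partial>noisy \<sigma> (u i) m)" for m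
  have c: "continuous_on UNIV (\<lambda>x. h (f x))" if "continuous_on UNIV f" for f :: "'c::topological_space \<Rightarrow> 'a"
    by (rule continuous_on_compose2[OF h that]) auto
  have "(\<integral>x. h (upper j m x) - h (lower j m x) \<partial>pairs i m) = \<Phi> m - \<Phi> (Suc m)" for m
  proof -
    interpret n: prob_space "ball_noise :: 'a measure" by (rule prob_space_ball_noise)
    have "(\<integral>x. h (upper j m x) - h (lower j m x) \<partial>pairs i m) = (\<integral>x. h (upper j m x) \<partial>pairs i m) - (\<integral>x. h (lower j m x) \<partial>pairs i m)"
      using integrable_pairs[OF c[OF continuous_upper]] integrable_pairs[OF c[OF continuous_lower]]
      by (rule Bochner_Integration.integral_diff)
    also have "(\<integral>x. h (upper j m x) \<partial>pairs i m) = \<Phi> m"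
      unfolding pairs_def upper_def \<Phi>_def
      by (subst bounded_prob_fubini[OF bounded_noisy bounded_prob_ball_noise])
         (auto intro!: c continuous_intros simp: n.prob_space[simplified])
    also have "(\<integral>x. h (lower j m x) \<partial>pairs i m) = \<Phi> (Suc m)"
      unfolding pairs_def lower_def \<Phi>_def
      by (subst integral_noisy_Suc[OF \<sigma>]) (auto intro!: c continuous_intros)
    finally show ?thesis .
  qed
  then have "(\<Sum>m\<le>K. \<integral>x. h (upper j m x) - h (lower j m x) \<partial>pairs i m) = (\<Sum>m\<le>K. \<Phi> m - \<Phi> (Suc m))" by simp
  also have "\<dots> = \<Phi> 0 - \<Phi> (Suc K)" by (rule sum_telescope)
  also have "\<Phi> 0 = h (u i)"
    unfolding \<Phi>_def using borel_measurable_continuous_onI[OF h] S by (simp, subst integral_return) auto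
  also have "\<Phi> (Suc K) = h (start j)"
  proof -
    interpret prob_space "noisy \<sigma> (u i) (Suc K)" using bounded_noisy[of i "Suc K"] unfolding bounded_prob_def by blast
    show ?thesis unfolding \<Phi>_def S using prob_space by (simp del: noisy.simps)
  qed
  finally show ?thesis by simp
qed

definition tilt :: "'i \<Rightarrow> real" where "tilt i = (\<Sum>m\<le>K. weight i m * info m)"

text \<open>A bound for all \<open>i\<close> at once: the constant collects the weight that no link uses, the second summand the links from \<open>t u j\<close> to \<open>u j\<close>,
and the third the links under the reference laws.\<close>

definition envelope :: "('a \<Rightarrow> real) \<Rightarrow> ennreal" where
  "envelope h = ennreal ((1 + t) / 2)
     + (\<Sum>j\<in>I. ennreal (q j) * ennreal ((1 - t) / 2 * exp (2 * (h (start j) - h (u j)) / (1 - t))))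
     + (\<Sum>m\<le>K. \<Sum>j\<in>I. ennreal (q j) * (\<integral>\<^sup>+x. ennreal (len j m x / 2 * increment_exp h (upper j m x) (lower j m x)) \<partial>ref_pairs m))"

lemma measurable_increment_exp:
  assumes h: "continuous_on UNIV h"
  shows "(\<lambda>x. len j m x / 2 * increment_exp h (upper j m x) (lower j m x)) \<in> borel_measurable borel"
proof -
  have [measurable]: "h \<in> borel_measurable borel" "upper j m \<in> borel_measurable borel" "lower j m \<in> borel_measurable borel" "len j m \<in> borel_measurable borel"
    by (intro borel_measurable_continuous_onI h continuous_intros)+
  show ?thesis unfolding increment_exp_def by measurable
qed

text \<open>Each link contributes a tangent inequality at the common point \<open>X\<close>, the left-hand exponent, shifted by the information of the
link.  Summed with the link weights, the increments telescope to \<open>h (u i) - \<Sum> q j h (u j)\<close> and the shifts add up to \<open>tilt i\<close>.  The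
difference is \<open>X\<close> again, so the left-hand sides add up to \<open>exp X (\<omega> + X - X \<omega>)\<close> with the total weight \<open>\<omega>\<close>, and
\<open>exp_weighted_gap\<close> applies.\<close>

lemma pathwise_bound:
  assumes h: "continuous_on UNIV h" and i: "i \<in> I" and total: "(1 - t) / 2 + (\<Sum>m\<le>K. weight i m) \<le> 1"
  shows "ennreal (exp (h (u i) - (\<Sum>j\<in>I. q j * h (u j)) - tilt i)) \<le> envelope h"
proof -
  define X where "X = h (u i) - (\<Sum>j\<in>I. q j * h (u j)) - tilt i"
  have c: "continuous_on UNIV (\<lambda>x. h (f x))" if "continuous_on UNIV f" for f :: "'c::topological_space \<Rightarrow> 'a"
    by (rule continuous_on_compose2[OF h that]) auto
  define w where "w j m = (\<integral>x. len j m x / 2 \<partial>pairs i m)" for j m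
  define D where "D j m = (\<integral>x. h (upper j m x) - h (lower j m x) \<partial>pairs i m)" for j m
  define P where "P j = exp (2 * (h (start j) - h (u j)) / (1 - t))" for j
  define \<omega> where "\<omega> = (1 - t) / 2 + (\<Sum>m\<le>K. weight i m)"
  have wt: "weight i m = (\<Sum>j\<in>I. q j * w j m)" for m by (simp add: weight_def w_def)
  have link: "ennreal (exp X * (w j m * (1 - info m - X) + D j m)) \<le> (\<integral>\<^sup>+x. ennreal (len j m x / 2 * increment_exp h (upper j m x) (lower j m x)) \<partial>ref_pairs m)"
    (is "_ \<le> ?R") if "m \<le> K" for j m
  proof -
    have i1: "integrable (pairs i m) (len j m)" and i2: "integrable (pairs i m) (\<lambda>x. h (upper j m x) - h (lower j m x))"
      by (intro integrable_pairs continuous_len Bochner_Integration.integrable_diff c[OF continuous_upper] c[OF continuous_lower])+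
    have e1: "exp X * (w j m * (1 - info m - X) + D j m) = (\<integral>x. exp X * (len j m x / 2 * (1 - info m - X) + (h (upper j m x) - h (lower j m x))) \<partial>pairs i m)"
      unfolding w_def D_def using i1 i2 by simp
    have "ennreal (exp X * (w j m * (1 - info m - X) + D j m)) \<le> (\<integral>\<^sup>+x. ennreal (len j m x / 2 * increment_exp h (upper j m x) (lower j m x) * exp (- info m)) \<partial>pairs i m)"
      unfolding e1
    proof (rule ennreal_integral_le_nn_integral)
      show "integrable (pairs i m) (\<lambda>x. exp X * (len j m x / 2 * (1 - info m - X) + (h (upper j m x) - h (lower j m x))))"
        using i1 i2 by auto
    qed (use increment_exp_tangent[of X _ _ _ h] in \<open>simp add: len_def\<close>)
    also have "\<dots> = (\<integral>\<^sup>+x. ennreal (exp (- info m)) * ennreal (len j m x / 2 * increment_exp h (upper j m x) (lower j m x)) \<partial>pairs i m)"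
    proof (rule nn_integral_cong)
      fix x
      have "0 \<le> len j m x / 2 * increment_exp h (upper j m x) (lower j m x)" by (simp add: len_def increment_exp_def)
      then show "ennreal (len j m x / 2 * increment_exp h (upper j m x) (lower j m x) * exp (- info m)) = ennreal (exp (- info m)) * ennreal (len j m x / 2 * increment_exp h (upper j m x) (lower j m x))"
        by (subst ennreal_mult[symmetric]) (simp_all add: mult.commute)
    qed
    also have "\<dots> = ennreal (exp (- info m)) * (\<integral>\<^sup>+x. ennreal (len j m x / 2 * increment_exp h (upper j m x) (lower j m x)) \<partial>pairs i m)"
      by (rule nn_integral_cmult) (use measurable_increment_exp[OF h] in \<open>simp add: measurable_cong_sets[OF sets_pairs refl]\<close>)
    \<comment> \<open>Only the first coordinate depends on \<open>i\<close>, so the domination of its law suffices.\<close>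
    also have "(\<integral>\<^sup>+x. ennreal (len j m x / 2 * increment_exp h (upper j m x) (lower j m x)) \<partial>pairs i m) \<le> ennreal (exp (info m)) * ?R"
    proof -
      interpret n: prob_space "ball_noise :: 'a measure" by (rule prob_space_ball_noise)
      define G where "G x = ennreal (len j m x / 2 * increment_exp h (upper j m x) (lower j m x))" for x
      have G: "G \<in> borel_measurable borel" unfolding G_def using measurable_increment_exp[OF h] by measurable
      have bn: "sets (\<nu> m) = sets borel" using \<nu> by (auto simp: bounded_prob_def)
      have Gb: "G \<in> borel_measurable (borel \<Otimes>\<^sub>M ball_noise)" 
        using G by (simp add: borel_prod[symmetric] cong: measurable_cong_sets sets_pair_measure_cong)
      have [measurable]: "(\<lambda>v. \<integral>\<^sup>+z. G (v, z) \<partial>ball_noise) \<in> borel_measurable borel"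
        using Gb by (rule n.borel_measurable_nn_integral_fst)
      have "(\<integral>\<^sup>+x. G x \<partial>pairs i m) = (\<integral>\<^sup>+v. (\<integral>\<^sup>+z. G (v, z) \<partial>ball_noise) \<partial>noisy \<sigma> (u i) m)"
        unfolding pairs_def using Gb by (intro n.nn_integral_fst[symmetric]) (simp cong: measurable_cong_sets sets_pair_measure_cong)
      also have "\<dots> \<le> ennreal (exp (info m)) * (\<integral>\<^sup>+v. (\<integral>\<^sup>+z. G (v, z) \<partial>ball_noise) \<partial>\<nu> m)"
        by (rule dominated) (use that i in auto)
      also have "(\<integral>\<^sup>+v. (\<integral>\<^sup>+z. G (v, z) \<partial>ball_noise) \<partial>\<nu> m) = (\<integral>\<^sup>+x. G x \<partial>ref_pairs m)"
        unfolding ref_pairs_def using Gb bn by (intro n.nn_integral_fst) (simp cong: measurable_cong_sets sets_pair_measure_cong)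
      finally show ?thesis by (simp add: G_def)
    qed
    also have "ennreal (exp (- info m)) * (ennreal (exp (info m)) * ?R) = ?R"
      by (simp add: mult.assoc[symmetric] ennreal_mult[symmetric] exp_minus)
    finally show ?thesis by (simp add: mult_left_mono)
  qed
  have pivot: "exp X * ((1 - t) / 2 * (1 - X) + (h (start j) - h (u j))) \<le> (1 - t) / 2 * P j" if "j \<in> I" for j
  proof (cases "t = 1")
    case True
    have "start j = u j" unfolding start_def by (simp add: True)
    then show ?thesis unfolding \<open>start j = u j\<close> by (simp add: True)
  next
    case False
    then have t1: "1 - t > 0" using t by simp
    let ?F = "2 * (h (start j) - h (u j)) / (1 - t)"
    have "1 + (?F - X) \<le> exp (?F - X)" by (rule exp_ge_add_one_self)
    then have "exp X * ((1 - t) / 2) * (1 + (?F - X)) \<le> exp X * ((1 - t) / 2) * exp (?F - X)"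
      using t1 by (intro mult_left_mono) auto
    also have "\<dots> = (1 - t) / 2 * P j" by (simp add: exp_diff P_def)
    also have "exp X * ((1 - t) / 2) * (1 + (?F - X)) = exp X * ((1 - t) / 2 * (1 - X) + (h (start j) - h (u j)))"
      using t1 by (simp add: field_simps)
    finally show ?thesis .
  qed
  have "(\<Sum>j\<in>I. q j * (exp X * ((1 - t) / 2 * (1 - X) + (h (start j) - h (u j))))) + (\<Sum>m\<le>K. \<Sum>j\<in>I. q j * (exp X * (w j m * (1 - info m - X) + D j m)))
    = exp X * (\<omega> + X - X * \<omega>)"
  proof -
    have XX: "h (u i) = X + (\<Sum>j\<in>I. q j * h (u j)) + tilt i" by (simp add: X_def)
    have s1: "(\<Sum>j\<in>I. q j * ((1 - t) / 2 * (1 - X) + (h (start j) - h (u j)))) = (1 - t) / 2 * (1 - X) + (\<Sum>j\<in>I. q j * h (start j)) - (\<Sum>j\<in>I. q j * h (u j))"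
    proof -
      have "(\<Sum>j\<in>I. q j * ((1 - t) / 2 * (1 - X) + (h (start j) - h (u j)))) = (\<Sum>j\<in>I. ((1 - t) / 2 * (1 - X)) * q j + (q j * h (start j) - q j * h (u j)))"
        by (intro sum.cong refl) (simp only: algebra_simps)
      also have "\<dots> = (1 - t) / 2 * (1 - X) * (\<Sum>j\<in>I. q j) + ((\<Sum>j\<in>I. q j * h (start j)) - (\<Sum>j\<in>I. q j * h (u j)))"
        unfolding sum.distrib sum_subtractf sum_distrib_left[symmetric] ..
      finally show ?thesis using q(2) by simp
    qed
    have s2: "(\<Sum>j\<in>I. q j * (w j m * (1 - info m - X) + D j m)) = weight i m * (1 - info m - X) + (\<Sum>j\<in>I. q j * D j m)" for m
      unfolding wt by (simp add: distrib_left sum.distrib sum_distrib_right mult.assoc)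
    have "(\<Sum>m\<le>K. \<Sum>j\<in>I. q j * D j m) = (\<Sum>j\<in>I. q j * (\<Sum>m\<le>K. D j m))"
      by (subst sum.swap) (simp add: sum_distrib_left)
    also have "\<dots> = (\<Sum>j\<in>I. q j * (h (u i) - h (start j)))"
      unfolding D_def telescope[OF h] ..
    also have "\<dots> = h (u i) - (\<Sum>j\<in>I. q j * h (start j))"
      using q(2) by (simp add: right_diff_distrib sum_subtractf sum_distrib_right[symmetric])
    finally have s3: "(\<Sum>m\<le>K. \<Sum>j\<in>I. q j * D j m) = h (u i) - (\<Sum>j\<in>I. q j * h (start j))" .
    have s4: "(\<Sum>m\<le>K. \<Sum>j\<in>I. q j * (w j m * (1 - info m - X) + D j m)) = (\<Sum>m\<le>K. weight i m) * (1 - X) - tilt i + h (u i) - (\<Sum>j\<in>I. q j * h (start j))"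
      unfolding s2 sum.distrib s3 tilt_def by (simp add: right_diff_distrib sum_subtractf sum_distrib_right[symmetric])
    have "(\<Sum>j\<in>I. q j * (exp X * ((1 - t) / 2 * (1 - X) + (h (start j) - h (u j))))) + (\<Sum>m\<le>K. \<Sum>j\<in>I. q j * (exp X * (w j m * (1 - info m - X) + D j m)))
      = exp X * ((\<Sum>j\<in>I. q j * ((1 - t) / 2 * (1 - X) + (h (start j) - h (u j)))) + (\<Sum>m\<le>K. \<Sum>j\<in>I. q j * (w j m * (1 - info m - X) + D j m)))"
      by (simp add: sum_distrib_left distrib_left mult.left_commute)
    also have "\<dots> = exp X * (\<omega> + X - X * \<omega>)"
      unfolding s1 s4 \<omega>_def XX by (simp add: field_simps)
    finally show ?thesis .
  qed
  then have "exp X \<le> (1 - \<omega>) + (\<Sum>j\<in>I. q j * (exp X * ((1 - t) / 2 * (1 - X) + (h (start j) - h (u j))))) + (\<Sum>m\<le>K. \<Sum>j\<in>I. q j * (exp X * (w j m * (1 - info m - X) + D j m)))"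
    using exp_weighted_gap[of \<omega> X] total by (simp add: \<omega>_def)
  also have "1 - \<omega> \<le> (1 + t) / 2"
  proof -
    have "0 \<le> w j m" for j m unfolding w_def by (intro Bochner_Integration.integral_nonneg) (simp add: len_def)
    then have "0 \<le> weight i m" for m unfolding wt using q(1) by (intro sum_nonneg) auto
    then have "0 \<le> (\<Sum>m\<le>K. weight i m)" by (intro sum_nonneg)
    then show ?thesis by (simp add: \<omega>_def field_simps)
  qed
  also have "(\<Sum>j\<in>I. q j * (exp X * ((1 - t) / 2 * (1 - X) + (h (start j) - h (u j))))) \<le> (\<Sum>j\<in>I. q j * ((1 - t) / 2 * P j))"
    using q(1) pivot by (intro sum_mono mult_left_mono) auto
  finally have "ennreal (exp X) \<le> ennreal ((1 + t) / 2 + (\<Sum>j\<in>I. q j * ((1 - t) / 2 * P j)) + (\<Sum>m\<le>K. \<Sum>j\<in>I. q j * (exp X * (w j m * (1 - info m - X) + D j m))))"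
    by (intro ennreal_leI) simp
  also have "\<dots> \<le> ennreal ((1 + t) / 2) + (\<Sum>j\<in>I. ennreal (q j * ((1 - t) / 2 * P j))) + (\<Sum>m\<le>K. \<Sum>j\<in>I. ennreal (q j * (exp X * (w j m * (1 - info m - X) + D j m))))"
    by (intro order_trans[OF ennreal_add_le] add_mono order_refl ennreal_sum_le order_trans[OF ennreal_sum_le sum_mono])
  also have "\<dots> \<le> envelope h"
    unfolding envelope_def P_def
  proof (intro add_mono order_refl sum_mono)
    fix j assume "j \<in> I"
    have "0 \<le> (1 - t) / 2 * exp (2 * (h (start j) - h (u j)) / (1 - t))" using t by simp
    then show "ennreal (q j * ((1 - t) / 2 * exp (2 * (h (start j) - h (u j)) / (1 - t)))) \<le> ennreal (q j) * ennreal ((1 - t) / 2 * exp (2 * (h (start j) - h (u j)) / (1 - t)))"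
      by (simp only: ennreal_mult[OF q(1)[OF \<open>j \<in> I\<close>]] order_refl)
  next
    fix m j assume "m \<in> {..K}" "j \<in> I"
    have "ennreal (q j * (exp X * (w j m * (1 - info m - X) + D j m))) \<le> ennreal (q j) * ennreal (exp X * (w j m * (1 - info m - X) + D j m))"
      using q(1)[OF \<open>j \<in> I\<close>] by (cases "0 \<le> exp X * (w j m * (1 - info m - X) + D j m)") (auto simp: ennreal_mult mult_nonneg_nonpos ennreal_neg)
    also have "\<dots> \<le> ennreal (q j) * (\<integral>\<^sup>+x. ennreal (len j m x / 2 * increment_exp h (upper j m x) (lower j m x)) \<partial>ref_pairs m)"
      using link \<open>m \<in> {..K}\<close> by (intro mult_left_mono) auto
    finally show "ennreal (q j * (exp X * (w j m * (1 - info m - X) + D j m))) \<le> ennreal (q j) * (\<integral>\<^sup>+x. ennreal (len j m x / 2 * increment_exp h (upper j m x) (lower j m x)) \<partial>ref_pairs m)" .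
  qed
  finally show ?thesis unfolding X_def .
qed

text \<open>Every exponential in the envelope has expectation at most \<open>exp A\<close>, and the coefficients add up to \<open>1 + \<Sum> ref_weight\<close>: the two
constants \<open>(1 + t) / 2\<close> and \<open>(1 - t) / 2\<close> sum to one.\<close>

lemma expectation_envelope:
  fixes H :: "'a \<Rightarrow> 'w \<Rightarrow> real"
  assumes M: "prob_space M"
    and cont: "\<And>w. w \<in> space M \<Longrightarrow> continuous_on UNIV (\<lambda>x. H x w)" and H [measurable]: "\<And>x. H x \<in> borel_measurable M"
    and A: "0 \<le> A"
    and incr: "\<And>x y d. 0 < d \<Longrightarrow> dist x y \<le> d \<Longrightarrow> (\<integral>\<^sup>+w. ennreal (exp (2 * (H x w - H y w) / d)) \<partial>M) \<le> ennreal (exp A)"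
  shows "(\<integral>\<^sup>+w. envelope (\<lambda>x. H x w) \<partial>M) \<le> ennreal (exp A * (1 + (\<Sum>m\<le>K. ref_weight m)))"
proof -
  interpret M: prob_space M by (rule M)
  define T where "T w j m = (\<integral>\<^sup>+x. ennreal (len j m x / 2 * increment_exp (\<lambda>x. H x w) (upper j m x) (lower j m x)) \<partial>ref_pairs m)" for w j m
  have car: "(\<lambda>p. H (snd p) (fst p)) \<in> borel_measurable (M \<Otimes>\<^sub>M borel)"
    by (rule borel_measurable_caratheodory[OF cont H])
  have G: "(\<lambda>p. ennreal (len j m (snd p) / 2 * increment_exp (\<lambda>x. H x (fst p)) (upper j m (snd p)) (lower j m (snd p)))) \<in> borel_measurable (M \<Otimes>\<^sub>M ref_pairs m)" for j m
  proof -
    have [measurable]: "upper j m \<in> borel_measurable borel" "lower j m \<in> borel_measurable borel" "len j m \<in> borel_measurable borel"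
      by (intro borel_measurable_continuous_onI continuous_intros)+
    have [measurable]: "(\<lambda>p. H (upper j m (snd p)) (fst p)) \<in> borel_measurable (M \<Otimes>\<^sub>M ref_pairs m)"
      using measurable_compose[OF _ car, of "\<lambda>p. (fst p, upper j m (snd p))" "M \<Otimes>\<^sub>M ref_pairs m"] by simp
    have [measurable]: "(\<lambda>p. H (lower j m (snd p)) (fst p)) \<in> borel_measurable (M \<Otimes>\<^sub>M ref_pairs m)"
      using measurable_compose[OF _ car, of "\<lambda>p. (fst p, lower j m (snd p))" "M \<Otimes>\<^sub>M ref_pairs m"] by simp
    show ?thesis unfolding increment_exp_def by measurable
  qed
  have prob_ref: "prob_space (ref_pairs m)" for m
  proof -
    interpret a: prob_space "\<nu> m" using \<nu>[of m] by (simp add: bounded_prob_def)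
    interpret b: prob_space "ball_noise :: 'a measure" by (rule prob_space_ball_noise)
    interpret pair_prob_space "\<nu> m" "ball_noise :: 'a measure" ..
    show ?thesis unfolding ref_pairs_def by (rule prob_space_axioms)
  qed
  have T [measurable]: "(\<lambda>w. T w j m) \<in> borel_measurable M" for j m
  proof -
    interpret r: prob_space "ref_pairs m" by (rule prob_ref)
    show ?thesis unfolding T_def using r.borel_measurable_nn_integral_fst[OF G[of j m]] by simp
  qed
  have link: "(\<integral>\<^sup>+w. T w j m \<partial>M) \<le> ennreal (exp A * (\<integral>x. len j m x / 2 \<partial>ref_pairs m))" for j m
  proof -
    interpret r: prob_space "ref_pairs m" by (rule prob_ref)
    interpret pair_prob_space M "ref_pairs m" ..
    have "(\<integral>\<^sup>+w. T w j m \<partial>M) = (\<integral>\<^sup>+x. (\<integral>\<^sup>+w. ennreal (len j m x / 2 * increment_exp (\<lambda>x. H x w) (upper j m x) (lower j m x)) \<partial>M) \<partial>ref_pairs m)"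
      unfolding T_def using Fubini'[of "\<lambda>w x. ennreal (len j m x / 2 * increment_exp (\<lambda>x. H x w) (upper j m x) (lower j m x))"] G[of j m]
      by (simp add: case_prod_unfold)
    also have "\<dots> \<le> (\<integral>\<^sup>+x. ennreal (exp A) * ennreal (len j m x / 2) \<partial>ref_pairs m)"
    proof (rule nn_integral_mono)
      fix x
      have 1: "(\<integral>\<^sup>+w. ennreal (increment_exp (\<lambda>x. H x w) (upper j m x) (lower j m x)) \<partial>M) \<le> ennreal (exp A)"
      proof (cases "upper j m x = lower j m x")
        case True
        then show ?thesis using A by (simp add: increment_exp_def M.emeasure_space_1 ennreal_ge_1)
      next
        case False
        then show ?thesis using incr[of "dist (upper j m x) (lower j m x)"] by (simp add: increment_exp_def)
      qed
      have [measurable]: "(\<lambda>w. increment_exp (\<lambda>x. H x w) (upper j m x) (lower j m x)) \<in> borel_measurable M"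
        unfolding increment_exp_def by measurable
      have "(\<integral>\<^sup>+w. ennreal (len j m x / 2 * increment_exp (\<lambda>x. H x w) (upper j m x) (lower j m x)) \<partial>M)
         = ennreal (len j m x / 2) * (\<integral>\<^sup>+w. ennreal (increment_exp (\<lambda>x. H x w) (upper j m x) (lower j m x)) \<partial>M)"
        by (subst nn_integral_cmult[symmetric]) (auto simp: len_def increment_exp_def ennreal_mult simp del: times_divide_eq_left intro!: nn_integral_cong)
      also have "\<dots> \<le> ennreal (exp A) * ennreal (len j m x / 2)"
        by (metis 1 mult.commute mult_left_mono zero_le)
      finally show "(\<integral>\<^sup>+w. ennreal (len j m x / 2 * increment_exp (\<lambda>x. H x w) (upper j m x) (lower j m x)) \<partial>M) \<le> ennreal (exp A) * ennreal (len j m x / 2)" .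
    qed
    also have "\<dots> = ennreal (exp A) * (\<integral>\<^sup>+x. ennreal (len j m x / 2) \<partial>ref_pairs m)"
      using borel_measurable_continuous_onI[OF continuous_len[of j m]]
      by (intro nn_integral_cmult) (simp add: measurable_cong_sets[OF sets_ref_pairs refl])
    also have "(\<integral>\<^sup>+x. ennreal (len j m x / 2) \<partial>ref_pairs m) = ennreal (\<integral>x. len j m x / 2 \<partial>ref_pairs m)"
      by (intro nn_integral_eq_integral integrable_divide integrable_ref_pairs continuous_len) (simp add: len_def)
    finally have "(\<integral>\<^sup>+w. T w j m \<partial>M) \<le> ennreal (exp A) * ennreal (\<integral>x. len j m x / 2 \<partial>ref_pairs m)" .
    moreover have "0 \<le> (\<integral>x. len j m x / 2 \<partial>ref_pairs m)" by (intro Bochner_Integration.integral_nonneg) (simp add: len_def)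
    ultimately show ?thesis by (simp only: ennreal_mult[OF exp_ge_zero])
  qed
  have pivot: "(\<integral>\<^sup>+w. ennreal ((1 - t) / 2 * exp (2 * (H (start j) w - H (u j) w) / (1 - t))) \<partial>M) \<le> ennreal (exp A * ((1 - t) / 2))" if "j \<in> I" for j
  proof (cases "t = 1")
    case False
    then have t1: "1 - t > 0" using t by simp
    have "u j - start j = (1 - t) *\<^sub>R u j" by (simp add: start_def algebra_simps)
    then have "dist (start j) (u j) = (1 - t) * norm (u j)" using t1 by (metis abs_of_pos dist_commute dist_norm norm_scaleR)
    then have "dist (start j) (u j) \<le> 1 - t" using u[OF that] t1 by (simp add: mult_left_le)
    then have 1: "(\<integral>\<^sup>+w. ennreal (exp (2 * (H (start j) w - H (u j) w) / (1 - t))) \<partial>M) \<le> ennreal (exp A)" by (rule incr[OF t1])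
    have "(\<integral>\<^sup>+w. ennreal ((1 - t) / 2 * exp (2 * (H (start j) w - H (u j) w) / (1 - t))) \<partial>M) = ennreal ((1 - t) / 2) * (\<integral>\<^sup>+w. ennreal (exp (2 * (H (start j) w - H (u j) w) / (1 - t))) \<partial>M)"
      using t1 by (subst nn_integral_cmult[symmetric]) (auto simp: ennreal_mult simp del: times_divide_eq_left intro!: nn_integral_cong)
    also have "\<dots> \<le> ennreal ((1 - t) / 2) * ennreal (exp A)" by (rule mult_left_mono[OF 1]) simp
    finally show ?thesis using t1 by (simp add: ennreal_mult'[symmetric] mult.commute)
  qed simp
  have "(\<integral>\<^sup>+w. envelope (\<lambda>x. H x w) \<partial>M) = ennreal ((1 + t) / 2)
     + (\<Sum>j\<in>I. ennreal (q j) * (\<integral>\<^sup>+w. ennreal ((1 - t) / 2 * exp (2 * (H (start j) w - H (u j) w) / (1 - t))) \<partial>M))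
     + (\<Sum>m\<le>K. \<Sum>j\<in>I. ennreal (q j) * (\<integral>\<^sup>+w. T w j m \<partial>M))"
    unfolding envelope_def T_def[symmetric]
    by (subst nn_integral_add, measurable, subst nn_integral_add, measurable, subst nn_integral_sum, measurable, subst nn_integral_sum, measurable)
       (simp add: nn_integral_sum nn_integral_cmult M.emeasure_space_1)
  also have "\<dots> \<le> ennreal (exp A * ((1 + t) / 2))
     + (\<Sum>j\<in>I. ennreal (q j * (exp A * ((1 - t) / 2))))
     + (\<Sum>m\<le>K. \<Sum>j\<in>I. ennreal (q j * (exp A * (\<integral>x. len j m x / 2 \<partial>ref_pairs m))))"
  proof (intro add_mono sum_mono)
    have "1 * ((1 + t) / 2) \<le> exp A * ((1 + t) / 2)" using A t by (intro mult_right_mono) auto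
    then show "ennreal ((1 + t) / 2) \<le> ennreal (exp A * ((1 + t) / 2))" by (intro ennreal_leI) simp
  next
    fix j assume j: "j \<in> I"
    have "ennreal (q j) * (\<integral>\<^sup>+w. ennreal ((1 - t) / 2 * exp (2 * (H (start j) w - H (u j) w) / (1 - t))) \<partial>M) \<le> ennreal (q j) * ennreal (exp A * ((1 - t) / 2))"
      by (rule mult_left_mono[OF pivot[OF j]]) simp
    moreover have "0 \<le> exp A * ((1 - t) / 2)" using t by simp
    ultimately show "ennreal (q j) * (\<integral>\<^sup>+w. ennreal ((1 - t) / 2 * exp (2 * (H (start j) w - H (u j) w) / (1 - t))) \<partial>M) \<le> ennreal (q j * (exp A * ((1 - t) / 2)))"
      by (simp only: ennreal_mult[OF q(1)[OF j]])
  next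
    fix m j assume j: "j \<in> I"
    have "ennreal (q j) * (\<integral>\<^sup>+w. T w j m \<partial>M) \<le> ennreal (q j) * ennreal (exp A * (\<integral>x. len j m x / 2 \<partial>ref_pairs m))"
      by (rule mult_left_mono[OF link]) simp
    moreover have "0 \<le> exp A * (\<integral>x. len j m x / 2 \<partial>ref_pairs m)"
      by (intro mult_nonneg_nonneg Bochner_Integration.integral_nonneg) (simp_all add: len_def)
    ultimately show "ennreal (q j) * (\<integral>\<^sup>+w. T w j m \<partial>M) \<le> ennreal (q j * (exp A * (\<integral>x. len j m x / 2 \<partial>ref_pairs m)))"
      by (simp only: ennreal_mult[OF q(1)[OF j]])
  qed
  also have "\<dots> = ennreal (exp A * ((1 + t) / 2) + (\<Sum>j\<in>I. q j * (exp A * ((1 - t) / 2))) + (\<Sum>m\<le>K. \<Sum>j\<in>I. q j * (exp A * (\<integral>x. len j m x / 2 \<partial>ref_pairs m))))"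
  proof -
    have n1: "0 \<le> q j * (exp A * ((1 - t) / 2))" if "j \<in> I" for j using q(1)[OF that] t by simp
    have n2: "0 \<le> q j * (exp A * (\<integral>x. len j m x / 2 \<partial>ref_pairs m))" if "j \<in> I" for j m using q(1)[OF that] by (simp add: len_def)
    have "(\<Sum>m\<le>K. \<Sum>j\<in>I. ennreal (q j * (exp A * (\<integral>x. len j m x / 2 \<partial>ref_pairs m)))) = ennreal (\<Sum>m\<le>K. \<Sum>j\<in>I. q j * (exp A * (\<integral>x. len j m x / 2 \<partial>ref_pairs m)))"
      using n2 by (simp add: sum_ennreal sum_nonneg)
    moreover have "(\<Sum>j\<in>I. ennreal (q j * (exp A * ((1 - t) / 2)))) = ennreal (\<Sum>j\<in>I. q j * (exp A * ((1 - t) / 2)))"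
      using n1 by (intro sum_ennreal) auto
    ultimately show ?thesis using t n1 n2 by (simp add: sum_nonneg flip: ennreal_plus)
  qed
  also have "exp A * ((1 + t) / 2) + (\<Sum>j\<in>I. q j * (exp A * ((1 - t) / 2))) + (\<Sum>m\<le>K. \<Sum>j\<in>I. q j * (exp A * (\<integral>x. len j m x / 2 \<partial>ref_pairs m)))
     = exp A * (1 + (\<Sum>m\<le>K. ref_weight m))"
  proof -
    have "(\<Sum>j\<in>I. q j * (exp A * ((1 - t) / 2))) = exp A * ((1 - t) / 2)" using q(2) by (simp add: sum_distrib_right[symmetric] del: times_divide_eq_right)
    moreover have "(\<Sum>m\<le>K. \<Sum>j\<in>I. q j * (exp A * (\<integral>x. len j m x / 2 \<partial>ref_pairs m))) = exp A * (\<Sum>m\<le>K. ref_weight m)"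
      unfolding ref_weight_def by (simp only: sum_distrib_left mult.left_commute)
    ultimately show ?thesis by (simp add: field_simps)
  qed
  finally show ?thesis .
qed

end

context noise_chain
begin

lemma len_eq: "len j m x = norm ((S m - S (Suc m)) *\<^sub>R (fst x - start j) + (- (S (Suc m) * \<sigma> m)) *\<^sub>R snd x)"
  unfolding len_def upper_def lower_def dist_norm by (simp add: algebra_simps)

text \<open>The inequality \<open>x / 2 \<le> x\<^sup>2 / (4 c) + c / 4\<close> trades lengths for second moments; \<open>c\<close> is optimised later.\<close>

lemma half_len_integral_le:
  assumes \<mu>: "bounded_prob \<mu> r" and c: "0 < c"
  shows "(\<integral>x. len j m x / 2 \<partial>(\<mu> \<Otimes>\<^sub>M ball_noise))
    \<le> ((S m - S (Suc m))\<^sup>2 * (\<integral>v. (norm (v - start j))\<^sup>2 \<partial>\<mu>) + (S (Suc m) * \<sigma> m)\<^sup>2 * (real DIM('a) / (real DIM('a) + 2))) / (4 * c) + c / 4"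
proof -
  interpret a: prob_space \<mu> using \<mu> by (simp add: bounded_prob_def)
  interpret b: prob_space "ball_noise :: 'a measure" by (rule prob_space_ball_noise)
  interpret pp: pair_prob_space \<mu> "ball_noise :: 'a measure" ..
  have i1: "integrable (\<mu> \<Otimes>\<^sub>M ball_noise) (len j m)" and i2: "integrable (\<mu> \<Otimes>\<^sub>M ball_noise) (\<lambda>x. (len j m x)\<^sup>2)"
    by (intro bounded_prob_pair_integrable[OF \<mu> bounded_prob_ball_noise] continuous_intros)+
  have "(\<integral>x. len j m x / 2 \<partial>(\<mu> \<Otimes>\<^sub>M ball_noise)) \<le> (\<integral>x. (len j m x)\<^sup>2 / (4 * c) + c / 4 \<partial>(\<mu> \<Otimes>\<^sub>M ball_noise))"
  proof (rule integral_mono)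
    fix x
    have "0 \<le> (len j m x - c)\<^sup>2 / (4 * c)" using c by simp
    then show "len j m x / 2 \<le> (len j m x)\<^sup>2 / (4 * c) + c / 4"
      using c by (simp add: field_simps power2_eq_square)
  qed (use i1 i2 in auto)
  also have "\<dots> = (\<integral>x. (len j m x)\<^sup>2 \<partial>(\<mu> \<Otimes>\<^sub>M ball_noise)) / (4 * c) + c / 4"
    using i2 by (simp add: pp.prob_space)
  also have "(\<integral>x. (len j m x)\<^sup>2 \<partial>(\<mu> \<Otimes>\<^sub>M ball_noise)) = (S m - S (Suc m))\<^sup>2 * (\<integral>v. (norm (v - start j))\<^sup>2 \<partial>\<mu>) + (S (Suc m) * \<sigma> m)\<^sup>2 * (real DIM('a) / (real DIM('a) + 2))"
    unfolding len_eq by (subst mixed_second_moment[OF \<mu>]) simp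
  finally show ?thesis .
qed

definition spread :: "'i \<Rightarrow> real" where "spread i = (\<Sum>j\<in>I. q j * (norm (u i - t *\<^sub>R u j))\<^sup>2)"

lemma weight_le:
  assumes c: "0 < c"
  shows "weight i m \<le> ((S m - S (Suc m))\<^sup>2 * (spread i + real DIM('a) / (real DIM('a) + 2) * (\<Sum>l<m. (\<sigma> l)\<^sup>2)) 
     + (S (Suc m) * \<sigma> m)\<^sup>2 * (real DIM('a) / (real DIM('a) + 2))) / (4 * c) + c / 4"
proof -
  let ?d = "real DIM('a) / (real DIM('a) + 2)"
  let ?n = "\<Sum>l<m. (\<sigma> l)\<^sup>2" and ?f = "S m - S (Suc m)" and ?g = "S (Suc m) * \<sigma> m"
  have "weight i m \<le> (\<Sum>j\<in>I. q j * ((?f\<^sup>2 * ((norm (u i - t *\<^sub>R u j))\<^sup>2 + ?d * ?n) + ?g\<^sup>2 * ?d) / (4 * c) + c / 4))"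
    unfolding weight_def
  proof (intro sum_mono mult_left_mono q(1))
    fix j assume "j \<in> I"
    show "(\<integral>x. len j m x / 2 \<partial>pairs i m) \<le> (?f\<^sup>2 * ((norm (u i - t *\<^sub>R u j))\<^sup>2 + ?d * ?n) + ?g\<^sup>2 * ?d) / (4 * c) + c / 4"
      using half_len_integral_le[OF bounded_noisy[where i=i and m=m] c, where j=j and m=m] unfolding pairs_def noisy_second_moment[OF \<sigma>] start_def .
  qed
  also have "\<dots> = (\<Sum>j\<in>I. (?f\<^sup>2 / (4 * c)) * (q j * (norm (u i - t *\<^sub>R u j))\<^sup>2) + q j * ((?f\<^sup>2 * (?d * ?n) + ?g\<^sup>2 * ?d) / (4 * c) + c / 4))"
    by (intro sum.cong refl) (simp add: add_divide_distrib distrib_left)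
  also have "\<dots> = (?f\<^sup>2 / (4 * c)) * spread i + ((?f\<^sup>2 * (?d * ?n) + ?g\<^sup>2 * ?d) / (4 * c) + c / 4)"
    unfolding sum.distrib sum_distrib_left[symmetric] sum_distrib_right[symmetric] q(2) spread_def by simp
  also have "\<dots> = (?f\<^sup>2 * (spread i + ?d * ?n) + ?g\<^sup>2 * ?d) / (4 * c) + c / 4"
    by (simp add: add_divide_distrib distrib_left)
  finally show ?thesis .
qed

lemma ref_weight_le:
  assumes c: "0 < c" and B: "\<And>j. j \<in> I \<Longrightarrow> (\<integral>v. (norm (v - start j))\<^sup>2 \<partial>\<nu> m) \<le> B"
  shows "ref_weight m \<le> ((S m - S (Suc m))\<^sup>2 * B + (S (Suc m) * \<sigma> m)\<^sup>2 * (real DIM('a) / (real DIM('a) + 2))) / (4 * c) + c / 4"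
    (is "_ \<le> ?R")
proof -
  have "ref_weight m \<le> (\<Sum>j\<in>I. q j * ?R)"
    unfolding ref_weight_def ref_pairs_def
  proof (intro sum_mono mult_left_mono q(1))
    fix j assume j: "j \<in> I"
    have "(S m - S (Suc m))\<^sup>2 * (\<integral>v. (norm (v - start j))\<^sup>2 \<partial>\<nu> m) \<le> (S m - S (Suc m))\<^sup>2 * B"
      by (intro mult_left_mono B j) simp
    then show "(\<integral>x. len j m x / 2 \<partial>(\<nu> m \<Otimes>\<^sub>M ball_noise)) \<le> ?R"
      using c by (intro order_trans[OF half_len_integral_le[OF \<nu> c]] add_mono divide_right_mono) auto
  qed
  also have "\<dots> = ?R" using q(2) by (simp add: sum_distrib_right[symmetric])
  finally show ?thesis .
qed

text \<open>The expectation of the envelope may exceed \<open>exp A\<close> by the factor \<open>1 + \<Sum> ref_weight\<close>, which a constant \<open>L\<close> in every penalty absorbs.\<close>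

lemma exponential_bound:
  fixes H :: "'a \<Rightarrow> 'w \<Rightarrow> real"
  assumes M: "prob_space M"
    and cont: "\<And>w. w \<in> space M \<Longrightarrow> continuous_on UNIV (\<lambda>x. H x w)" and H [measurable]: "\<And>x. H x \<in> borel_measurable M"
    and A: "0 \<le> A"
    and incr: "\<And>x y d. 0 < d \<Longrightarrow> dist x y \<le> d \<Longrightarrow> (\<integral>\<^sup>+w. ennreal (exp (2 * (H x w - H y w) / d)) \<partial>M) \<le> ennreal (exp A)"
    and total: "\<And>i. i \<in> I \<Longrightarrow> (1 - t) / 2 + (\<Sum>m\<le>K. weight i m) \<le> 1"
    and L: "1 + (\<Sum>m\<le>K. ref_weight m) \<le> exp L"
  shows "(\<integral>\<^sup>+w. (SUP i\<in>I. ennreal (exp (H (u i) w - (\<Sum>j\<in>I. q j * H (u j) w) - (tilt i + L)))) \<partial>M) \<le> ennreal (exp A)"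
proof -
  have "(\<integral>\<^sup>+w. (SUP i\<in>I. ennreal (exp (H (u i) w - (\<Sum>j\<in>I. q j * H (u j) w) - (tilt i + L)))) \<partial>M) 
    \<le> (\<integral>\<^sup>+w. ennreal (exp (- L)) * (SUP i\<in>I. ennreal (exp (H (u i) w - (\<Sum>j\<in>I. q j * H (u j) w) - tilt i))) \<partial>M)"
  proof (intro nn_integral_mono SUP_least)
    fix w i assume i: "i \<in> I"
    have "ennreal (exp (H (u i) w - (\<Sum>j\<in>I. q j * H (u j) w) - (tilt i + L))) = ennreal (exp (- L)) * ennreal (exp (H (u i) w - (\<Sum>j\<in>I. q j * H (u j) w) - tilt i))"
      by (subst ennreal_mult[symmetric]) (auto simp: exp_add[symmetric])
    also have "\<dots> \<le> ennreal (exp (- L)) * (SUP i\<in>I. ennreal (exp (H (u i) w - (\<Sum>j\<in>I. q j * H (u j) w) - tilt i)))"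
      using i by (intro mult_left_mono SUP_upper) auto
    finally show "ennreal (exp (H (u i) w - (\<Sum>j\<in>I. q j * H (u j) w) - (tilt i + L))) \<le> \<dots>" .
  qed
  also have "\<dots> = ennreal (exp (- L)) * (\<integral>\<^sup>+w. (SUP i\<in>I. ennreal (exp (H (u i) w - (\<Sum>j\<in>I. q j * H (u j) w) - tilt i))) \<partial>M)"
    using I(1) by (intro nn_integral_cmult borel_measurable_SUP countable_finite) measurable
  also have "(\<integral>\<^sup>+w. (SUP i\<in>I. ennreal (exp (H (u i) w - (\<Sum>j\<in>I. q j * H (u j) w) - tilt i))) \<partial>M) \<le> (\<integral>\<^sup>+w. envelope (\<lambda>x. H x w) \<partial>M)"
    by (intro nn_integral_mono SUP_least pathwise_bound cont total)
  also have "\<dots> \<le> ennreal (exp A * (1 + (\<Sum>m\<le>K. ref_weight m)))"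
    by (rule expectation_envelope[OF M cont H A incr])
  also have "\<dots> \<le> ennreal (exp A * exp L)"
    using L by (intro ennreal_leI mult_left_mono) auto
  also have "ennreal (exp (- L)) * ennreal (exp A * exp L) = ennreal (exp A)"
    by (subst ennreal_mult[symmetric]) (auto simp: exp_minus)
  finally show ?thesis by (simp add: mult_left_mono)
qed

end

lemma nn_integral_noisy_1:
  assumes [measurable]: "h \<in> borel_measurable borel"
  shows "(\<integral>\<^sup>+v. h v \<partial>noisy (\<lambda>_. r) (0::'a::euclidean_space) (Suc 0)) = (\<integral>\<^sup>+z. h (r *\<^sub>R z) \<partial>ball_noise)"
proof -
  interpret n: prob_space "ball_noise :: 'a measure" by (rule prob_space_ball_noise)
  have [measurable_cong]: "sets (return borel (0::'a)) = sets borel" by simp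
  have "(\<integral>\<^sup>+v. h v \<partial>noisy (\<lambda>_. r) (0::'a) (Suc 0)) = (\<integral>\<^sup>+x. h (fst x + r *\<^sub>R snd x) \<partial>(return borel 0 \<Otimes>\<^sub>M ball_noise))"
    by (simp, subst nn_integral_distr) auto
  also have "\<dots> = (\<integral>\<^sup>+v. (\<integral>\<^sup>+z. h (v + r *\<^sub>R z) \<partial>ball_noise) \<partial>return borel (0::'a))"
    by (subst n.nn_integral_fst[symmetric]) auto
  also have "\<dots> = (\<integral>\<^sup>+z. h (r *\<^sub>R z) \<partial>ball_noise)"
    by (subst nn_integral_return) auto
  finally show ?thesis .
qed

text \<open>Before any noise is added, the uniform law on the finitely many points serves as reference law, at the price \<open>card I\<close>.\<close>

lemma bounded_prob_points:
  fixes u :: "'i \<Rightarrow> 'a::euclidean_space"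
  assumes I: "finite I" "I \<noteq> {}" and u: "\<And>i. i \<in> I \<Longrightarrow> norm (u i) \<le> 1"
  shows "bounded_prob (distr (uniform_count_measure I) borel u) 1"
    and "\<And>h. h \<in> borel_measurable borel \<Longrightarrow> i \<in> I \<Longrightarrow> h (u i) \<le> ennreal (real (card I)) * (\<integral>\<^sup>+v. h v \<partial>distr (uniform_count_measure I) borel u)"
    and "(\<And>i. i \<in> I \<Longrightarrow> g (u i) \<le> B) \<Longrightarrow> continuous_on UNIV g \<Longrightarrow> (\<integral>v. g v \<partial>distr (uniform_count_measure I) borel u) \<le> (B::real)"
proof -
  interpret c: prob_space "uniform_count_measure I" using I by (rule prob_space_uniform_count_measure)
  have um [measurable]: "u \<in> borel_measurable (uniform_count_measure I)"
    by (simp add: measurable_def space_uniform_count_measure sets_uniform_count_measure)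
  show b: "bounded_prob (distr (uniform_count_measure I) borel u) 1"
    unfolding bounded_prob_def using u
    by (auto intro!: c.prob_space_distr AE_I2 simp: AE_distr_iff space_uniform_count_measure)
  show "h (u i) \<le> ennreal (real (card I)) * (\<integral>\<^sup>+v. h v \<partial>distr (uniform_count_measure I) borel u)" if [measurable]: "h \<in> borel_measurable borel" and i: "i \<in> I" for h i
  proof -
    have c0: "card I > 0" using I by (simp add: card_gt_0_iff)
    have "(\<integral>\<^sup>+v. h v \<partial>distr (uniform_count_measure I) borel u) = (\<integral>\<^sup>+i. h (u i) \<partial>uniform_count_measure I)"
      by (rule nn_integral_distr) auto
    also have "\<dots> = (\<Sum>j\<in>I. ennreal (1 / card I) * h (u j))"
      unfolding uniform_count_measure_def using I
      by (subst nn_integral_point_measure_finite) (auto simp: mult.commute)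
    also have "ennreal (real (card I)) * \<dots> = (\<Sum>j\<in>I. h (u j))"
      unfolding sum_distrib_left[symmetric] mult.assoc[symmetric] using c0
      by (subst ennreal_mult[symmetric]) auto
    finally have "ennreal (real (card I)) * (\<integral>\<^sup>+v. h v \<partial>distr (uniform_count_measure I) borel u) = (\<Sum>j\<in>I. h (u j))" .
    moreover have "h (u i) \<le> (\<Sum>j\<in>I. h (u j))" using I i by (intro member_le_sum) auto
    ultimately show ?thesis by simp
  qed
  show "(\<integral>v. g v \<partial>distr (uniform_count_measure I) borel u) \<le> B" if g: "\<And>i. i \<in> I \<Longrightarrow> g (u i) \<le> B" and cg: "continuous_on UNIV g"
  proof -
    interpret d: prob_space "distr (uniform_count_measure I) borel u" by (rule c.prob_space_distr) simp
    have [measurable]: "g \<in> borel_measurable borel" by (rule borel_measurable_continuous_onI[OF cg])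
    have "(\<integral>v. g v \<partial>distr (uniform_count_measure I) borel u) \<le> (\<integral>v. B \<partial>distr (uniform_count_measure I) borel u)"
    proof (rule integral_mono_AE)
      show "AE v in distr (uniform_count_measure I) borel u. g v \<le> B"
        using g by (subst AE_distr_iff) (auto intro!: AE_I2 simp: space_uniform_count_measure)
    qed (use bounded_prob_integrable[OF b cg] in auto)
    then show ?thesis by (simp add: d.prob_space[simplified])
  qed
qed

section \<open>Numerical cost of a chain\<close>

text \<open>Links are counted here from the coarse end: \<open>k = K - m\<close>, with noise of scale proportional to \<open>4 / 4\<^sup>k\<close> in link \<open>k\<close>.  The
positions \<open>0, 1/2, 9/10, \<dots>\<close> approach \<open>1\<close> at the rate \<open>4\<^sup>-\<^sup>k\<close> at which the noise decreases.  The first steps are modified;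
the numbers are tuned so that the total cost stays below \<open>2 p ln 2\<close> in every dimension \<open>p \<ge> 2\<close>.\<close>

definition chain_pos :: "nat \<Rightarrow> nat \<Rightarrow> real" where
  "chain_pos K k = (if k = 0 then 0 else if k = 1 then 1/2 else if k \<le> K then 1 - (8/5) / 4 ^ k else 1)"

definition chain_step :: "nat \<Rightarrow> nat \<Rightarrow> real" where
  "chain_step K k = chain_pos K (Suc k) - chain_pos K k"

text \<open>With this factor \<open>\<kappa>\<close>, a link of step \<open>f\<close> contains noise of variance at most \<open>f\<^sup>2 \<kappa> \<tau>\<^sup>2\<close> times that of the uniform law on the unit ball,
where \<open>\<tau>\<close> is the noise level (\<open>noise_factor_bound\<close>).\<close>

definition noise_factor :: "nat \<Rightarrow> real" where
  "noise_factor k = (if k = 0 then 16/15 else if k = 1 then 391/240 else if k = 2 then 2161/240 else 1389/125)"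

definition weight_factor :: "nat \<Rightarrow> real" where
  "weight_factor k = (if k = 0 then 5589/10000 else if k = 1 then 58185/100000 else if k = 2 then 8264/10000 else 884/1000)"

text \<open>Nearly optimal constants for trading lengths against second moments in link \<open>k\<close>; the resulting average link weight, relative
to the step, is \<open>weight_factor k\<close>.\<close>

definition weight_scale :: "nat \<Rightarrow> real" where
  "weight_scale k = (if k = 0 then 1118/1000 else if k = 1 then 116/100 else if k = 2 then 165/100 else 177/100)"

lemma chain_step_cases:
  assumes "3 \<le> K"
  shows "chain_step K 0 = 1/2" "chain_step K (Suc 0) = 2/5" "chain_step K 2 = 3/40"
    and "3 \<le> k \<Longrightarrow> k < K \<Longrightarrow> chain_step K k = (6/5) / 4 ^ k" "chain_step K K = (8/5) / 4 ^ K"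
  using assms by (auto simp: chain_step_def chain_pos_def power2_eq_square field_simps)

lemma chain_step_pos: "3 \<le> K \<Longrightarrow> k \<le> K \<Longrightarrow> 0 < chain_step K k"
  using chain_step_cases(4)[of K k] chain_step_cases(1-3,5)[of K]
  by (cases "k = 0"; cases "k = 1"; cases "k = 2"; cases "k = K") auto

lemma chain_pos_bounds: "0 \<le> chain_pos K k" "chain_pos K k \<le> 1"
proof -
  have "(8/5::real) / 4 ^ k \<le> 1" if "2 \<le> k"
  proof -
    have "(4::real) ^ 2 \<le> 4 ^ k" using that by (rule power_increasing) simp
    then show ?thesis by (simp add: field_simps)
  qed
  then show "0 \<le> chain_pos K k" "chain_pos K k \<le> 1" by (auto simp: chain_pos_def)
qed

lemma chain_sum_split:
  assumes "3 \<le> K"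
  shows "(\<Sum>k\<le>K. g k) = g 0 + g (Suc 0) + g 2 + (\<Sum>k=3..<K. g k) + (g K :: real)"
proof -
  have "(\<Sum>k\<le>K. g k) = (\<Sum>k<K. g k) + g K" by (simp add: lessThan_Suc_atMost[symmetric])
  also have "(\<Sum>k<K. g k) = (\<Sum>k<3. g k) + (\<Sum>k=3..<K. g k)"
    using assms sum.atLeastLessThan_concat[of 0 3 K g] by (simp add: atLeast0LessThan)
  finally show ?thesis by (simp add: eval_nat_numeral)
qed

lemma quarter_sum: "3 \<le> K \<Longrightarrow> (\<Sum>k=3..<K. 1 / 4 ^ k) = 1/48 - (4/3) / (4::real) ^ K"
proof (induction K rule: nat_induct_at_least)
  case (Suc K)
  then have "(\<Sum>k=3..<Suc K. 1 / (4::real) ^ k) = 1/48 - (4/3) / 4 ^ K + 1 / 4 ^ K" by simp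
  then show ?case by (simp add: field_simps)
qed simp

lemma quarter_sum_linear: "3 \<le> K \<Longrightarrow> (\<Sum>k=3..<K. real k / 4 ^ k) = 5/72 - (4/3 * real K + 4/9) / 4 ^ K"
proof (induction K rule: nat_induct_at_least)
  case (Suc K)
  then have "(\<Sum>k=3..<Suc K. real k / 4 ^ k) = 5/72 - (4/3 * real K + 4/9) / 4 ^ K + real K / 4 ^ K" by simp
  then show ?case by (simp add: field_simps)
qed simp

lemma sum_chain_step: "0 < K \<Longrightarrow> (\<Sum>k\<le>K. chain_step K k) = 1"
  using sum_lessThan_telescope[of "chain_pos K" "Suc K"] unfolding lessThan_Suc_atMost chain_step_def by (simp add: chain_pos_def)

lemma sum_chain_step_tail: 
  assumes "3 \<le> K" shows "(\<Sum>k=3..<K. chain_step K k) = 1/40 - (8/5) / 4 ^ K"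
  using sum_chain_step[of K] assms by (simp add: chain_sum_split chain_step_cases)

lemma noise_factor_bound:
  assumes K: "3 \<le> K" and k: "k \<le> K" 
  shows "(chain_step K k)\<^sup>2 * ((16/15) / 16 ^ k) + (chain_pos K k * (4 / 4 ^ k))\<^sup>2 \<le> (chain_step K k)\<^sup>2 * noise_factor k"
proof -
  consider "k = 0" | "k = 1" | "k = 2" | "3 \<le> k" by linarith
  then show ?thesis
  proof cases
    case 4
    have f: "(6/5) / 4 ^ k \<le> chain_step K k" using 4 k chain_step_cases(4)[OF K, of k] chain_step_cases(5)[OF K] by (cases "k = K") (auto simp: divide_simps)
    have "(chain_pos K k * (4 / 4 ^ k))\<^sup>2 \<le> (4 / 4 ^ k)\<^sup>2"
      using chain_pos_bounds[of K k] by (intro power_mono mult_left_le_one_le) auto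
    also have "\<dots> = (100/9) * ((6/5) / 4 ^ k)\<^sup>2" by (simp add: power_divide power2_eq_square)
    also have "\<dots> \<le> (100/9) * (chain_step K k)\<^sup>2" using f by (intro mult_left_mono power_mono) auto
    finally have 1: "(chain_pos K k * (4 / 4 ^ k))\<^sup>2 \<le> (100/9) * (chain_step K k)\<^sup>2" .
    have "(16::real) ^ 3 \<le> 16 ^ k" using 4 by (rule power_increasing) simp
    then have "(16/15) / 16 ^ k \<le> (16/15) / (16::real) ^ 3" by (intro divide_left_mono) auto
    then have "(chain_step K k)\<^sup>2 * ((16/15) / 16 ^ k) \<le> (chain_step K k)\<^sup>2 * ((16/15) / 16 ^ 3)" by (rule mult_left_mono) simp
    note add_mono[OF this 1]
    also have "(chain_step K k)\<^sup>2 * ((16/15) / 16 ^ 3) + (100/9) * (chain_step K k)\<^sup>2 = (chain_step K k)\<^sup>2 * ((16/15) / 16 ^ 3 + 100/9)"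
      by (simp only: distrib_left mult.commute)
    also have "\<dots> \<le> (chain_step K k)\<^sup>2 * noise_factor k" using 4 by (intro mult_left_mono) (auto simp: noise_factor_def)
    finally show ?thesis .
  qed (use K in \<open>simp_all add: chain_step_cases chain_pos_def noise_factor_def power2_eq_square\<close>)
qed

lemma sum_noise_factor:
  assumes K: "3 \<le> K"
  shows "(\<Sum>k\<le>K. chain_step K k * noise_factor k) \<le> 15/7"
    and "(\<Sum>k\<le>K. chain_step K k * (if k = 0 then 0 else noise_factor k)) \<le> 16049/10000"
proof -
  have "(\<Sum>k=3..<K. chain_step K k * noise_factor k) = (1/40 - (8/5) / 4 ^ K) * (1389/125)"
    unfolding sum_chain_step_tail[OF K, symmetric] sum_distrib_right by (intro sum.cong) (auto simp: noise_factor_def)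
  moreover have "(\<Sum>k=3..<K. chain_step K k * (if k = 0 then 0 else noise_factor k)) = (\<Sum>k=3..<K. chain_step K k * noise_factor k)"
    by (intro sum.cong) auto
  ultimately show "(\<Sum>k\<le>K. chain_step K k * noise_factor k) \<le> 15/7"
    and "(\<Sum>k\<le>K. chain_step K k * (if k = 0 then 0 else noise_factor k)) \<le> 16049/10000"
    unfolding chain_sum_split[OF K] using K by (simp_all add: chain_step_cases noise_factor_def)
qed

lemma sum_chain_step_powers:
  assumes K: "3 \<le> K"
  shows "(\<Sum>k\<le>K. chain_step K k * (1 / 4 ^ k)) \<le> 606/1000 + chain_step K K" and "(\<Sum>k\<le>K. chain_step K k * (1 / 16 ^ k)) \<le> 5254/10000 + chain_step K K"
proof -
  have c: "chain_step K k * (1 / b ^ k) \<le> chain_step K k * (1 / b ^ 3)" if "k \<in> {3..<K}" "1 \<le> b" for k and b :: real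
    using that chain_step_pos[OF K, of k] by (intro mult_left_mono divide_left_mono power_increasing) auto
  have t: "(\<Sum>k=3..<K. chain_step K k * (1 / b ^ k)) \<le> (1/40) * (1 / b ^ 3)" if "1 \<le> b" for b :: real
  proof -
    have "(\<Sum>k=3..<K. chain_step K k * (1 / b ^ k)) \<le> (1/40 - (8/5) / 4 ^ K) * (1 / b ^ 3)"
      unfolding sum_chain_step_tail[OF K, symmetric] sum_distrib_right by (intro sum_mono c that)
    also have "\<dots> \<le> (1/40) * (1 / b ^ 3)" using that by (intro mult_right_mono) auto
    finally show ?thesis .
  qed
  have l: "chain_step K K * (1 / b ^ K) \<le> chain_step K K" if "1 \<le> b" for b :: real
    using that chain_step_pos[OF K, of K] by (intro mult_left_le) auto
  show "(\<Sum>k\<le>K. chain_step K k * (1 / 4 ^ k)) \<le> 606/1000 + chain_step K K" 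
    using t[of 4] l[of 4] unfolding chain_sum_split[OF K] chain_step_cases(1-3)[OF K] by (simp add: power2_eq_square)
  show "(\<Sum>k\<le>K. chain_step K k * (1 / 16 ^ k)) \<le> 5254/10000 + chain_step K K"
    using t[of 16] l[of 16] unfolding chain_sum_split[OF K] chain_step_cases(1-3)[OF K] by (simp add: power2_eq_square)
qed

lemma weight_factor_bound: "(21/20 + 14/75 * noise_factor k) / (4 * weight_scale k) + weight_scale k / 4 \<le> weight_factor k"
  by (simp add: noise_factor_def weight_scale_def weight_factor_def)

text \<open>Concavity of the logarithm between \<open>A / l + B\<close> and \<open>B\<close>.  Link weights are proportional to a scale \<open>l\<close> and the information
grows like \<open>ln (1 / l)\<close>; the lemma shows that \<open>l = 1\<close> is the most expensive case.\<close>

lemma scaled_log_le: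
  assumes "0 < l" "l \<le> 1" "0 < A" "1 \<le> B"
  shows "l * ln (A / l + B) \<le> ln (A + (B::real))"
proof -
  have p: "0 < A / l" "0 < A / l + B" using assms by (auto intro: add_pos_pos)
  have "concave_on {0<..} (ln :: real \<Rightarrow> real)" by (rule ln_concave)
  then have "l * ln (A / l + B) + (1 - l) * ln B \<le> ln (l * (A / l + B) + (1 - l) * B)"
    using assms p concave_onD[of "{0<..}" ln "1 - l" "A / l + B" B] by simp
  also have "l * (A / l + B) + (1 - l) * B = A + B" using assms by (simp add: field_simps)
  finally show ?thesis using assms by (smt (verit) ln_ge_zero mult_nonneg_nonneg)
qed

lemma ln_le_ln2:
  assumes "0 < x" "x ^ n \<le> 2 ^ m" "0 < n"
  shows "ln x \<le> real m / real n * ln 2"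
proof -
  have "real n * ln x = ln (x ^ n)" using assms by (simp add: ln_realpow)
  also have "\<dots> \<le> ln (2 ^ m)" using assms by (subst ln_le_cancel_iff) auto
  also have "\<dots> = real m * ln 2" by (simp add: ln_realpow)
  finally show ?thesis using assms by (simp add: field_simps)
qed

lemma ln_four_power_le: "\<lbrakk>0 < x; x ^ n \<le> 2 ^ m; 0 < n\<rbrakk> \<Longrightarrow> ln (4 ^ k * x) \<le> (2 * real k + real m / real n) * ln 2"
proof -
  assume *: "0 < x" "x ^ n \<le> 2 ^ m" "0 < n"
  have "ln ((4::real) ^ k) = real k * (2 * ln 2)" by (simp add: ln_realpow ln_realpow[of 2 2, simplified])
  then show ?thesis using ln_le_ln2[OF *] * by (simp add: ln_mult algebra_simps)
qed

text \<open>For \<open>k \<ge> 3\<close> the additive \<open>4/3\<close> is at most \<open>4\<^sup>k / 48\<close>, so the logarithm is linear in \<open>k\<close> up to a constant.\<close>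

lemma tail_log_sum:
  assumes K: "3 \<le> K" and x: "0 < b" "(b + 1/48) ^ n \<le> 2 ^ m" "0 < n" 
  shows "(\<Sum>k=3..<K. (chain_step K k * weight_factor k) * ln (4 ^ k * b + 4/3)) \<le> (6/5 * 884/1000 * (5/36 + real m / real n / 48)) * ln 2"
proof -
  have "ln (4 ^ k * b + 4/3) \<le> (2 * real k + real m / real n) * ln 2" if "3 \<le> k" for k
  proof -
    have "(4::real) ^ 3 \<le> 4 ^ k" using that by (rule power_increasing) simp
    then have "4 ^ k * b + 4/3 \<le> 4 ^ k * (b + 1/48)" by (simp add: algebra_simps)
    moreover have "0 < 4 ^ k * b + 4/3" using x by (intro add_pos_pos) auto
    ultimately have "ln (4 ^ k * b + 4/3) \<le> ln (4 ^ k * (b + 1/48))" by (subst ln_le_cancel_iff) auto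
    also have "\<dots> \<le> (2 * real k + real m / real n) * ln 2" using x by (intro ln_four_power_le) auto
    finally show ?thesis .
  qed
  then have "(\<Sum>k=3..<K. (chain_step K k * weight_factor k) * ln (4 ^ k * b + 4/3)) \<le> (\<Sum>k=3..<K. (6/5 * 884/1000 / 4 ^ k) * ((2 * real k + real m / real n) * ln 2))"
    using K by (intro sum_mono) (auto simp: chain_step_cases weight_factor_def intro!: divide_right_mono)
  also have "\<dots> = (\<Sum>k=3..<K. (6/5 * 884/1000 * ln 2) * (2 * (real k / 4 ^ k)) + (6/5 * 884/1000 * ln 2) * (real m / real n * (1 / 4 ^ k)))"
    by (intro sum.cong refl) (simp add: algebra_simps add_divide_distrib)
  also have "\<dots> = (6/5 * 884/1000 * ln 2) * (2 * (\<Sum>k=3..<K. real k / 4 ^ k) + real m / real n * (\<Sum>k=3..<K. 1 / 4 ^ k))"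
    by (simp only: sum.distrib sum_distrib_left[symmetric] distrib_left)
  also have "\<dots> \<le> (6/5 * 884/1000 * ln 2) * (2 * (5/72) + real m / real n * (1/48))"
    using x K by (intro mult_left_mono add_mono) (auto simp: quarter_sum quarter_sum_linear)
  finally show ?thesis by (simp add: algebra_simps)
qed

text \<open>Logarithms are bounded by rational multiples of \<open>ln 2\<close>, each checked as an inequality between powers.  The last summand is the
cost \<open>L\<close> of the reference weights.\<close>

lemma chain_cost_dim2:
  assumes K: "3 \<le> K" and b: "0 < b" "b \<le> 1637/1000"
  shows "2 * (\<Sum>k<K. (chain_step K k * weight_factor k) * ln (4 ^ k * b + 4/3)) + ln (1 + 6457/10000) \<le> (4 - 1/20) * ln 2"
proof -
  have 0: "ln (4 ^ 0 * b + 4/3) \<le> real 11 / real 7 * ln 2" 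
  proof (rule ln_le_ln2)
    have "(4 ^ 0 * b + 4/3) ^ 7 \<le> (1637/1000 + 4/3) ^ 7" using b by (intro power_mono) auto
    then show "(4 ^ 0 * b + 4/3) ^ 7 \<le> 2 ^ 11" by (rule order_trans) (simp add: power_divide)
  qed (use b in auto)
  have 1: "ln (4 ^ 1 * b + 4/3) \<le> real 3 / real 1 * ln 2" 
    using b by (intro ln_le_ln2) auto
  have 2: "ln (4 ^ 2 * b + 4/3) \<le> real 24 / real 5 * ln 2" 
  proof (rule ln_le_ln2)
    have "(4 ^ 2 * b + 4/3) ^ 5 \<le> (16 * 1637/1000 + 4/3) ^ 5" using b by (intro power_mono) auto
    then show "(4 ^ 2 * b + 4/3) ^ 5 \<le> 2 ^ 24" by (rule order_trans) (simp add: power_divide)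
  qed (use b in auto)
  have L: "ln (1 + 6457/10000) \<le> real 3 / real 4 * ln 2" by (rule ln_le_ln2) (simp_all add: power_divide)
  have "(\<Sum>k=3..<K. (chain_step K k * weight_factor k) * ln (4 ^ k * b + 4/3)) \<le> (6/5 * 884/1000 * (5/36 + real 3 / real 4 / 48)) * ln 2"
  proof (rule tail_log_sum[OF K b(1)])
    have "(b + 1/48) ^ 4 \<le> (1637/1000 + 1/48) ^ 4" using b by (intro power_mono) auto
    then show "(b + 1/48) ^ 4 \<le> 2 ^ 3" by (rule order_trans) (simp add: power_divide)
  qed simp
  moreover have "(\<Sum>k<K. (chain_step K k * weight_factor k) * ln (4 ^ k * b + 4/3)) = (chain_step K 0 * weight_factor 0) * ln (4 ^ 0 * b + 4/3) + (chain_step K 1 * weight_factor 1) * ln (4 ^ 1 * b + 4/3) + (chain_step K 2 * weight_factor 2) * ln (4 ^ 2 * b + 4/3) + (\<Sum>k=3..<K. (chain_step K k * weight_factor k) * ln (4 ^ k * b + 4/3))"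
    using chain_sum_split[OF K, of "\<lambda>k. (chain_step K k * weight_factor k) * ln (4 ^ k * b + 4/3)"] by (simp add: lessThan_Suc_atMost[symmetric])
  ultimately show ?thesis using 0 1 2 L K ln2_ge_two_thirds by (simp add: chain_step_cases weight_factor_def)
qed

text \<open>The noise level tends to a limit as the dimension grows, and the limiting costs alone leave too little room for \<open>L\<close> in dimension
three.  The tangent of the logarithm at the limiting value recovers the deficit, of order \<open>1 / (d + 2)\<close>, in the two coarsest
links.\<close>

lemma chain_cost_dim_ge3:
  assumes K: "3 \<le> K" and d: "3 \<le> d" and b: "0 < b" "b \<le> 23146/10000 * (1 - 1 / (d + 2))"
  shows "d * (\<Sum>k<K. (chain_step K k * weight_factor k) * ln (4 ^ k * b + 4/3)) + ln (1 + 764/1000) \<le> 2 * d * ln 2 - 1/200"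
proof -
  define b' :: real where "b' = 23146/10000"
  have bb: "b \<le> b'" using b d unfolding b'_def by (intro order_trans[OF b(2)] mult_left_le) auto
  have slope: "ln (a * b + 4/3) \<le> ln (a * b' + 4/3) - a * b' / (a * b' + 4/3) * (1 / (d + 2))" if a: "0 < a" for a
  proof -
    have Z: "0 < a * b' + 4/3" "0 < a * b + 4/3" using a b by (auto simp: b'_def intro!: add_pos_pos)
    have "ln (a * b + 4/3) - ln (a * b' + 4/3) = ln ((a * b + 4/3) / (a * b' + 4/3))" using Z by (simp add: ln_div)
    also have "\<dots> \<le> (a * b + 4/3) / (a * b' + 4/3) - 1" using Z by (intro ln_le_minus_one) auto
    also have "\<dots> = a * (b - b') / (a * b' + 4/3)" using Z by (simp add: field_simps)
    also have "\<dots> \<le> a * (- b' * (1 / (d + 2))) / (a * b' + 4/3)"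
    proof -
      have "b - b' \<le> - b' * (1 / (d + 2))" using b unfolding b'_def by (simp only: right_diff_distrib mult_minus_left)
      then show ?thesis using Z a by (intro divide_right_mono mult_left_mono) auto
    qed
    finally show ?thesis by (simp add: algebra_simps)
  qed
  define y where "y = 1 / (d + 2)"
  have y0: "0 \<le> y" using d by (simp add: y_def)
  have 0: "ln (4 ^ 0 * b + 4/3) \<le> real 15 / real 8 * ln 2 - 634/1000 * y" 
  proof -
    have "ln (1 * b' + 4/3) \<le> real 15 / real 8 * ln 2" by (rule ln_le_ln2) (simp_all add: b'_def power_divide)
    moreover have "634/1000 * y \<le> 1 * b' / (1 * b' + 4/3) * y" using y0 by (intro mult_right_mono) (auto simp: b'_def)
    ultimately show ?thesis using slope[of 1] unfolding y_def by simp
  qed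
  have 1: "ln (4 ^ 1 * b + 4/3) \<le> real 24 / real 7 * ln 2 - 874/1000 * y" 
  proof -
    have "ln (4 * b' + 4/3) \<le> real 24 / real 7 * ln 2" by (rule ln_le_ln2) (simp_all add: b'_def power_divide)
    moreover have "874/1000 * y \<le> 4 * b' / (4 * b' + 4/3) * y" using y0 by (intro mult_right_mono) (auto simp: b'_def)
    ultimately show ?thesis using slope[of 4] unfolding y_def by simp
  qed
  have 2: "ln (4 ^ 2 * b + 4/3) \<le> real 16 / real 3 * ln 2" 
  proof (rule ln_le_ln2)
    have "(4 ^ 2 * b + 4/3) ^ 3 \<le> (16 * b' + 4/3) ^ 3" using b bb by (intro power_mono) auto
    then show "(4 ^ 2 * b + 4/3) ^ 3 \<le> 2 ^ 16" by (rule order_trans) (simp add: b'_def power_divide)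
  qed (use b in auto)
  have L: "ln (1 + 764/1000) \<le> real 5 / real 6 * ln 2" by (rule ln_le_ln2) (simp_all add: power_divide)
  have tl: "(\<Sum>k=3..<K. (chain_step K k * weight_factor k) * ln (4 ^ k * b + 4/3)) \<le> (6/5 * 884/1000 * (5/36 + real 5 / real 4 / 48)) * ln 2"
  proof (rule tail_log_sum[OF K b(1)])
    have "(b + 1/48) ^ 4 \<le> (b' + 1/48) ^ 4" using b bb by (intro power_mono) auto
    then show "(b + 1/48) ^ 4 \<le> 2 ^ 5" by (rule order_trans) (simp add: b'_def power_divide)
  qed simp
  have sp: "(\<Sum>k<K. (chain_step K k * weight_factor k) * ln (4 ^ k * b + 4/3)) = (chain_step K 0 * weight_factor 0) * ln (4 ^ 0 * b + 4/3) + (chain_step K 1 * weight_factor 1) * ln (4 ^ 1 * b + 4/3) + (chain_step K 2 * weight_factor 2) * ln (4 ^ 2 * b + 4/3) + (\<Sum>k=3..<K. (chain_step K k * weight_factor k) * ln (4 ^ k * b + 4/3))"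
    using chain_sum_split[OF K, of "\<lambda>k. (chain_step K k * weight_factor k) * ln (4 ^ k * b + 4/3)"] by (simp add: lessThan_Suc_atMost[symmetric])
  have "(\<Sum>k<K. (chain_step K k * weight_factor k) * ln (4 ^ k * b + 4/3)) \<le> (2 - 1725/10000) * ln 2 - 3804/10000 * y"
    unfolding sp using 0 1 2 tl K y0 ln2_ge_two_thirds by (simp add: chain_step_cases weight_factor_def)
  then have "d * (\<Sum>k<K. (chain_step K k * weight_factor k) * ln (4 ^ k * b + 4/3)) \<le> d * ((2 - 1725/10000) * ln 2 - 3804/10000 * y)"
    using d by (intro mult_left_mono) auto
  also have "\<dots> = 2 * d * ln 2 - 1725/10000 * ln 2 * d - 3804/10000 * (d * y)" by (simp add: algebra_simps)
  also have "\<dots> \<le> 2 * d * ln 2 - 1725/10000 * ln 2 * 3 - 3804/10000 * (3/5)"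
  proof -
    have "3/5 \<le> d * y" using d by (simp add: y_def field_simps)
    moreover have "1725/10000 * ln 2 * 3 \<le> 1725/10000 * ln 2 * d" using d by (intro mult_left_mono) auto
    ultimately show ?thesis by linarith
  qed
  finally show ?thesis using L ln2_le_25_over_36 by simp
qed

section \<open>Centred processes on the unit ball\<close>

lemma sum_reverse_atMost: "(\<Sum>m\<le>K. g (K - m)) = (\<Sum>k\<le>K. g (k::nat) :: real)"
  using sum.nat_diff_reindex[of g "Suc K"] by (simp add: lessThan_Suc_atMost)

lemma scaled_quadratic: "f \<noteq> 0 \<Longrightarrow> (f\<^sup>2 * x) / (4 * (f * g)) + f * g / 4 = f * (x / (4 * g) + g / (4::real))"
  by (cases "g = 0") (simp_all add: power2_eq_square field_simps)

lemma scaled_constants: "T \<noteq> 0 \<Longrightarrow> (x / (4 * T) + T / 4) + (14/75 * y / (4 * T)) * (15/7) = (x + 2/5 * y) / (4 * T) + T / (4::real)"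
  by (simp add: field_simps)

lemma square_over_double: "T \<noteq> 0 \<Longrightarrow> T\<^sup>2 / (4 * T) + T / 4 = T / (2::real)"
  by (simp add: power2_eq_square field_simps)

text \<open>A chain for points with spread of order \<open>l\<close> about the shrunken points \<open>t u j\<close>.  Its noise level \<open>\<tau>\<close> is proportional to \<open>l\<close> and
chosen such that \<open>qd \<tau>\<^sup>2 = 14 l\<^sup>2 / 75\<close>, where \<open>qd\<close> is the second moment of the noise: then the noise acts in the total weight like an
increase of the squared spread by at most \<open>2 l\<^sup>2 / 5\<close>, for which the hypothesis \<open>far\<close> leaves room.  The hypothesis \<open>avg\<close> makes the average link weights
proportional to \<open>l\<close>, which compensates the growth of the information \<open>ln (4\<^sup>k / \<tau>)\<close> for small \<open>l\<close>; \<open>tl\<close> controls the reference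
weights.\<close>

lemma noisy_chain_bound:
  fixes I :: "'i set" and u :: "'i \<Rightarrow> 'a::euclidean_space" and H :: "'a \<Rightarrow> 'w \<Rightarrow> real"
  assumes I: "finite I" "I \<noteq> {}"
    and q: "\<And>i. i \<in> I \<Longrightarrow> 0 \<le> q i" "(\<Sum>i\<in>I. q i) = 1"
    and u: "\<And>i. i \<in> I \<Longrightarrow> norm (u i) \<le> 1"
    and t: "0 \<le> t" "t \<le> 1" and l: "0 < l" "l \<le> 1"
    and far: "\<And>i. i \<in> I \<Longrightarrow> (\<Sum>j\<in>I. q j * (norm (u i - t *\<^sub>R u j))\<^sup>2) + 2/5 * l\<^sup>2 \<le> (1 + t)\<^sup>2"
    and avg: "(\<Sum>i\<in>I. q i * (\<Sum>j\<in>I. q j * (norm (u i - t *\<^sub>R u j))\<^sup>2)) \<le> 21/20 * l\<^sup>2"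
    and tl: "t\<^sup>2 \<le> 1 - 21/25 * l\<^sup>2"
    and dim: "2 \<le> DIM('a)"
    and M: "prob_space M"
    and cont: "\<And>w. w \<in> space M \<Longrightarrow> continuous_on UNIV (\<lambda>x. H x w)" and H: "\<And>x. H x \<in> borel_measurable M"
    and A: "0 \<le> A"
    and incr: "\<And>x y d. 0 < d \<Longrightarrow> dist x y \<le> d \<Longrightarrow> (\<integral>\<^sup>+w. ennreal (exp (2 * (H x w - H y w) / d)) \<partial>M) \<le> ennreal (exp A)"
  shows "\<exists>C. (\<Sum>i\<in>I. q i * C i) \<le> 2 * real DIM('a) * ln 2 \<and>
    (\<integral>\<^sup>+w. (SUP i\<in>I. ennreal (exp (H (u i) w - (\<Sum>j\<in>I. q j * H (u j) w) - C i))) \<partial>M) \<le> ennreal (exp A)"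
proof -
  define d where "d = real DIM('a)"
  have d2: "2 \<le> d" using dim by (simp add: d_def)
  define qd where "qd = d / (d + 2)"
  have qd: "1/2 \<le> qd" "qd \<le> 1" using d2 by (auto simp: qd_def field_simps)
  define b where "b = sqrt (75 * qd / 14)"
  have b2: "b\<^sup>2 = 75 * qd / 14" using qd by (simp add: b_def)
  have b: "0 < b" using qd by (simp add: b_def)
  define \<tau> where "\<tau> = l / b"
  have \<tau>: "0 < \<tau>" using l b by (simp add: \<tau>_def)
  have qt: "qd * \<tau>\<^sup>2 = 14/75 * l\<^sup>2" unfolding \<tau>_def power_divide b2 using qd by (simp add: field_simps)
  have qt1: "qd * \<tau> = 14/75 * (b * l)"
  proof -
    have "qd = 14/75 * b\<^sup>2" using b2 by simp
    then have "qd * \<tau> = (14/75 * b\<^sup>2) * (l / b)" by (simp only: \<tau>_def)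
    then show ?thesis using b by (simp add: power2_eq_square)
  qed
  have card: "1 \<le> real (card I)" using I by (simp add: Suc_le_eq card_gt_0_iff)
  \<comment> \<open>The finest link costs \<open>ln (card I)\<close>; so many links are used that its weight makes this negligible.\<close>
  obtain K where K9: "9 \<le> K" and KI: "(8/5) / 4 ^ K * (884/1000 * ln (card I)) \<le> 1/200"
  proof -
    have "(\<lambda>K. (8/5) / 4 ^ K * (884/1000 * ln (card I))) \<longlonglongrightarrow> 0"
    proof -
      have "(\<lambda>K. (1/4::real) ^ K) \<longlonglongrightarrow> 0" by (rule LIMSEQ_power_zero) simp
      from tendsto_mult_right[OF this, of "(8/5) * (884/1000 * ln (card I))"]
      show ?thesis by (simp add: power_one_over field_simps)
    qed
    then have "\<forall>\<^sub>F K in sequentially. (8/5) / 4 ^ K * (884/1000 * ln (card I)) < 1/200"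
      by (rule order_tendstoD) simp
    then have "\<forall>\<^sub>F K in sequentially. 9 \<le> K \<and> (8/5) / 4 ^ K * (884/1000 * ln (card I)) < 1/200"
      by (rule eventually_conj[OF eventually_ge_at_top])
    then show ?thesis using that by (auto simp: eventually_sequentially less_imp_le)
  qed
  have K: "3 \<le> K" using K9 by simp
  have fK: "chain_step K K \<le> 1/100000"
  proof -
    have "(4::real) ^ 9 \<le> 4 ^ K" using K9 by (rule power_increasing) simp
    then show ?thesis by (simp add: chain_step_cases(5)[OF K] field_simps)
  qed
  define S where "S m = chain_pos K (Suc K - m)" for m
  define \<sigma> where "\<sigma> m = 4 * \<tau> * 4 ^ m / 4 ^ K" for m
  define r where "r m = 1 + (4/3) * \<tau> / 4 ^ (K - m)" for m
  define info where "info m = (if m = 0 then ln (card I) else d * ln (4 ^ (K - m) / \<tau> + 4/3))" for m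
  define \<nu> where "\<nu> m = (if m = 0 then distr (uniform_count_measure I) borel u else noisy (\<lambda>_. r m) 0 (Suc 0))" for m
  define R where "R m = (if m = 0 then 1 else norm (0::'a) + (\<Sum>i<Suc 0. r m))" for m
  have \<sigma>0: "0 < \<sigma> m" for m using \<tau> by (simp add: \<sigma>_def)
  have r0: "0 < r m" for m using \<tau> by (auto simp: r_def intro!: add_pos_nonneg)
  have sc: "\<sigma> m = \<tau> * (4 / 4 ^ (K - m))" if "m \<le> K" for m
    using that by (simp add: \<sigma>_def power_diff)
  have sum\<sigma>: "(\<Sum>l<m. \<sigma> l) \<le> (4/3) * \<tau> / 4 ^ (K - m)" if "m \<le> K" for m
  proof -
    have "(\<Sum>l<m. \<sigma> l) = 4 * \<tau> / 4 ^ K * (\<Sum>l<m. 4 ^ l)" by (simp add: \<sigma>_def sum_distrib_left)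
    also have "(\<Sum>l<m. (4::real) ^ l) = (4 ^ m - 1) / 3" by (simp add: sum_gp_strict field_simps)
    also have "4 * \<tau> / 4 ^ K * ((4 ^ m - 1) / 3) \<le> 4 * \<tau> / 4 ^ K * (4 ^ m / 3)" using \<tau> by (intro mult_left_mono) auto
    also have "\<dots> = (4/3) * \<tau> / 4 ^ (K - m)" using that by (simp add: power_diff)
    finally show ?thesis .
  qed
  have pow4: "((4::real) ^ k)\<^sup>2 = 16 ^ k" for k by (simp add: power2_eq_square flip: power_mult_distrib)
  have sum\<sigma>2: "(\<Sum>l<m. (\<sigma> l)\<^sup>2) \<le> \<tau>\<^sup>2 * ((16/15) / 16 ^ (K - m))" if "m \<le> K" for m
  proof -
    have "(\<Sum>l<m. (\<sigma> l)\<^sup>2) = 16 * \<tau>\<^sup>2 / 16 ^ K * (\<Sum>l<m. 16 ^ l)"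
      unfolding sum_distrib_left by (intro sum.cong refl) (simp add: \<sigma>_def power_divide power_mult_distrib pow4)
    also have "(\<Sum>l<m. (16::real) ^ l) = (16 ^ m - 1) / 15" by (simp add: sum_gp_strict field_simps)
    also have "16 * \<tau>\<^sup>2 / 16 ^ K * ((16 ^ m - 1) / 15) \<le> 16 * \<tau>\<^sup>2 / 16 ^ K * (16 ^ m / 15)" by (intro mult_left_mono) auto
    also have "\<dots> = \<tau>\<^sup>2 * ((16/15) / 16 ^ (K - m))" using that by (simp add: power_diff)
    finally show ?thesis .
  qed
  interpret noise_chain I u q t S \<sigma> K info \<nu> R
  proof
    show "S 0 = 1" "S (Suc K) = 0" using K by (simp_all add: S_def chain_pos_def)
    show "bounded_prob (\<nu> m) (R m)" for m
      unfolding \<nu>_def R_def using bounded_prob_points(1)[OF I u] bounded_prob_noisy[of "\<lambda>_. r m" 0 "Suc 0"] r0[of m]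
      by (auto simp: less_imp_le simp del: noisy.simps)
    show "(\<integral>\<^sup>+v. h v \<partial>noisy \<sigma> (u i) m) \<le> ennreal (exp (info m)) * (\<integral>\<^sup>+v. h v \<partial>\<nu> m)"
      if m: "m \<le> K" and i: "i \<in> I" and h: "h \<in> borel_measurable borel" for m i h
    proof (cases m)
      case 0
      have "(\<integral>\<^sup>+v. h v \<partial>noisy \<sigma> (u i) m) = h (u i)" using h by (simp add: 0 nn_integral_return)
      then show ?thesis using bounded_prob_points(2)[OF I u h i] card by (simp add: 0 info_def \<nu>_def)
    next
      case (Suc n)
      have "(\<integral>\<^sup>+v. h v \<partial>noisy \<sigma> (u i) (Suc n)) \<le> ennreal ((r m / \<sigma> n) ^ DIM('a)) * (\<integral>\<^sup>+z. h (r m *\<^sub>R z) \<partial>ball_noise)"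
        using \<sigma>0 sum\<sigma>[OF m] u[OF i] unfolding Suc r_def 
        by (intro noisy_dominated[OF h]) (auto simp: less_imp_le simp del: sum.lessThan_Suc)
      also have "(\<integral>\<^sup>+z. h (r m *\<^sub>R z) \<partial>ball_noise) = (\<integral>\<^sup>+v. h v \<partial>\<nu> m)"
        unfolding \<nu>_def using nn_integral_noisy_1[OF h, of "r m"] Suc by (simp del: noisy.simps)
      also have "(r m / \<sigma> n) ^ DIM('a) = exp (info m)"
      proof -
        have e: "\<sigma> n = \<tau> / 4 ^ (K - m)"
        proof -
          have "4 * (4::real) ^ n / 4 ^ K = 1 / 4 ^ (K - m)" using m power_diff[of "4::real" m K] by (simp add: Suc)
          then show ?thesis unfolding \<sigma>_def by (metis mult.assoc mult.commute times_divide_eq_right mult_1)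
        qed
        have "r m / \<sigma> n = 4 ^ (K - m) / \<tau> + 4/3" unfolding e r_def using \<tau> by (simp add: field_simps)
        moreover have "0 < 4 ^ (K - m) / \<tau> + 4/3" using \<tau> by (auto intro!: add_pos_pos)
        ultimately show ?thesis by (simp add: info_def Suc d_def exp_of_nat_mult)
      qed
      finally show ?thesis using Suc by simp
    qed
  qed (use I q u t \<sigma>0 in \<open>auto simp: less_imp_le\<close>)
  have Sd: "S m - S (Suc m) = chain_step K (K - m)" and Ss: "S (Suc m) = chain_pos K (K - m)" if "m \<le> K" for m
    using that by (simp_all add: S_def chain_step_def Suc_diff_le)
  have W: "weight i m \<le> chain_step K (K - m) * ((spread i + 14/75 * l\<^sup>2 * noise_factor (K - m)) / (4 * g) + g / 4)"
    if m: "m \<le> K" and g: "0 < g" for i m g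
  proof -
    let ?f = "chain_step K (K - m)" and ?k = "noise_factor (K - m)" and ?n = "\<Sum>l<m. (\<sigma> l)\<^sup>2"
    have f: "0 < ?f" using chain_step_pos[OF K] by simp
    have "weight i m \<le> (?f\<^sup>2 * (spread i + qd * ?n) + (chain_pos K (K - m) * \<sigma> m)\<^sup>2 * qd) / (4 * (?f * g)) + ?f * g / 4"
      using weight_le[of "?f * g" i m] f g unfolding Sd[OF m] unfolding Ss[OF m] d_def[symmetric] qd_def[symmetric] by simp
    moreover have "?f\<^sup>2 * (spread i + qd * ?n) + (chain_pos K (K - m) * \<sigma> m)\<^sup>2 * qd \<le> ?f\<^sup>2 * (spread i + 14/75 * l\<^sup>2 * ?k)"
    proof -
      have "?f\<^sup>2 * ?n + (chain_pos K (K - m) * \<sigma> m)\<^sup>2 \<le> ?f\<^sup>2 * (\<tau>\<^sup>2 * ((16/15) / 16 ^ (K - m))) + (chain_pos K (K - m) * \<sigma> m)\<^sup>2"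
        by (intro add_mono mult_left_mono sum\<sigma>2 m) auto
      also have "\<dots> = \<tau>\<^sup>2 * (?f\<^sup>2 * ((16/15) / 16 ^ (K - m)) + (chain_pos K (K - m) * (4 / 4 ^ (K - m)))\<^sup>2)"
        unfolding sc[OF m] by (simp add: power_mult_distrib power_divide algebra_simps)
      also have "\<dots> \<le> \<tau>\<^sup>2 * (?f\<^sup>2 * ?k)" using noise_factor_bound[OF K, of "K - m"] by (intro mult_left_mono) auto
      finally have "qd * (?f\<^sup>2 * ?n + (chain_pos K (K - m) * \<sigma> m)\<^sup>2) \<le> qd * (\<tau>\<^sup>2 * (?f\<^sup>2 * ?k))" using qd by (intro mult_left_mono) auto
      also have "\<dots> = (qd * \<tau>\<^sup>2) * (?f\<^sup>2 * ?k)" by simp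
      finally show ?thesis unfolding qt by (simp add: algebra_simps)
    qed
    ultimately have "weight i m \<le> (?f\<^sup>2 * (spread i + 14/75 * l\<^sup>2 * ?k)) / (4 * (?f * g)) + ?f * g / 4"
      using f g by (elim order_trans) (intro add_mono divide_right_mono, auto)
    also have "\<dots> = ?f * ((spread i + 14/75 * l\<^sup>2 * ?k) / (4 * g) + g / 4)"
      using f by (intro scaled_quadratic) simp
    finally show ?thesis .
  qed
  \<comment> \<open>With the trade-off constant \<open>1 + t\<close> in every link, the total weight is at most one.\<close>
  have total: "(1 - t) / 2 + (\<Sum>m\<le>K. weight i m) \<le> 1" if i: "i \<in> I" for i
  proof -
    have "(\<Sum>m\<le>K. weight i m) \<le> (\<Sum>m\<le>K. chain_step K (K - m) * ((spread i + 14/75 * l\<^sup>2 * noise_factor (K - m)) / (4 * (1 + t)) + (1 + t) / 4))"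
      using t by (intro sum_mono W) auto
    also have "\<dots> = (\<Sum>k\<le>K. chain_step K k * ((spread i + 14/75 * l\<^sup>2 * noise_factor k) / (4 * (1 + t)) + (1 + t) / 4))"
      by (rule sum_reverse_atMost)
    also have "\<dots> = (\<Sum>k\<le>K. chain_step K k * (spread i / (4 * (1 + t)) + (1 + t) / 4) + (14/75 * l\<^sup>2 / (4 * (1 + t))) * (chain_step K k * noise_factor k))"
      by (intro sum.cong refl) (simp add: algebra_simps add_divide_distrib)
    also have "\<dots> = (spread i / (4 * (1 + t)) + (1 + t) / 4) + (14/75 * l\<^sup>2 / (4 * (1 + t))) * (\<Sum>k\<le>K. chain_step K k * noise_factor k)"
      unfolding sum.distrib sum_distrib_left[symmetric] sum_distrib_right[symmetric] using K by (simp add: sum_chain_step)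
    also have "\<dots> \<le> (spread i / (4 * (1 + t)) + (1 + t) / 4) + (14/75 * l\<^sup>2 / (4 * (1 + t))) * (15/7)"
      using t sum_noise_factor(1)[OF K] by (intro add_left_mono mult_left_mono) auto
    also have "\<dots> = (spread i + 2/5 * l\<^sup>2) / (4 * (1 + t)) + (1 + t) / 4"
      using t by (intro scaled_constants) simp
    also have "\<dots> \<le> (1 + t)\<^sup>2 / (4 * (1 + t)) + (1 + t) / 4"
      using far[OF i] t unfolding spread_def by (intro add_right_mono divide_right_mono) auto
    also have "\<dots> = (1 + t) / 2" using t by (intro square_over_double) simp
    finally show ?thesis by (simp add: field_simps)
  qed
  \<comment> \<open>Averaged over \<open>i\<close>, the squared spread is of order \<open>l\<^sup>2\<close>, and trade-off constants proportional to \<open>l\<close> are better.\<close>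
  have Wavg: "(\<Sum>i\<in>I. q i * weight i m) \<le> l * (chain_step K (K - m) * weight_factor (K - m))" if m: "m \<le> K" for m
  proof -
    let ?f = "chain_step K (K - m)" and ?k = "noise_factor (K - m)" and ?r = "weight_scale (K - m)"
    have f: "0 < ?f" using chain_step_pos[OF K] by simp
    have g: "0 < ?r" by (simp add: weight_scale_def)
    have "(\<Sum>i\<in>I. q i * weight i m) \<le> (\<Sum>i\<in>I. q i * (?f * ((spread i + 14/75 * l\<^sup>2 * ?k) / (4 * (l * ?r)) + l * ?r / 4)))"
      using l g by (intro sum_mono mult_left_mono W m q) auto
    also have "\<dots> = (\<Sum>i\<in>I. ?f / (4 * (l * ?r)) * (q i * spread i) + q i * (?f * ((14/75 * l\<^sup>2 * ?k) / (4 * (l * ?r)) + l * ?r / 4)))"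
      by (intro sum.cong refl) (simp add: algebra_simps add_divide_distrib)
    also have "\<dots> = ?f / (4 * (l * ?r)) * (\<Sum>i\<in>I. q i * spread i) + ?f * ((14/75 * l\<^sup>2 * ?k) / (4 * (l * ?r)) + l * ?r / 4)"
      unfolding sum.distrib sum_distrib_left[symmetric] sum_distrib_right[symmetric] q(2) by simp
    also have "\<dots> \<le> ?f / (4 * (l * ?r)) * (21/20 * l\<^sup>2) + ?f * ((14/75 * l\<^sup>2 * ?k) / (4 * (l * ?r)) + l * ?r / 4)"
      using avg f l g unfolding spread_def by (intro add_right_mono mult_left_mono) auto
    also have "\<dots> = l * (?f * ((21/20 + 14/75 * ?k) / (4 * ?r) + ?r / 4))"
      using l g by (simp add: field_simps power2_eq_square)
    also have "\<dots> \<le> l * (?f * weight_factor (K - m))"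
      using l f weight_factor_bound by (intro mult_left_mono) auto
    finally show ?thesis .
  qed
  have info0: "0 \<le> info m" for m
    using card \<tau> d2 by (auto simp: info_def add_increasing intro!: mult_nonneg_nonneg ln_ge_zero)
  define c where "c k = chain_step K k * weight_factor k" for k
  have c0: "0 \<le> c k" if "k \<le> K" for k using chain_step_pos[OF K that] by (simp add: c_def weight_factor_def)
  have tilt: "(\<Sum>i\<in>I. q i * tilt i) \<le> d * (\<Sum>k<K. c k * ln (4 ^ k * b + 4/3)) + 1/200"
  proof -
    have "(\<Sum>i\<in>I. q i * tilt i) = (\<Sum>m\<le>K. info m * (\<Sum>i\<in>I. q i * weight i m))"
      unfolding tilt_def sum_distrib_left by (subst sum.swap) (simp add: mult_ac)
    also have "\<dots> \<le> (\<Sum>m\<le>K. c (K - m) * (if K - m = K then ln (card I) else d * ln (4 ^ (K - m) * b + 4/3)))"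
    proof (rule sum_mono)
      fix m assume "m \<in> {..K}"
      then have m: "m \<le> K" by simp
      have "info m * (\<Sum>i\<in>I. q i * weight i m) \<le> info m * (l * c (K - m))"
        unfolding c_def by (intro mult_left_mono Wavg m info0)
      also have "\<dots> = c (K - m) * (l * info m)" by simp
      also have "\<dots> \<le> c (K - m) * (if K - m = K then ln (card I) else d * ln (4 ^ (K - m) * b + 4/3))"
      proof (rule mult_left_mono[OF _ c0])
        show "l * info m \<le> (if K - m = K then ln (card I) else d * ln (4 ^ (K - m) * b + 4/3))"
        proof (cases "m = 0")
          case True
          then show ?thesis using l card by (simp add: info_def mult_left_le_one_le)
        next
          case False
          have "l * ln (4 ^ (K - m) * b / l + 4/3) \<le> ln (4 ^ (K - m) * b + 4/3)"
            using l b by (intro scaled_log_le) auto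
          then have "d * (l * ln (4 ^ (K - m) * b / l + 4/3)) \<le> d * ln (4 ^ (K - m) * b + 4/3)"
            using d2 by (intro mult_left_mono) auto
          moreover have "K - m \<noteq> K" using False K m by simp
          ultimately show ?thesis using False by (simp add: info_def \<tau>_def mult_ac)
        qed
      qed simp
      finally show "info m * (\<Sum>i\<in>I. q i * weight i m) \<le> c (K - m) * (if K - m = K then ln (card I) else d * ln (4 ^ (K - m) * b + 4/3))" .
    qed
    also have "\<dots> = (\<Sum>k\<le>K. c k * (if k = K then ln (card I) else d * ln (4 ^ k * b + 4/3)))"
      by (rule sum_reverse_atMost)
    also have "\<dots> = (\<Sum>k<K. c k * (if k = K then ln (card I) else d * ln (4 ^ k * b + 4/3))) + c K * ln (card I)"
      by (simp add: lessThan_Suc_atMost[symmetric])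
    also have "(\<Sum>k<K. c k * (if k = K then ln (card I) else d * ln (4 ^ k * b + 4/3))) = d * (\<Sum>k<K. c k * ln (4 ^ k * b + 4/3))"
      unfolding sum_distrib_left by (intro sum.cong) auto
    also have "c K * ln (card I) \<le> 1/200"
      using KI K by (simp add: c_def chain_step_cases weight_factor_def)
    finally show ?thesis by simp
  qed
  \<comment> \<open>\<open>X\<close> bounds the second moments under the reference laws; the trade-off constant \<open>g\<close> is common to all links.\<close>
  define X where "X = 1 + 133375/100000 * qd + 1/10000"
  have ref: "(\<Sum>m\<le>K. ref_weight m) \<le> X / (4 * g) + g / 4" if g: "0 < g" for g
  proof -
    define B where "B k = t\<^sup>2 + qd * (1 + (4/3) * \<tau> / 4 ^ k)\<^sup>2 + (if k = K then 4 else 0)" for k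
    define \<kappa> where "\<kappa> k = (if k = 0 then 0 else noise_factor k)" for k
    have one: "ref_weight m \<le> chain_step K (K - m) * ((B (K - m) + 14/75 * l\<^sup>2 * \<kappa> (K - m)) / (4 * g) + g / 4)" if m: "m \<le> K" for m
    proof -
      let ?f = "chain_step K (K - m)"
      have f: "0 < ?f" using chain_step_pos[OF K] by simp
      have mom: "(\<integral>v. (norm (v - start j))\<^sup>2 \<partial>\<nu> m) \<le> B (K - m)" if j: "j \<in> I" for j
      proof -
        have st: "norm (start j) \<le> t" unfolding start_def using u[OF j] t by (simp add: mult_left_le)
        show ?thesis
        proof (cases "m = 0")
          case True
          have "(\<integral>v. (norm (v - start j))\<^sup>2 \<partial>distr (uniform_count_measure I) borel u) \<le> 4"
          proof (rule bounded_prob_points(3)[OF I u])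
            fix i assume "i \<in> I"
            then have "norm (u i - start j) \<le> 2" using u[of i] st t norm_triangle_ineq4[of "u i" "start j"] by linarith
            then have "(norm (u i - start j))\<^sup>2 \<le> 2\<^sup>2" by (intro power_mono) auto
            then show "(norm (u i - start j))\<^sup>2 \<le> 4" by simp
          qed (auto intro!: continuous_intros)
          moreover have "4 \<le> B (K - m)" using True qd by (auto simp: B_def)
          ultimately show ?thesis by (simp add: \<nu>_def True)
        next
          case False
          have "(\<integral>v. (norm (v - start j))\<^sup>2 \<partial>\<nu> m) = (norm (start j))\<^sup>2 + qd * (r m)\<^sup>2"
            using False noisy_second_moment[where \<sigma>="\<lambda>_. r m" and a="start j" and u=0 and m="Suc 0"] r0[of m] 
            by (simp add: \<nu>_def qd_def d_def less_imp_le del: noisy.simps)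
          also have "\<dots> \<le> t\<^sup>2 + qd * (r m)\<^sup>2" using st by (intro add_right_mono power_mono) auto
          also have "\<dots> \<le> B (K - m)" unfolding B_def r_def by auto
          finally show ?thesis .
        qed
      qed
      have "ref_weight m \<le> (?f\<^sup>2 * B (K - m) + (chain_pos K (K - m) * \<sigma> m)\<^sup>2 * qd) / (4 * (?f * g)) + ?f * g / 4"
        using ref_weight_le[of "?f * g" m "B (K - m)", OF _ mom] f g unfolding Sd[OF m] unfolding Ss[OF m] d_def[symmetric] qd_def[symmetric] by simp
      moreover have "?f\<^sup>2 * B (K - m) + (chain_pos K (K - m) * \<sigma> m)\<^sup>2 * qd \<le> ?f\<^sup>2 * (B (K - m) + 14/75 * l\<^sup>2 * \<kappa> (K - m))"
      proof -
        have "(chain_pos K (K - m) * (4 / 4 ^ (K - m)))\<^sup>2 \<le> ?f\<^sup>2 * \<kappa> (K - m)"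
        proof (cases "K - m = 0")
          case False
          have "(chain_pos K (K - m) * (4 / 4 ^ (K - m)))\<^sup>2 \<le> ?f\<^sup>2 * ((16/15) / 16 ^ (K - m)) + (chain_pos K (K - m) * (4 / 4 ^ (K - m)))\<^sup>2" by simp
          also have "\<dots> \<le> ?f\<^sup>2 * noise_factor (K - m)" by (rule noise_factor_bound[OF K]) simp
          finally show ?thesis using False by (simp add: \<kappa>_def)
        qed (simp add: chain_pos_def \<kappa>_def)
        then have "(qd * \<tau>\<^sup>2) * (chain_pos K (K - m) * (4 / 4 ^ (K - m)))\<^sup>2 \<le> (qd * \<tau>\<^sup>2) * (?f\<^sup>2 * \<kappa> (K - m))"
          using qd by (intro mult_left_mono) auto
        moreover have "(chain_pos K (K - m) * \<sigma> m)\<^sup>2 * qd = (qd * \<tau>\<^sup>2) * (chain_pos K (K - m) * (4 / 4 ^ (K - m)))\<^sup>2"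
          unfolding sc[OF m] by (simp add: power_mult_distrib power_divide)
        ultimately show ?thesis unfolding qt by (simp add: algebra_simps)
      qed
      ultimately have "ref_weight m \<le> (?f\<^sup>2 * (B (K - m) + 14/75 * l\<^sup>2 * \<kappa> (K - m))) / (4 * (?f * g)) + ?f * g / 4"
        using f g by (elim order_trans) (intro add_mono divide_right_mono, auto)
      also have "\<dots> = ?f * ((B (K - m) + 14/75 * l\<^sup>2 * \<kappa> (K - m)) / (4 * g) + g / 4)"
        using f by (intro scaled_quadratic) simp
      finally show ?thesis .
    qed
    let ?f = "chain_step K"
    have "(\<Sum>m\<le>K. ref_weight m) \<le> (\<Sum>m\<le>K. ?f (K - m) * ((B (K - m) + 14/75 * l\<^sup>2 * \<kappa> (K - m)) / (4 * g) + g / 4))"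
      by (intro sum_mono one) auto
    also have "\<dots> = (\<Sum>k\<le>K. ?f k * ((B k + 14/75 * l\<^sup>2 * \<kappa> k) / (4 * g) + g / 4))"
      by (rule sum_reverse_atMost)
    also have "\<dots> = (\<Sum>k\<le>K. (1 / (4 * g)) * (?f k * B k + 14/75 * l\<^sup>2 * (?f k * \<kappa> k)) + ?f k * (g / 4))"
      by (intro sum.cong refl) (simp add: algebra_simps add_divide_distrib)
    also have "\<dots> = (1 / (4 * g)) * ((\<Sum>k\<le>K. ?f k * B k) + 14/75 * l\<^sup>2 * (\<Sum>k\<le>K. ?f k * \<kappa> k)) + g / 4"
      unfolding sum.distrib sum_distrib_left[symmetric] sum_distrib_right[symmetric] using K by (simp add: sum_chain_step)
    also have "(\<Sum>k\<le>K. ?f k * B k) = (\<Sum>k\<le>K. ?f k * (t\<^sup>2 + qd) + (8/3 * (qd * \<tau>)) * (?f k * (1 / 4 ^ k)) + (16/9 * (qd * \<tau>\<^sup>2)) * (?f k * (1 / 16 ^ k)) + (if k = K then 4 * ?f K else 0))"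
    proof (intro sum.cong refl)
      fix k
      have "((4::real) ^ k)\<^sup>2 = 16 ^ k" by (simp add: power2_eq_square flip: power_mult_distrib)
      then have "(1 + (4/3) * \<tau> / 4 ^ k)\<^sup>2 = 1 + (8/3) * \<tau> * (1 / 4 ^ k) + (16/9) * \<tau>\<^sup>2 * (1 / 16 ^ k)"
        by (simp add: power2_sum power_divide power_mult_distrib)
      then show "?f k * B k = ?f k * (t\<^sup>2 + qd) + (8/3 * (qd * \<tau>)) * (?f k * (1 / 4 ^ k)) + (16/9 * (qd * \<tau>\<^sup>2)) * (?f k * (1 / 16 ^ k)) + (if k = K then 4 * ?f K else 0)"
        unfolding B_def by (simp add: algebra_simps)
    qed
    also have "\<dots> = (t\<^sup>2 + qd) + (8/3 * (qd * \<tau>)) * (\<Sum>k\<le>K. ?f k * (1 / 4 ^ k)) + (16/9 * (qd * \<tau>\<^sup>2)) * (\<Sum>k\<le>K. ?f k * (1 / 16 ^ k)) + 4 * ?f K"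
      unfolding sum.distrib sum_distrib_left[symmetric] sum_distrib_right[symmetric] using K by (simp add: sum_chain_step)
    also have "(1 / (4 * g)) * (\<dots> + 14/75 * l\<^sup>2 * (\<Sum>k\<le>K. ?f k * \<kappa> k)) + g / 4 \<le> (1 / (4 * g)) * X + g / 4"
    proof (intro add_right_mono mult_left_mono)
      have 1: "(8/3 * (qd * \<tau>)) * (\<Sum>k\<le>K. ?f k * (1 / 4 ^ k)) \<le> (8/3 * (qd * \<tau>)) * (6061/10000)"
        using sum_chain_step_powers(1)[OF K] fK qd \<tau> by (intro mult_left_mono) auto
      have 2: "(16/9 * (qd * \<tau>\<^sup>2)) * (\<Sum>k\<le>K. ?f k * (1 / 16 ^ k)) \<le> (16/9 * (qd * \<tau>\<^sup>2)) * (5255/10000)"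
        using sum_chain_step_powers(2)[OF K] fK qd \<tau> by (intro mult_left_mono) auto
      have 3: "14/75 * l\<^sup>2 * (\<Sum>k\<le>K. ?f k * \<kappa> k) \<le> 14/75 * l\<^sup>2 * (16049/10000)"
        using sum_noise_factor(2)[OF K] unfolding \<kappa>_def by (intro mult_left_mono) auto
      \<comment> \<open>The term linear in \<open>l\<close> comes from the noise enlarging the reference balls; a square is completed to absorb it.\<close>
      have 4: "302/1000 * (b * l) \<le> 366/1000 * l\<^sup>2 + 623/10000 * b\<^sup>2"
      proof -
        have "0 \<le> 366/1000 * (l - 302/732 * b)\<^sup>2" by simp
        also have "\<dots> = 366/1000 * l\<^sup>2 - 302/1000 * (b * l) + 366/1000 * (302/732)\<^sup>2 * b\<^sup>2" by (simp add: power2_eq_square algebra_simps)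
        also have "366/1000 * (302/732)\<^sup>2 * b\<^sup>2 \<le> 623/10000 * b\<^sup>2" by (intro mult_right_mono) (auto simp: power2_eq_square)
        finally show ?thesis by simp
      qed
      have 5: "0 \<le> b * l" "0 \<le> l\<^sup>2" using b l by auto
      have le1: "(8/3 * (qd * \<tau>)) * (\<Sum>k\<le>K. ?f k * (1 / 4 ^ k)) \<le> 302/1000 * (b * l)"
        using 5 by (intro order_trans[OF 1]) (simp add: qt1)
      have le2: "(16/9 * (qd * \<tau>\<^sup>2)) * (\<Sum>k\<le>K. ?f k * (1 / 16 ^ k)) \<le> 17439/100000 * l\<^sup>2"
        using 5 by (intro order_trans[OF 2]) (simp add: qt)
      have le3: "14/75 * l\<^sup>2 * (\<Sum>k\<le>K. ?f k * \<kappa> k) \<le> 299582/1000000 * l\<^sup>2"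
        using 5 by (intro order_trans[OF 3]) simp
      show "(t\<^sup>2 + qd) + (8/3 * (qd * \<tau>)) * (\<Sum>k\<le>K. ?f k * (1 / 4 ^ k)) + (16/9 * (qd * \<tau>\<^sup>2)) * (\<Sum>k\<le>K. ?f k * (1 / 16 ^ k)) + 4 * ?f K + 14/75 * l\<^sup>2 * (\<Sum>k\<le>K. ?f k * \<kappa> k) \<le> X"
        using le1 le2 le3 4 5 tl fK unfolding b2 X_def by linarith
    qed (use g in auto)
    finally show ?thesis by simp
  qed
  obtain D where D: "(\<Sum>m\<le>K. ref_weight m) \<le> D" "0 < D" and cost: "d * (\<Sum>k<K. c k * ln (4 ^ k * b + 4/3)) + ln (1 + D) \<le> 2 * d * ln 2 - 1/200"
  proof (cases "d = 2")
    case True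
    have "b \<le> 1637/1000"
    proof -
      have "b\<^sup>2 \<le> (1637/1000)\<^sup>2" unfolding b2 qd_def True by (simp add: power2_eq_square)
      then show ?thesis by (rule power2_le_imp_le) simp
    qed
    then have "2 * (\<Sum>k<K. c k * ln (4 ^ k * b + 4/3)) + ln (1 + 6457/10000) \<le> (4 - 1/20) * ln 2"
      unfolding c_def using chain_cost_dim2[OF K b] by simp
    moreover have "(\<Sum>m\<le>K. ref_weight m) \<le> 6457/10000"
      using ref[of "129/100"] unfolding X_def qd_def True by simp
    ultimately show ?thesis using ln2_ge_two_thirds by (intro that[of "6457/10000"]) (auto simp: True)
  next
    case False
    then have "3 \<le> DIM('a)" using dim by (simp add: d_def)
    then have d3: "3 \<le> d" by (simp add: d_def)
    have "b \<le> 23146/10000 * (1 - 1 / (d + 2))"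
    proof (rule power2_le_imp_le)
      have "qd \<le> (1 - 1 / (d + 2))\<^sup>2" 
      proof -
        have "qd = 1 - 2 * (1 / (d + 2))" using d2 by (simp add: qd_def field_simps)
        then show ?thesis by (simp add: power2_diff)
      qed
      then have "75 * qd / 14 \<le> (23146/10000)\<^sup>2 * (1 - 1 / (d + 2))\<^sup>2"
      proof (rule order_trans[rotated, OF mult_left_mono])
        show "75 * qd / 14 \<le> (23146/10000)\<^sup>2 * qd" using qd by (simp add: power2_eq_square)
      qed simp
      then show "b\<^sup>2 \<le> (23146/10000 * (1 - 1 / (d + 2)))\<^sup>2" unfolding b2 power_mult_distrib .
    qed (use d2 in \<open>simp add: field_simps\<close>)
    from chain_cost_dim_ge3[OF K d3 b this]
    have "d * (\<Sum>k<K. c k * ln (4 ^ k * b + 4/3)) + ln (1 + 764/1000) \<le> 2 * d * ln 2 - 1/200" unfolding c_def .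
    moreover have "(\<Sum>m\<le>K. ref_weight m) \<le> 764/1000"
      using ref[of "1527/1000"] qd unfolding X_def by (simp add: field_simps)
    ultimately show ?thesis by (intro that[of "764/1000"]) auto
  qed
  let ?C = "\<lambda>i. tilt i + ln (1 + D)"
  have "(\<Sum>i\<in>I. q i * ?C i) = (\<Sum>i\<in>I. q i * tilt i) + ln (1 + D)"
    unfolding distrib_left sum.distrib sum_distrib_right[symmetric] q(2) by simp
  then have "(\<Sum>i\<in>I. q i * ?C i) \<le> 2 * real DIM('a) * ln 2" using tilt cost unfolding d_def by simp
  moreover have "(\<integral>\<^sup>+w. (SUP i\<in>I. ennreal (exp (H (u i) w - (\<Sum>j\<in>I. q j * H (u j) w) - ?C i))) \<partial>M) \<le> ennreal (exp A)"
    using D by (intro exponential_bound[OF M cont H A incr total]) auto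
  ultimately show ?thesis by (intro exI[of _ ?C] conjI)
qed

text \<open>Choice of the shrinking factor \<open>t\<close> and of the scale \<open>l\<close>, when \<open>1 - w\<close> is the length of the mean of the points.  If \<open>w\<close> is large, the
points are spread out and \<open>l = 1\<close>; if it is small, they cluster around a point of the sphere and \<open>l\<^sup>2\<close> is proportional to \<open>w\<close>.  In
both cases \<open>t w = l\<^sup>2 / 5\<close>.\<close>

lemma starting_scale:
  fixes w :: real
  assumes "0 < w" "w \<le> 1"
  obtains t l where "0 \<le> t" "t \<le> 1" "0 < l" "l \<le> 1" "1 + t\<^sup>2 + 2 * t * (1 - w) + 2/5 * l\<^sup>2 \<le> (1 + t)\<^sup>2"
    "1 + t\<^sup>2 - 2 * t * (1 - w)\<^sup>2 \<le> 21/20 * l\<^sup>2" "t\<^sup>2 \<le> 1 - 21/25 * l\<^sup>2"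
proof (cases "1/2 \<le> w")
  case True
  \<comment> \<open>The polynomial is nearly tangent to zero at \<open>87/100\<close>, whence the square.\<close>
  have poly: "1 - 10 * w + 75/4 * w\<^sup>2 - 10 * w ^ 3 \<le> 0"
  proof -
    have "0 \<le> 10 * (w - 87/100)\<^sup>2 * (w - 135/1000)" using True by simp
    also have "\<dots> = 10 * w ^ 3 - 75/4 * w\<^sup>2 + 9918/1000 * w - 10218150/10000000" by (simp add: power2_eq_square power3_eq_cube field_simps)
    finally show ?thesis using True by simp
  qed
  show ?thesis
  proof (rule that[of "1 / (5 * w)" 1])
    have "1 + (1 / (5 * w))\<^sup>2 - 2 * (1 / (5 * w)) * (1 - w)\<^sup>2 - 21/20 = (1 - 10 * w + 75/4 * w\<^sup>2 - 10 * w ^ 3) / (25 * w\<^sup>2)"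
      using assms by (simp add: field_simps power2_eq_square power3_eq_cube)
    also have "\<dots> \<le> 0" using poly by (simp add: divide_nonpos_nonneg)
    finally show "1 + (1 / (5 * w))\<^sup>2 - 2 * (1 / (5 * w)) * (1 - w)\<^sup>2 \<le> 21/20 * 1\<^sup>2" by simp
    have "1 / (5 * w) \<le> 2/5" using True by (simp add: field_simps)
    then have "(1 / (5 * w))\<^sup>2 \<le> (2/5)\<^sup>2" using assms by (intro power_mono) auto
    then show "(1 / (5 * w))\<^sup>2 \<le> 1 - 21/25 * 1\<^sup>2" by (simp add: power2_eq_square)
    show "1 + (1 / (5 * w))\<^sup>2 + 2 * (1 / (5 * w)) * (1 - w) + 2/5 * 1\<^sup>2 \<le> (1 + 1 / (5 * w))\<^sup>2"
      using assms by (simp add: field_simps power2_eq_square)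
  qed (use True in \<open>auto simp: field_simps\<close>)
next
  case False
  have c: "0 < 1 + 3 * w" using assms by simp
  define t where "t = 1 / (1 + 3 * w)"
  have t: "0 < t" "t \<le> 1" using assms by (auto simp: t_def)
  have t1: "t * (1 + 3 * w) = 1" using c by (simp add: t_def)
  have l2: "(sqrt (5 * w * t))\<^sup>2 = 5 * w * t" using assms t by simp
  have wt: "5 * w * t \<le> 1" using assms c False by (simp add: t_def field_simps)
  show ?thesis
  proof (rule that[of t "sqrt (5 * w * t)"])
    show "1 + t\<^sup>2 + 2 * t * (1 - w) + 2/5 * (sqrt (5 * w * t))\<^sup>2 \<le> (1 + t)\<^sup>2"
      unfolding l2 by (simp add: power2_eq_square algebra_simps)
    have "1 + t\<^sup>2 - 2 * t * (1 - w)\<^sup>2 - 21/20 * (5 * w * t) = t\<^sup>2 * (w * (13/4 * w - 5/4 - 6 * w\<^sup>2))"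
    proof -
      have e: "1 = t\<^sup>2 * (1 + 3 * w)\<^sup>2" "t = t\<^sup>2 * (1 + 3 * w)" 
      proof -
        show "1 = t\<^sup>2 * (1 + 3 * w)\<^sup>2" unfolding power_mult_distrib[symmetric] t1 by simp
        have "t\<^sup>2 * (1 + 3 * w) = t * (t * (1 + 3 * w))" by (simp only: power2_eq_square mult.assoc)
        then show "t = t\<^sup>2 * (1 + 3 * w)" unfolding t1 by simp
      qed
      have "1 + t\<^sup>2 - 2 * t * (1 - w)\<^sup>2 - 21/20 * (5 * w * t) = t\<^sup>2 * (1 + 3 * w)\<^sup>2 + t\<^sup>2 - 2 * (t\<^sup>2 * (1 + 3 * w)) * (1 - w)\<^sup>2 - 21/20 * (5 * w * (t\<^sup>2 * (1 + 3 * w)))"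
        by (simp only: e[symmetric])
      then show ?thesis by (simp add: power2_eq_square algebra_simps)
    qed
    also have "\<dots> \<le> 0"
    proof -
      have "13/4 * w - 5/4 - 6 * w\<^sup>2 = - (6 * (w - 13/48)\<^sup>2) - (5/4 - 169/384)" by (simp add: power2_eq_square algebra_simps)
      also have "\<dots> \<le> 0" using zero_le_power2[of "w - 13/48"] by linarith
      finally show ?thesis using assms by (intro mult_nonneg_nonpos) auto
    qed
    finally show "1 + t\<^sup>2 - 2 * t * (1 - w)\<^sup>2 \<le> 21/20 * (sqrt (5 * w * t))\<^sup>2" unfolding l2 by simp
    have "0 \<le> t * w * (18/10 - 36/10 * w) * t" using t assms False by (intro mult_nonneg_nonneg) auto
    moreover have "1 - 21/25 * (5 * w * t) - t\<^sup>2 = t * w * (18/10 - 36/10 * w) * t"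
    proof -
      have e: "1 = t * (1 + 3 * w) * (t * (1 + 3 * w))" "t = t * (t * (1 + 3 * w))" unfolding t1 by simp_all
      have "1 - 21/25 * (5 * w * t) - t\<^sup>2 = t * (1 + 3 * w) * (t * (1 + 3 * w)) - 21/25 * (5 * w * (t * (t * (1 + 3 * w)))) - t\<^sup>2"
        by (simp only: e[symmetric])
      then show ?thesis by (simp add: power2_eq_square algebra_simps)
    qed
    ultimately show "t\<^sup>2 \<le> 1 - 21/25 * (sqrt (5 * w * t))\<^sup>2" unfolding l2 by linarith
  qed (use assms t wt in auto)
qed

text \<open>The spread of the points about \<open>t u j\<close> is controlled by the length of their mean \<open>a\<close>.  If \<open>a\<close> lies on the
unit sphere, all points coincide and nothing has to be proved; otherwise \<open>starting_scale\<close> provides a chain.\<close>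

lemma centred_envelope_multidim:
  fixes I :: "'i set" and u :: "'i \<Rightarrow> 'a::euclidean_space" and H :: "'a \<Rightarrow> 'w \<Rightarrow> real"
  assumes I: "finite I" "I \<noteq> {}"
    and q: "\<And>i. i \<in> I \<Longrightarrow> 0 < q i" "(\<Sum>i\<in>I. q i) = 1"
    and u: "\<And>i. i \<in> I \<Longrightarrow> norm (u i) \<le> 1"
    and dim: "2 \<le> DIM('a)"
    and M: "prob_space M"
    and cont: "\<And>w. w \<in> space M \<Longrightarrow> continuous_on UNIV (\<lambda>x. H x w)" and H: "\<And>x. H x \<in> borel_measurable M"
    and A: "0 \<le> A"
    and incr: "\<And>x y d. 0 < d \<Longrightarrow> dist x y \<le> d \<Longrightarrow> (\<integral>\<^sup>+w. ennreal (exp (2 * (H x w - H y w) / d)) \<partial>M) \<le> ennreal (exp A)"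
  shows "\<exists>C. (\<Sum>i\<in>I. q i * C i) \<le> 2 * real DIM('a) * ln 2 \<and>
    (\<integral>\<^sup>+w. (SUP i\<in>I. ennreal (exp (H (u i) w - (\<Sum>j\<in>I. q j * H (u j) w) - C i))) \<partial>M) \<le> ennreal (exp A)"
proof -
  define a where "a = (\<Sum>j\<in>I. q j *\<^sub>R u j)"
  have q0: "0 \<le> q i" if "i \<in> I" for i using q(1)[OF that] by simp
  have a1: "norm a \<le> 1"
  proof -
    have "norm a \<le> (\<Sum>j\<in>I. norm (q j *\<^sub>R u j))" unfolding a_def by (rule norm_sum)
    also have "\<dots> \<le> (\<Sum>j\<in>I. q j)" using u q0 by (intro sum_mono) (auto simp: mult_left_le)
    finally show ?thesis using q(2) by simp
  qed
  have inner_a: "(\<Sum>j\<in>I. q j * (x \<bullet> u j)) = x \<bullet> a" for x by (simp add: a_def inner_sum_right)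
  define s where "s = (\<Sum>j\<in>I. q j * (norm (u j))\<^sup>2)"
  have s1: "s \<le> 1"
  proof -
    have "s \<le> (\<Sum>j\<in>I. q j * 1\<^sup>2)" unfolding s_def using u q0 by (intro sum_mono mult_left_mono power_mono) auto
    then show ?thesis using q(2) by simp
  qed
  have spread: "(\<Sum>j\<in>I. q j * (norm (x - t *\<^sub>R u j))\<^sup>2) = (norm x)\<^sup>2 - 2 * t * (x \<bullet> a) + t\<^sup>2 * s" for x t
  proof -
    have "(\<Sum>j\<in>I. q j * (norm (x - t *\<^sub>R u j))\<^sup>2) = (\<Sum>j\<in>I. q j * (norm x)\<^sup>2 - 2 * t * (q j * (x \<bullet> u j)) + t\<^sup>2 * (q j * (norm (u j))\<^sup>2))"
      by (intro sum.cong refl, unfold power2_norm_eq_inner)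
         (simp add: inner_diff_left inner_diff_right inner_commute power2_eq_square algebra_simps)
    also have "\<dots> = (norm x)\<^sup>2 - 2 * t * (x \<bullet> a) + t\<^sup>2 * s"
      unfolding sum.distrib sum_subtractf sum_distrib_left[symmetric] sum_distrib_right[symmetric] q(2) inner_a s_def by simp
    finally show ?thesis .
  qed
  show ?thesis
  proof (cases "norm a = 1")
    case True
    have "(\<Sum>j\<in>I. q j * (norm (a - 1 *\<^sub>R u j))\<^sup>2) = (norm a)\<^sup>2 - 2 * 1 * (a \<bullet> a) + 1\<^sup>2 * s" by (rule spread)
    also have "\<dots> \<le> 0" using True s1 by (simp add: dot_square_norm)
    finally have "(\<Sum>j\<in>I. q j * (norm (a - 1 *\<^sub>R u j))\<^sup>2) = 0" using q0 by (intro antisym sum_nonneg) auto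
    then have "\<forall>j\<in>I. q j * (norm (a - 1 *\<^sub>R u j))\<^sup>2 = 0" using I(1) q0 by (subst (asm) sum_nonneg_eq_0_iff) auto
    then have ua: "u j = a" if "j \<in> I" for j using q(1)[OF that] that by auto
    have z: "H (u i) w - (\<Sum>j\<in>I. q j * H (u j) w) - 0 = 0" if "i \<in> I" for i w
    proof -
      have "(\<Sum>j\<in>I. q j * H (u j) w) = (\<Sum>j\<in>I. q j * H a w)" by (intro sum.cong) (auto simp: ua)
      then show ?thesis using that q(2) by (simp add: ua sum_distrib_right[symmetric])
    qed
    have "(\<integral>\<^sup>+w. (SUP i\<in>I. ennreal (exp (H (u i) w - (\<Sum>j\<in>I. q j * H (u j) w) - 0))) \<partial>M) = (\<integral>\<^sup>+w. 1 \<partial>M)"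
    proof (rule nn_integral_cong)
      fix w
      have "(SUP i\<in>I. ennreal (exp (H (u i) w - (\<Sum>j\<in>I. q j * H (u j) w) - 0))) = (SUP i\<in>I. 1)"
        by (intro SUP_cong refl) (subst z, auto)
      then show "(SUP i\<in>I. ennreal (exp (H (u i) w - (\<Sum>j\<in>I. q j * H (u j) w) - 0))) = 1" using I(2) by simp
    qed
    also have "\<dots> = 1" using prob_space.emeasure_space_1[OF M] by simp
    also have "\<dots> \<le> ennreal (exp A)" using A by simp
    finally show ?thesis by (intro exI[of _ "\<lambda>_. 0"]) auto
  next
    case False
    then have w: "0 < 1 - norm a" "1 - norm a \<le> 1" using a1 by auto
    from starting_scale[OF w] obtain t l where tl: "0 \<le> t" "t \<le> 1" "0 < l" "l \<le> 1"
      and far: "1 + t\<^sup>2 + 2 * t * (1 - (1 - norm a)) + 2/5 * l\<^sup>2 \<le> (1 + t)\<^sup>2"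
      and avg: "1 + t\<^sup>2 - 2 * t * (1 - (1 - norm a))\<^sup>2 \<le> 21/20 * l\<^sup>2" and t2: "t\<^sup>2 \<le> 1 - 21/25 * l\<^sup>2" .
    show ?thesis
    proof (rule noisy_chain_bound[OF I q0 q(2) u tl _ _ t2 dim M cont H A incr])
      fix i assume i: "i \<in> I"
      have "- (2 * t * (u i \<bullet> a)) \<le> 2 * t * norm a"
      proof -
        have "- (u i \<bullet> a) \<le> norm (u i) * norm a" using Cauchy_Schwarz_ineq2[of "u i" a] by linarith
        also have "\<dots> \<le> 1 * norm a" using u[OF i] by (intro mult_right_mono) auto
        finally have "2 * t * (- (u i \<bullet> a)) \<le> 2 * t * norm a" using tl by (intro mult_left_mono) auto
        then show ?thesis by simp
      qed
      moreover have "(norm (u i))\<^sup>2 \<le> 1" using u[OF i] by (simp add: power_le_one)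
      moreover have "t\<^sup>2 * s \<le> t\<^sup>2" using s1 by (simp add: mult_left_le)
      ultimately show "(\<Sum>j\<in>I. q j * (norm (u i - t *\<^sub>R u j))\<^sup>2) + 2/5 * l\<^sup>2 \<le> (1 + t)\<^sup>2"
        unfolding spread using far by simp
    next
      have "(\<Sum>i\<in>I. q i * (\<Sum>j\<in>I. q j * (norm (u i - t *\<^sub>R u j))\<^sup>2)) = (\<Sum>i\<in>I. q i * (norm (u i))\<^sup>2 - 2 * t * (q i * (a \<bullet> u i)) + q i * (t\<^sup>2 * s))"
        unfolding spread by (intro sum.cong refl) (simp add: inner_commute algebra_simps)
      also have "\<dots> = s - 2 * t * (a \<bullet> a) + t\<^sup>2 * s"
        unfolding sum.distrib sum_subtractf sum_distrib_left[symmetric] sum_distrib_right[symmetric] q(2) inner_a s_def[symmetric] by simp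
      also have "\<dots> \<le> 1 + t\<^sup>2 - 2 * t * (1 - (1 - norm a))\<^sup>2"
        using s1 mult_left_le[OF s1, of "t\<^sup>2"] by (simp add: dot_square_norm)
      finally show "(\<Sum>i\<in>I. q i * (\<Sum>j\<in>I. q j * (norm (u i - t *\<^sub>R u j))\<^sup>2)) \<le> 21/20 * l\<^sup>2" using avg by linarith
    qed
  qed
qed

lemma sorted_variation_bound:
  fixes h :: "real \<Rightarrow> real"
  assumes X: "finite X" "x \<in> X" "y \<in> X"
  defines "xs \<equiv> sorted_list_of_set X"
  shows "h x - h y \<le> (\<Sum>m<length xs - 1. \<bar>h (xs ! Suc m) - h (xs ! m)\<bar>)"
proof -
  have set: "set xs = X" using X by (simp add: xs_def)
  obtain i j where ij: "i < length xs" "j < length xs" "xs ! i = x" "xs ! j = y"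
    using X set by (metis in_set_conv_nth)
  have part: "\<bar>h (xs ! b) - h (xs ! a)\<bar> \<le> (\<Sum>m<length xs - 1. \<bar>h (xs ! Suc m) - h (xs ! m)\<bar>)"
    if "a \<le> b" "b < length xs" for a b
  proof -
    have "h (xs ! b) - h (xs ! a) = (\<Sum>m=a..<b. h (xs ! Suc m) - h (xs ! m))"
      using sum_Suc_diff'[OF that(1), of "\<lambda>m. h (xs ! m)"] by simp
    also have "\<bar>\<dots>\<bar> \<le> (\<Sum>m=a..<b. \<bar>h (xs ! Suc m) - h (xs ! m)\<bar>)" by (rule sum_abs)
    also have "\<dots> \<le> (\<Sum>m<length xs - 1. \<bar>h (xs ! Suc m) - h (xs ! m)\<bar>)"
      using that by (intro sum_mono2) auto
    finally show ?thesis .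
  qed
  show ?thesis
  proof (cases "i \<le> j")
    case True
    from part[OF True ij(2)] show ?thesis unfolding ij by linarith
  next
    case False
    then have "j \<le> i" by simp
    from part[OF this ij(1)] show ?thesis unfolding ij by linarith
  qed
qed

text \<open>On a line the differences \<open>H (u i) - H (u j)\<close> are bounded by the total variation of \<open>H\<close> along the sorted points.  The gaps add up to
at most \<open>2\<close>, so their halves are weights of total at most one, and convexity of the exponential bounds the exponential of the
variation by a mean of exponentials of normalised increments.  The absolute values cost a factor two.\<close>

lemma centred_envelope_line:
  fixes I :: "'i set" and u :: "'i \<Rightarrow> 'a::euclidean_space" and H :: "'a \<Rightarrow> 'w \<Rightarrow> real"
  assumes I: "finite I" "I \<noteq> {}"
    and q: "\<And>i. i \<in> I \<Longrightarrow> 0 < q i" "(\<Sum>i\<in>I. q i) = 1"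
    and u: "\<And>i. i \<in> I \<Longrightarrow> norm (u i) \<le> 1"
    and dim: "DIM('a) = 1"
    and M: "prob_space M" and H [measurable]: "\<And>x. H x \<in> borel_measurable M"
    and A: "0 \<le> A"
    and incr: "\<And>x y d. 0 < d \<Longrightarrow> dist x y \<le> d \<Longrightarrow> (\<integral>\<^sup>+w. ennreal (exp (2 * (H x w - H y w) / d)) \<partial>M) \<le> ennreal (exp A)"
  shows "(\<integral>\<^sup>+w. (SUP i\<in>I. ennreal (exp (H (u i) w - (\<Sum>j\<in>I. q j * H (u j) w) - ln 2))) \<partial>M) \<le> ennreal (exp A)"
proof -
  interpret prob_space M by (rule M)
  obtain b :: 'a where B: "Basis = {b}" using dim card_1_singletonE by blast
  have nb: "norm b = 1" using B by (intro norm_Basis) auto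
  have rep: "x = (x \<bullet> b) *\<^sub>R b" for x using euclidean_representation[of x] unfolding B by simp
  define X where "X = (\<lambda>i. u i \<bullet> b) ` I"
  have X: "finite X" "X \<noteq> {}" using I by (auto simp: X_def)
  have X1: "\<bar>x\<bar> \<le> 1" if "x \<in> X" for x
    using that u Cauchy_Schwarz_ineq2[of _ b] unfolding X_def nb by (auto intro: order_trans)
  define xs where "xs = sorted_list_of_set X"
  have set: "set xs = X" using X by (simp add: xs_def)
  define n where "n = length xs - 1"
  have len: "length xs = Suc n" using X unfolding n_def xs_def by (simp add: card_gt_0_iff)
  define l where "l m = xs ! Suc m - xs ! m" for m
  have lpos: "0 < l m" if "m < n" for m
    using sorted_wrt_nth_less[OF strict_sorted_list_of_set[of X], of m "Suc m"] that len unfolding l_def xs_def by simp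
  define \<omega> where "\<omega> = (\<Sum>m<n. l m / 2)"
  have \<omega>0: "0 \<le> \<omega>" unfolding \<omega>_def using lpos by (intro sum_nonneg) (auto simp: less_imp_le)
  have \<omega>1: "\<omega> \<le> 1"
  proof -
    have "\<omega> = (xs ! n - xs ! 0) / 2"
      unfolding \<omega>_def l_def sum_divide_distrib[symmetric] by (subst sum_lessThan_telescope) simp
    moreover have "xs ! n \<in> X" "xs ! 0 \<in> X" using len set by (metis lessI nth_mem, metis nth_mem zero_less_Suc)
    ultimately show ?thesis using X1[of "xs ! n"] X1[of "xs ! 0"] by simp
  qed
  define D where "D m w = H ((xs ! Suc m) *\<^sub>R b) w - H ((xs ! m) *\<^sub>R b) w" for m w
  define E where "E w = (\<Sum>m<n. ennreal (l m / 2) * (ennreal (exp (2 * D m w / l m)) + ennreal (exp (2 * (- D m w) / l m)))) + ennreal (1 - \<omega>)" for w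
  have path: "ennreal (exp (H (u i) w - (\<Sum>j\<in>I. q j * H (u j) w))) \<le> E w" if i: "i \<in> I" for i w
  proof -
    define T where "T = (\<Sum>m<n. \<bar>D m w\<bar>)"
    have diff: "H (u i) w - H (u j) w \<le> T" if "j \<in> I" for j
      using sorted_variation_bound[OF X(1), of "u i \<bullet> b" "u j \<bullet> b" "\<lambda>x. H (x *\<^sub>R b) w"] i that
      unfolding xs_def[symmetric] n_def[symmetric] T_def D_def rep[symmetric] by (auto simp: X_def)
    have "H (u i) w - (\<Sum>j\<in>I. q j * H (u j) w) = (\<Sum>j\<in>I. q j * (H (u i) w - H (u j) w))"
      unfolding right_diff_distrib sum_subtractf sum_distrib_right[symmetric] q(2) by simp
    also have "\<dots> \<le> (\<Sum>j\<in>I. q j * T)" using q(1) diff by (intro sum_mono mult_left_mono) (auto simp: less_imp_le)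
    also have "\<dots> = T" unfolding sum_distrib_right[symmetric] q(2) by simp
    finally have le: "H (u i) w - (\<Sum>j\<in>I. q j * H (u j) w) \<le> T" .
    have tangent: "exp T * (l m / 2 * (1 - T) + \<bar>D m w\<bar>) \<le> l m / 2 * (exp (2 * D m w / l m) + exp (2 * (- D m w) / l m))" if m: "m < n" for m
    proof -
      have "1 + (2 * \<bar>D m w\<bar> / l m - T) \<le> exp (2 * \<bar>D m w\<bar> / l m - T)" by (rule exp_ge_add_one_self)
      then have "exp T * (1 + (2 * \<bar>D m w\<bar> / l m - T)) \<le> exp T * exp (2 * \<bar>D m w\<bar> / l m - T)" by (intro mult_left_mono) auto
      also have "\<dots> = exp (2 * \<bar>D m w\<bar> / l m)" by (simp add: exp_add[symmetric])
      also have "\<dots> \<le> exp (2 * D m w / l m) + exp (2 * (- D m w) / l m)" by (cases "0 \<le> D m w") auto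
      finally have "l m / 2 * (exp T * (1 + (2 * \<bar>D m w\<bar> / l m - T))) \<le> l m / 2 * (exp (2 * D m w / l m) + exp (2 * (- D m w) / l m))"
        using lpos[OF m] by (intro mult_left_mono) auto
      moreover have "l m / 2 * (exp T * (1 + (2 * \<bar>D m w\<bar> / l m - T))) = exp T * (l m / 2 * (1 - T) + \<bar>D m w\<bar>)"
        using lpos[OF m] by (simp add: field_simps)
      ultimately show ?thesis by linarith
    qed
    have "exp T \<le> exp T * (\<omega> + T - T * \<omega>) + (1 - \<omega>)" by (rule exp_weighted_gap[OF \<omega>1])
    also have "exp T * (\<omega> + T - T * \<omega>) = (\<Sum>m<n. exp T * (l m / 2 * (1 - T) + \<bar>D m w\<bar>))"
      unfolding sum_distrib_left[symmetric] sum.distrib sum_distrib_right[symmetric] \<omega>_def[symmetric] T_def[symmetric] by (simp add: algebra_simps)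
    also have "\<dots> \<le> (\<Sum>m<n. l m / 2 * (exp (2 * D m w / l m) + exp (2 * (- D m w) / l m)))"
      by (intro sum_mono tangent) auto
    finally have "ennreal (exp T) \<le> ennreal ((\<Sum>m<n. l m / 2 * (exp (2 * D m w / l m) + exp (2 * (- D m w) / l m))) + (1 - \<omega>))"
      by (intro ennreal_leI) auto
    also have "\<dots> = E w"
    proof -
      have nn: "0 \<le> l m / 2 * (exp (2 * D m w / l m) + exp (2 * (- D m w) / l m))" if "m < n" for m using lpos[OF that] by simp
      have "ennreal (l m / 2 * (exp (2 * D m w / l m) + exp (2 * (- D m w) / l m))) = ennreal (l m / 2) * (ennreal (exp (2 * D m w / l m)) + ennreal (exp (2 * (- D m w) / l m)))" if "m < n" for m
        using lpos[OF that] by (subst ennreal_mult) (auto simp: ennreal_plus)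
      then have "(\<Sum>m<n. ennreal (l m / 2) * (ennreal (exp (2 * D m w / l m)) + ennreal (exp (2 * (- D m w) / l m)))) = ennreal (\<Sum>m<n. l m / 2 * (exp (2 * D m w / l m) + exp (2 * (- D m w) / l m)))"
        using nn by (subst sum_ennreal[symmetric]) (auto intro!: sum.cong)
      then show ?thesis using \<omega>1 nn unfolding E_def by (subst ennreal_plus) (auto intro!: sum_nonneg)
    qed
    finally have "ennreal (exp T) \<le> E w" .
    moreover have "ennreal (exp (H (u i) w - (\<Sum>j\<in>I. q j * H (u j) w))) \<le> ennreal (exp T)" using le by (intro ennreal_leI) simp
    ultimately show ?thesis by (rule order_trans[rotated])
  qed
  have "(\<integral>\<^sup>+w. (SUP i\<in>I. ennreal (exp (H (u i) w - (\<Sum>j\<in>I. q j * H (u j) w) - ln 2))) \<partial>M) \<le> (\<integral>\<^sup>+w. ennreal (1/2) * E w \<partial>M)"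
  proof (intro nn_integral_mono SUP_least)
    fix w i assume i: "i \<in> I"
    have "ennreal (exp (H (u i) w - (\<Sum>j\<in>I. q j * H (u j) w) - ln 2)) = ennreal (1/2) * ennreal (exp (H (u i) w - (\<Sum>j\<in>I. q j * H (u j) w)))"
      by (subst ennreal_mult[symmetric]) (auto simp: exp_diff)
    then show "ennreal (exp (H (u i) w - (\<Sum>j\<in>I. q j * H (u j) w) - ln 2)) \<le> ennreal (1/2) * E w"
      using path[OF i] by (simp add: mult_left_mono)
  qed
  also have "\<dots> = ennreal (1/2) * (\<integral>\<^sup>+w. E w \<partial>M)"
    unfolding E_def D_def by (intro nn_integral_cmult) measurable
  also have "(\<integral>\<^sup>+w. E w \<partial>M) = (\<Sum>m<n. ennreal (l m / 2) * ((\<integral>\<^sup>+w. ennreal (exp (2 * D m w / l m)) \<partial>M) + (\<integral>\<^sup>+w. ennreal (exp (2 * (- D m w) / l m)) \<partial>M))) + ennreal (1 - \<omega>)"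
  proof -
    have [measurable]: "D m \<in> borel_measurable M" for m unfolding D_def by measurable
    show ?thesis unfolding E_def
      by (subst nn_integral_add, measurable, subst nn_integral_sum, measurable)
         (simp add: nn_integral_cmult nn_integral_add emeasure_space_1)
  qed
  also have "\<dots> \<le> (\<Sum>m<n. ennreal (l m / 2) * (ennreal (exp A) + ennreal (exp A))) + ennreal (1 - \<omega>)"
  proof (intro add_right_mono sum_mono mult_left_mono add_mono)
    fix m assume "m \<in> {..<n}"
    then have m: "0 < l m" using lpos by simp
    have dd: "dist ((xs ! Suc m) *\<^sub>R b) ((xs ! m) *\<^sub>R b) \<le> l m" "dist ((xs ! m) *\<^sub>R b) ((xs ! Suc m) *\<^sub>R b) \<le> l m"
      using m by (simp_all add: dist_norm scaleR_diff_left[symmetric] nb l_def)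
    show "(\<integral>\<^sup>+w. ennreal (exp (2 * D m w / l m)) \<partial>M) \<le> ennreal (exp A)" unfolding D_def by (rule incr[OF m dd(1)])
    show "(\<integral>\<^sup>+w. ennreal (exp (2 * (- D m w) / l m)) \<partial>M) \<le> ennreal (exp A)" using incr[OF m dd(2)] unfolding D_def by simp
  qed auto
  also have "\<dots> = ennreal (\<omega> * (2 * exp A) + (1 - \<omega>))"
  proof -
    have "(\<Sum>m<n. ennreal (l m / 2) * (ennreal (exp A) + ennreal (exp A))) = (\<Sum>m<n. ennreal (l m / 2 * (2 * exp A)))"
      using lpos by (intro sum.cong refl) (subst ennreal_mult, auto simp: less_imp_le simp flip: ennreal_plus)
    also have "\<dots> = ennreal (\<omega> * (2 * exp A))"
      unfolding \<omega>_def sum_distrib_right using lpos by (intro sum_ennreal) (auto simp: less_imp_le)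
    finally show ?thesis using \<omega>0 \<omega>1 by (simp add: ennreal_plus)
  qed
  also have "\<dots> \<le> ennreal (2 * exp A)"
  proof (rule ennreal_leI)
    have "(1 - \<omega>) * 1 \<le> (1 - \<omega>) * (2 * exp A)" using \<omega>1 A one_le_exp_iff[of A] by (intro mult_left_mono) (linarith, simp)
    then show "\<omega> * (2 * exp A) + (1 - \<omega>) \<le> 2 * exp A" by (simp add: algebra_simps)
  qed
  also have "ennreal (1/2) * ennreal (2 * exp A) = ennreal (exp A)" by (subst ennreal_mult[symmetric]) auto
  finally show ?thesis by (simp add: mult_left_mono)
qed

text \<open>The mean penalty \<open>2 p ln 2\<close> is the entropy of the unit ball as far as it is visible from volumes alone.\<close>

lemma centred_envelope:
  fixes I :: "'i set" and u :: "'i \<Rightarrow> 'a::euclidean_space" and H :: "'a \<Rightarrow> 'w \<Rightarrow> real"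
  assumes I: "finite I" "I \<noteq> {}"
    and q: "\<And>i. i \<in> I \<Longrightarrow> 0 < q i" "(\<Sum>i\<in>I. q i) = 1"
    and u: "\<And>i. i \<in> I \<Longrightarrow> norm (u i) \<le> 1"
    and M: "prob_space M"
    and cont: "\<And>w. w \<in> space M \<Longrightarrow> continuous_on UNIV (\<lambda>x. H x w)" and H: "\<And>x. H x \<in> borel_measurable M"
    and A: "0 \<le> A"
    and incr: "\<And>x y d. 0 < d \<Longrightarrow> dist x y \<le> d \<Longrightarrow> (\<integral>\<^sup>+w. ennreal (exp (2 * (H x w - H y w) / d)) \<partial>M) \<le> ennreal (exp A)"
  shows "\<exists>C. (\<Sum>i\<in>I. q i * C i) \<le> 2 * real DIM('a) * ln 2 \<and>
    (\<integral>\<^sup>+w. (SUP i\<in>I. ennreal (exp (H (u i) w - (\<Sum>j\<in>I. q j * H (u j) w) - C i))) \<partial>M) \<le> ennreal (exp A)"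
proof (cases "DIM('a) = 1")
  case True
  show ?thesis
    using centred_envelope_line[OF I q u True M H A incr] q(2) True
    by (intro exI[of _ "\<lambda>_. ln 2"]) (simp add: sum_distrib_right[symmetric])
next
  case False
  then have dim: "2 \<le> DIM('a)" using DIM_positive[where 'a='a] by linarith
  show ?thesis by (rule centred_envelope_multidim[OF I q u dim M cont H A incr])
qed

section \<open>The maximal inequality on a ball\<close>

text \<open>Ties are split evenly, which keeps the shares measurable without ordering the index set.\<close>

lemma maximal_share:
  fixes Z :: "'i \<Rightarrow> 'w \<Rightarrow> real"
  assumes I: "finite I" "I \<noteq> {}" and [measurable]: "\<And>i. Z i \<in> borel_measurable M"
  shows "\<exists>e :: 'i \<Rightarrow> 'w \<Rightarrow> real. (\<forall>i\<in>I. e i \<in> borel_measurable M) \<and> (\<forall>i\<in>I. \<forall>w. 0 \<le> e i w) \<and> (\<forall>w. (\<Sum>i\<in>I. e i w) = 1)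
    \<and> (\<forall>i\<in>I. \<forall>j\<in>I. \<forall>w. 0 < e i w \<longrightarrow> Z j w \<le> Z i w)"
proof -
  define top where "top i w = (if \<forall>j\<in>I. Z j w \<le> Z i w then 1 else 0 :: real)" for i w
  have [measurable]: "top i \<in> borel_measurable M" for i
  proof -
    have "(\<lambda>w. if (\<forall>j\<in>I. Z j w \<le> Z i w) then 1 else 0 :: real) \<in> borel_measurable M"
      using I(1) by measurable
    then show ?thesis by (simp add: top_def[abs_def])
  qed
  have pos: "0 < (\<Sum>i\<in>I. top i w)" for w
  proof -
    have "Max ((\<lambda>i. Z i w) ` I) \<in> (\<lambda>i. Z i w) ` I" using I by (intro Max_in) auto
    then obtain i where i: "i \<in> I" "Z i w = Max ((\<lambda>i. Z i w) ` I)" by auto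
    have "\<forall>j\<in>I. Z j w \<le> Z i w" using I unfolding i(2) by auto
    then have "0 < top i w" by (simp add: top_def)
    then show ?thesis using I i by (intro sum_pos2[of I i]) (auto simp: top_def)
  qed
  have "(\<lambda>w. top i w / (\<Sum>i\<in>I. top i w)) \<in> borel_measurable M" for i by measurable
  moreover have "(\<Sum>i\<in>I. top i w / (\<Sum>i\<in>I. top i w)) = 1" for w
    using pos[of w] by (simp add: sum_divide_distrib[symmetric])
  moreover have "0 \<le> top i w / (\<Sum>i\<in>I. top i w)" for i w using pos[of w] by (simp add: top_def)
  moreover have "Z j w \<le> Z i w" if "i \<in> I" "j \<in> I" "0 < top i w / (\<Sum>i\<in>I. top i w)" for i j w
    using that by (auto simp: top_def split: if_splits)
  ultimately show ?thesis by (intro exI[of _ "\<lambda>i w. top i w / (\<Sum>i\<in>I. top i w)"]) blast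
qed

lemma young_exp:
  fixes \<rho> :: real
  assumes "0 \<le> \<rho>" "\<rho> \<le> 1"
  shows "exp ((1 - \<rho>) * x + \<rho> * y) \<le> (1 - \<rho>) * exp x + \<rho> * exp y"
  using convex_onD[OF exp_convex, of \<rho> x y] assms by simp

lemma exp_mean_le:
  assumes "finite J" "\<And>j. j \<in> J \<Longrightarrow> 0 \<le> q j" "(\<Sum>j\<in>J. q j) = (1::real)"
  shows "exp (\<Sum>j\<in>J. q j * z j) \<le> (\<Sum>j\<in>J. q j * exp (z j))"
proof -
  have "J \<noteq> {}" using assms(3) by auto
  then show ?thesis using convex_on_sum[OF assms(1) _ exp_convex assms(3), of z] assms(2) by simp
qed

text \<open>The increments of \<open>H\<close> are controlled, but the constants \<open>c i\<close> are arbitrary up to the normalisation of \<open>exp (Z i)\<close>.  Let \<open>q\<close> be the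
law of the maximiser under the density proportional to the maximum of \<open>exp (\<rho> Z i)\<close>.  With the penalties \<open>C\<close> of
\<open>centred_envelope\<close>, the variable \<open>\<rho> Z i\<close> equals \<open>(1 - \<rho>)\<close> times the penalised centred increment, plus \<open>\<rho>\<close> times the \<open>q\<close>-mean of
\<open>Z\<close>, plus a constant \<open>b i\<close> with \<open>q\<close>-mean \<open>(1 - \<rho>) \<Sum> q i C i\<close>: the constants \<open>c i\<close> drop out of this mean.  The first two parts
are bounded by Young's inequality, and Jensen's inequality replaces \<open>b i\<close> by its mean.\<close>

lemma local_maximal_inequality:
  fixes I :: "'i set" and u :: "'i \<Rightarrow> 'a::euclidean_space" and H :: "'a \<Rightarrow> 'w \<Rightarrow> real" and c :: "'i \<Rightarrow> real"
  assumes I: "finite I" and \<rho>: "0 < \<rho>" "\<rho> < 1"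
    and u: "\<And>i. i \<in> I \<Longrightarrow> norm (u i) \<le> 1"
    and M: "prob_space M"
    and cont: "\<And>w. w \<in> space M \<Longrightarrow> continuous_on UNIV (\<lambda>x. H x w)" and H [measurable]: "\<And>x. H x \<in> borel_measurable M"
    and A: "0 \<le> A"
    and incr: "\<And>x y d. 0 < d \<Longrightarrow> dist x y \<le> d \<Longrightarrow> (\<integral>\<^sup>+w. ennreal (exp (2 * (H x w - H y w) / d)) \<partial>M) \<le> ennreal (exp A)"
  defines "Z \<equiv> \<lambda>i w. (1 - \<rho>) / \<rho> * H (u i) w + c i"
  assumes Z1: "\<And>i. i \<in> I \<Longrightarrow> (\<integral>\<^sup>+w. ennreal (exp (Z i w)) \<partial>M) \<le> 1"
  shows "(\<integral>\<^sup>+w. (SUP i\<in>I. ennreal (exp (\<rho> * Z i w))) \<partial>M) \<le> ennreal (exp ((1 - \<rho>) * (2 * real DIM('a) * ln 2 + A)))"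
proof (cases "I = {}")
  case True
  then show ?thesis by (simp add: bot_ennreal)
next
  case False
  interpret prob_space M by (rule M)
  have measZ [measurable]: "Z i \<in> borel_measurable M" for i unfolding Z_def by measurable
  obtain e :: "'i \<Rightarrow> 'w \<Rightarrow> real" where e': "\<forall>i\<in>I. e i \<in> borel_measurable M" "\<forall>i\<in>I. \<forall>w. 0 \<le> e i w" "\<forall>w. (\<Sum>i\<in>I. e i w) = 1"
      "\<forall>i\<in>I. \<forall>j\<in>I. \<forall>w. 0 < e i w \<longrightarrow> Z j w \<le> Z i w"
    using maximal_share[where Z=Z and M=M, OF I False measZ] by (elim exE conjE)
  have e [measurable]: "e i \<in> borel_measurable M" if "i \<in> I" for i using e'(1) that by blast
  have e0: "0 \<le> e i w" if "i \<in> I" for i w using e'(2) that by blast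
  have e1: "(\<Sum>i\<in>I. e i w) = 1" for w using e'(3) by blast
  have top: "Z j w \<le> Z i w" if "i \<in> I" "j \<in> I" "0 < e i w" for i j w using e'(4) that by blast
  have ele: "e i w \<le> 1" if "i \<in> I" for i w using member_le_sum[of i I "\<lambda>i. e i w"] that e0 e1 I by simp
  have intZ: "integrable M (\<lambda>w. exp (Z i w))" if "i \<in> I" for i
    using Z1[OF that] by (intro integrableI_nonneg) (auto intro: le_less_trans)
  have rhoZ: "exp (\<rho> * Z i w) \<le> 1 + exp (Z i w)" for i w
    using \<rho> young_exp[of \<rho> 0 "Z i w"] by (simp, smt (verit) exp_gt_zero mult_left_le_one_le)
  have intS: "integrable M (\<lambda>w. e i w * exp (\<rho> * Z i w))" if i: "i \<in> I" for i
  proof (rule Bochner_Integration.integrable_bound)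
    show "integrable M (\<lambda>w. 1 + exp (Z i w))" using intZ[OF i] by simp
    show "AE w in M. norm (e i w * exp (\<rho> * Z i w)) \<le> norm (1 + exp (Z i w))"
    proof (rule AE_I2)
      fix w
      have "e i w * exp (\<rho> * Z i w) \<le> 1 * exp (\<rho> * Z i w)" using ele[OF i] by (intro mult_right_mono) auto
      then have "e i w * exp (\<rho> * Z i w) \<le> 1 + exp (Z i w)" using rhoZ[of i w] by linarith
      then show "norm (e i w * exp (\<rho> * Z i w)) \<le> norm (1 + exp (Z i w))" using e0[OF i] by (simp add: abs_mult)
    qed
  qed (use i in measurable)
  define a where "a i = (\<integral>w. e i w * exp (\<rho> * Z i w) \<partial>M)" for i
  have a0: "0 \<le> a i" if "i \<in> I" for i unfolding a_def using e0[OF that] by (intro Bochner_Integration.integral_nonneg) auto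
  define s where "s = (\<Sum>i\<in>I. a i)"
  have lhs: "(\<integral>\<^sup>+w. (SUP i\<in>I. ennreal (exp (\<rho> * Z i w))) \<partial>M) \<le> ennreal s"
  proof -
    have "(\<integral>\<^sup>+w. (SUP i\<in>I. ennreal (exp (\<rho> * Z i w))) \<partial>M) \<le> (\<integral>\<^sup>+w. (\<Sum>i\<in>I. ennreal (e i w * exp (\<rho> * Z i w))) \<partial>M)"
    proof (intro nn_integral_mono SUP_least)
      fix w j assume j: "j \<in> I"
      have "exp (\<rho> * Z j w) = (\<Sum>i\<in>I. e i w * exp (\<rho> * Z j w))" by (simp add: sum_distrib_right[symmetric] e1)
      also have "\<dots> \<le> (\<Sum>i\<in>I. e i w * exp (\<rho> * Z i w))"
      proof (rule sum_mono)
        fix i assume i: "i \<in> I"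
        show "e i w * exp (\<rho> * Z j w) \<le> e i w * exp (\<rho> * Z i w)"
          using e0[OF i, of w] top[OF i j, of w] \<rho> by (cases "e i w = 0") auto
      qed
      finally have "ennreal (exp (\<rho> * Z j w)) \<le> ennreal (\<Sum>i\<in>I. e i w * exp (\<rho> * Z i w))" by (rule ennreal_leI)
      also have "\<dots> = (\<Sum>i\<in>I. ennreal (e i w * exp (\<rho> * Z i w)))" using e0 by (intro sum_ennreal[symmetric]) auto
      finally show "ennreal (exp (\<rho> * Z j w)) \<le> (\<Sum>i\<in>I. ennreal (e i w * exp (\<rho> * Z i w)))" .
    qed
    also have "\<dots> = (\<Sum>i\<in>I. \<integral>\<^sup>+w. ennreal (e i w * exp (\<rho> * Z i w)) \<partial>M)" by (intro nn_integral_sum) measurable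
    also have "\<dots> = (\<Sum>i\<in>I. ennreal (a i))"
      unfolding a_def using intS e0 by (intro sum.cong refl nn_integral_eq_integral) auto
    also have "\<dots> = ennreal s" unfolding s_def using a0 by (intro sum_ennreal) auto
    finally show ?thesis .
  qed
  show ?thesis
  proof (cases "0 < s")
    case False
    then have "ennreal s = 0" by (simp add: ennreal_neg)
    with lhs show ?thesis by simp
  next
    case s: True
    \<comment> \<open>Indices that are almost never maximal are dropped, since \<open>centred_envelope\<close> wants positive weights.\<close>
    define J where "J = {i \<in> I. 0 < a i}"
    define q where "q i = a i / s" for i
    have J: "finite J" "J \<subseteq> I" using I by (auto simp: J_def)
    have q: "0 < q i" if "i \<in> J" for i using that s by (simp add: q_def J_def)
    have sumJ: "(\<Sum>i\<in>J. a i) = s" unfolding s_def using I a0 by (intro sum.mono_neutral_left) (force simp: J_def)+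
    have q1: "(\<Sum>i\<in>J. q i) = 1" unfolding q_def sum_divide_distrib[symmetric] sumJ using s by simp
    have J0: "J \<noteq> {}" using q1 by auto
    have uJ: "norm (u i) \<le> 1" if "i \<in> J" for i using u that J by auto
    obtain C where C: "(\<Sum>i\<in>J. q i * C i) \<le> 2 * real DIM('a) * ln 2"
      and env: "(\<integral>\<^sup>+w. (SUP i\<in>J. ennreal (exp (H (u i) w - (\<Sum>j\<in>J. q j * H (u j) w) - C i))) \<partial>M) \<le> ennreal (exp A)"
    proof -
      have "\<exists>C. (\<Sum>i\<in>J. q i * C i) \<le> 2 * real DIM('a) * ln 2 \<and>
        (\<integral>\<^sup>+w. (SUP i\<in>J. ennreal (exp (H (u i) w - (\<Sum>j\<in>J. q j * H (u j) w) - C i))) \<partial>M) \<le> ennreal (exp A)"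
        by (rule centred_envelope[OF J(1) J0 q q1 uJ M cont H A incr])
      then show ?thesis using that by blast
    qed
    define b where "b i = (1 - \<rho>) * C i + \<rho> * c i - \<rho> * (\<Sum>j\<in>J. q j * c j)" for i
    have sumb: "(\<Sum>i\<in>J. q i * b i) = (1 - \<rho>) * (\<Sum>i\<in>J. q i * C i)"
    proof -
      have "(\<Sum>i\<in>J. q i * b i) = (\<Sum>i\<in>J. (1 - \<rho>) * (q i * C i) + \<rho> * (q i * c i) - q i * (\<rho> * (\<Sum>j\<in>J. q j * c j)))"
        by (intro sum.cong refl) (simp add: b_def algebra_simps)
      then show ?thesis unfolding sum.distrib sum_subtractf sum_distrib_left[symmetric] sum_distrib_right[symmetric] q1 by simp
    qed
    define X where "X w = (SUP i\<in>J. ennreal (exp (H (u i) w - (\<Sum>j\<in>J. q j * H (u j) w) - C i)))" for w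
    have [measurable]: "X \<in> borel_measurable M" unfolding X_def by (intro borel_measurable_SUP countable_finite J) measurable
    define Y where "Y w = ennreal (exp ((1 - \<rho>) * A)) * (ennreal ((1 - \<rho>) * exp (- A)) * X w + ennreal \<rho> * (\<Sum>j\<in>J. ennreal (q j) * ennreal (exp (Z j w))))" for w
    have point: "ennreal (exp (\<rho> * Z i w - b i)) \<le> Y w" if i: "i \<in> J" for i w
    proof -
      define g where "g = H (u i) w - (\<Sum>j\<in>J. q j * H (u j) w) - C i"
      have "(\<Sum>j\<in>J. q j * Z j w) = (1 - \<rho>) / \<rho> * (\<Sum>j\<in>J. q j * H (u j) w) + (\<Sum>j\<in>J. q j * c j)"
        unfolding Z_def sum_distrib_left sum.distrib[symmetric] by (intro sum.cong refl) (simp add: algebra_simps)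
      then have "\<rho> * (\<Sum>j\<in>J. q j * Z j w) = (1 - \<rho>) * (\<Sum>j\<in>J. q j * H (u j) w) + \<rho> * (\<Sum>j\<in>J. q j * c j)"
        using \<rho> by (simp add: distrib_left)
      moreover have "\<rho> * Z i w = (1 - \<rho>) * H (u i) w + \<rho> * c i" using \<rho> by (simp add: Z_def distrib_left)
      ultimately have eq: "\<rho> * Z i w - b i = (1 - \<rho>) * A + ((1 - \<rho>) * (g - A) + \<rho> * (\<Sum>j\<in>J. q j * Z j w))"
        by (simp add: g_def b_def algebra_simps)
      have "exp (\<rho> * Z i w - b i) = exp ((1 - \<rho>) * A) * exp ((1 - \<rho>) * (g - A) + \<rho> * (\<Sum>j\<in>J. q j * Z j w))"
        unfolding eq by (rule exp_add)
      also have "\<dots> \<le> exp ((1 - \<rho>) * A) * ((1 - \<rho>) * exp (g - A) + \<rho> * (\<Sum>j\<in>J. q j * exp (Z j w)))"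
        using \<rho> q less_imp_le
        by (intro mult_left_mono order_trans[OF young_exp] add_left_mono exp_mean_le J q1) auto
      also have "\<dots> = exp ((1 - \<rho>) * A) * (((1 - \<rho>) * exp (- A)) * exp g + \<rho> * (\<Sum>j\<in>J. q j * exp (Z j w)))"
        by (simp add: exp_diff exp_minus field_simps)
      finally have "ennreal (exp (\<rho> * Z i w - b i)) \<le> ennreal (exp ((1 - \<rho>) * A) * (((1 - \<rho>) * exp (- A)) * exp g + \<rho> * (\<Sum>j\<in>J. q j * exp (Z j w))))"
        by (rule ennreal_leI)
      also have "\<dots> = ennreal (exp ((1 - \<rho>) * A)) * (ennreal ((1 - \<rho>) * exp (- A)) * ennreal (exp g) + ennreal \<rho> * (\<Sum>j\<in>J. ennreal (q j) * ennreal (exp (Z j w))))"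
      proof -
        have "(\<Sum>j\<in>J. ennreal (q j) * ennreal (exp (Z j w))) = (\<Sum>j\<in>J. ennreal (q j * exp (Z j w)))"
          using q by (intro sum.cong refl) (auto simp: ennreal_mult less_imp_le)
        also have "\<dots> = ennreal (\<Sum>j\<in>J. q j * exp (Z j w))" using q by (intro sum_ennreal) (auto simp: less_imp_le)
        finally have s: "(\<Sum>j\<in>J. ennreal (q j) * ennreal (exp (Z j w))) = ennreal (\<Sum>j\<in>J. q j * exp (Z j w))" .
        have p: "0 \<le> (\<Sum>j\<in>J. q j * exp (Z j w))" "0 \<le> (1 - \<rho>) * exp (- A)" "0 \<le> \<rho>" using q \<rho> by (auto intro!: sum_nonneg simp: less_imp_le)
        show ?thesis unfolding s using p by (simp add: ennreal_mult ennreal_plus del: sum_ennreal)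
      qed
      also have "\<dots> \<le> Y w"
        unfolding Y_def X_def g_def using i by (intro mult_left_mono add_right_mono SUP_upper) auto
      finally show ?thesis .
    qed
    have EY: "(\<integral>\<^sup>+w. Y w \<partial>M) \<le> ennreal (exp ((1 - \<rho>) * A))"
    proof -
      have "(\<integral>\<^sup>+w. Y w \<partial>M) = ennreal (exp ((1 - \<rho>) * A)) * (ennreal ((1 - \<rho>) * exp (- A)) * (\<integral>\<^sup>+w. X w \<partial>M) + ennreal \<rho> * (\<Sum>j\<in>J. ennreal (q j) * (\<integral>\<^sup>+w. ennreal (exp (Z j w)) \<partial>M)))"
        unfolding Y_def by (simp add: nn_integral_cmult nn_integral_add nn_integral_sum)
      also have "\<dots> \<le> ennreal (exp ((1 - \<rho>) * A)) * (ennreal ((1 - \<rho>) * exp (- A)) * ennreal (exp A) + ennreal \<rho> * (\<Sum>j\<in>J. ennreal (q j) * 1))"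
        using env Z1 J unfolding X_def by (intro mult_left_mono add_mono sum_mono) auto
      also have "ennreal ((1 - \<rho>) * exp (- A)) * ennreal (exp A) = ennreal (1 - \<rho>)"
        using \<rho> by (subst ennreal_mult[symmetric]) (auto simp: exp_minus)
      also have "(\<Sum>j\<in>J. ennreal (q j) * 1) = 1" using q q1 by (simp add: sum_ennreal less_imp_le)
      also have "ennreal (1 - \<rho>) + ennreal \<rho> * 1 = 1" using \<rho> by (simp flip: ennreal_plus)
      finally show ?thesis by simp
    qed
    have "ennreal (\<Sum>i\<in>J. exp (- b i) * a i) \<le> (\<integral>\<^sup>+w. Y w \<partial>M)"
    proof -
      have "ennreal (\<Sum>i\<in>J. exp (- b i) * a i) = (\<Sum>i\<in>J. ennreal (exp (- b i)) * ennreal (a i))"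
        using a0 J by (subst sum_ennreal[symmetric]) (auto simp: ennreal_mult intro!: sum.cong)
      also have "\<dots> = (\<Sum>i\<in>J. ennreal (exp (- b i)) * (\<integral>\<^sup>+w. ennreal (e i w * exp (\<rho> * Z i w)) \<partial>M))"
        unfolding a_def using intS e0 J by (intro sum.cong refl arg_cong2[where f="(*)"] nn_integral_eq_integral[symmetric]) auto
      also have "\<dots> = (\<integral>\<^sup>+w. (\<Sum>i\<in>J. ennreal (exp (- b i)) * ennreal (e i w * exp (\<rho> * Z i w))) \<partial>M)"
        using J(2) e by (subst nn_integral_sum) (auto intro!: sum.cong nn_integral_cmult[symmetric] borel_measurable_times measurable_compose[OF _ measurable_ennreal])
      also have "\<dots> \<le> (\<integral>\<^sup>+w. Y w \<partial>M)"
      proof (rule nn_integral_mono)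
        fix w
        have "(\<Sum>i\<in>J. ennreal (exp (- b i)) * ennreal (e i w * exp (\<rho> * Z i w))) = (\<Sum>i\<in>J. ennreal (e i w) * ennreal (exp (\<rho> * Z i w - b i)))"
          using e0 J by (intro sum.cong refl) (auto simp: ennreal_mult[symmetric] exp_diff exp_minus field_simps)
        also have "\<dots> \<le> (\<Sum>i\<in>J. ennreal (e i w) * Y w)" by (intro sum_mono mult_left_mono point) auto
        also have "\<dots> = ennreal (\<Sum>i\<in>J. e i w) * Y w" using e0 J by (subst sum_ennreal[symmetric]) (auto simp: sum_distrib_right)
        also have "\<dots> \<le> 1 * Y w"
        proof (rule mult_right_mono)
          have "(\<Sum>i\<in>J. e i w) \<le> (\<Sum>i\<in>I. e i w)" using I J e0 by (intro sum_mono2) auto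
          then show "ennreal (\<Sum>i\<in>J. e i w) \<le> 1" unfolding e1 by (simp add: ennreal_le_1)
        qed simp
        finally show "(\<Sum>i\<in>J. ennreal (exp (- b i)) * ennreal (e i w * exp (\<rho> * Z i w))) \<le> Y w" by simp
      qed
      finally show ?thesis .
    qed
    then have "ennreal (\<Sum>i\<in>J. exp (- b i) * a i) \<le> ennreal (exp ((1 - \<rho>) * A))" using EY by (rule order_trans)
    then have up: "(\<Sum>i\<in>J. exp (- b i) * a i) \<le> exp ((1 - \<rho>) * A)" by (simp add: ennreal_le_iff)
    \<comment> \<open>Jensen's inequality for the law \<open>q\<close>.\<close>
    have "s * exp (- (\<Sum>i\<in>J. q i * b i)) \<le> (\<Sum>i\<in>J. exp (- b i) * a i)"
    proof -
      have "exp (\<Sum>i\<in>J. q i * (- b i)) \<le> (\<Sum>i\<in>J. q i * exp (- b i))"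
        using q by (intro exp_mean_le J q1) (auto simp: less_imp_le)
      then have "s * exp (- (\<Sum>i\<in>J. q i * b i)) \<le> s * (\<Sum>i\<in>J. q i * exp (- b i))" using s by (intro mult_left_mono) (auto simp: sum_negf)
      also have "\<dots> = (\<Sum>i\<in>J. exp (- b i) * a i)" unfolding sum_distrib_left using s by (intro sum.cong refl) (simp add: q_def)
      finally show ?thesis .
    qed
    with up have "s * exp (- (\<Sum>i\<in>J. q i * b i)) \<le> exp ((1 - \<rho>) * A)" by linarith
    then have "s \<le> exp ((1 - \<rho>) * A) * exp (\<Sum>i\<in>J. q i * b i)" by (simp add: exp_minus field_simps)
    also have "\<dots> = exp ((1 - \<rho>) * A + (\<Sum>i\<in>J. q i * b i))" by (simp add: exp_add)
    also have "\<dots> \<le> exp ((1 - \<rho>) * (2 * real DIM('a) * ln 2 + A))"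
    proof -
      have "(\<Sum>i\<in>J. q i * b i) \<le> (1 - \<rho>) * (2 * real DIM('a) * ln 2)" unfolding sumb using \<rho> C by (intro mult_left_mono) auto
      then show ?thesis by (simp add: algebra_simps)
    qed
    finally show ?thesis by (intro order_trans[OF lhs] ennreal_leI)
  qed
qed

section \<open>Volumes of ellipsoids\<close>

text \<open>Induction over elementary matrices, for an arbitrary finite index type.  A transposition is an involution, so its determinant
has absolute value one; a shear is a row operation on the identity.\<close>

lemma measure_linear_image_finite:
  fixes f :: "real^'n \<Rightarrow> real^'n"
  assumes "linear f" "S \<in> lmeasurable"
  shows "f ` S \<in> lmeasurable \<and> measure lebesgue (f ` S) = \<bar>det (matrix f)\<bar> * measure lebesgue S"
proof -
  define P where "P f \<longleftrightarrow> (\<forall>S \<in> lmeasurable. f ` S \<in> lmeasurable \<and> measure lebesgue (f ` S) = \<bar>det (matrix f)\<bar> * measure lebesgue S)"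
    for f :: "real^'n \<Rightarrow> real^'n"
  have unit: "P f" if lin: "linear f" and box: "\<And>a b. measure lebesgue (f ` cbox a b) = measure lebesgue (cbox a b)" and d: "\<bar>det (matrix f)\<bar> = 1" for f
    unfolding P_def
  proof
    fix S :: "(real^'n) set" assume "S \<in> lmeasurable"
    then have "f ` S \<in> lmeasurable \<and> 1 * measure lebesgue S = measure lebesgue (f ` S)"
      by (rule measure_linear_sufficient[OF lin]) (simp only: box mult_1)
    then show "f ` S \<in> lmeasurable \<and> measure lebesgue (f ` S) = \<bar>det (matrix f)\<bar> * measure lebesgue S" unfolding d by simp
  qed
  have "P f"
    using assms(1)
  proof (rule induct_linear_elementary)
    fix f g :: "real^'n \<Rightarrow> real^'n"
    assume f: "linear f" "P f" and g: "linear g" "P g"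
    show "P (f \<circ> g)"
      using f(2) g(2) unfolding P_def image_comp[symmetric] matrix_compose[OF g(1) f(1)] det_mul abs_mult by simp
  next
    fix f :: "real^'n \<Rightarrow> real^'n" and i
    assume f: "linear f" and 0: "\<And>x. f x $ i = 0"
    have "\<not> surj f"
    proof
      assume "surj f"
      then obtain x where "f x = axis i 1" by (metis surjD)
      then show False using 0[of x] by simp
    qed
    then have inj: "\<not> inj f" using f linear_injective_imp_surjective by blast
    then have "det (matrix f) = 0" using det_nz_iff_inj[OF f] by blast
    moreover have "negligible (f ` S)" for S using inj f by (rule negligible_linear_singular_image[rotated])
    ultimately show "P f" by (auto simp: P_def negligible_imp_measurable negligible_imp_measure0)
  next
    fix c :: "'n \<Rightarrow> real"
    show "P (\<lambda>x. \<chi> i. c i * x $ i)"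
      by (auto simp: P_def measurable_stretch measure_stretch axis_def matrix_def det_diagonal)
  next
    fix m n :: 'n
    let ?h = "\<lambda>x :: real^'n. \<chi> i. x $ Transposition.transpose m n i"
    have lin: "linear ?h" by (rule linearI) (simp_all add: plus_vec_def scaleR_vec_def)
    have inv: "?h (?h x) = x" for x by (simp add: vec_eq_iff)
    have "matrix ?h ** matrix ?h = mat 1"
      by (subst matrix_compose[OF lin lin, symmetric]) (simp add: o_def inv matrix_id_mat_1[unfolded id_def])
    then have "det (matrix ?h ** matrix ?h) = 1" by simp
    then have "(det (matrix ?h))\<^sup>2 = 1" by (simp add: det_mul power2_eq_square)
    then have d: "\<bar>det (matrix ?h)\<bar> = 1" by (simp add: abs_square_eq_1)
    show "P ?h"
    proof (rule unit[OF lin _ d])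
      fix a b
      have "?h ` cbox a b = cbox (?h a) (?h b)"
      proof
        show "?h ` cbox a b \<subseteq> cbox (?h a) (?h b)" by (auto simp: mem_box_cart)
        show "cbox (?h a) (?h b) \<subseteq> ?h ` cbox a b"
        proof
          fix x assume "x \<in> cbox (?h a) (?h b)"
          then have x: "(a $ Transposition.transpose m n i) \<le> x $ i \<and> x $ i \<le> b $ Transposition.transpose m n i" for i by (simp add: mem_box_cart)
          have "?h x \<in> cbox a b" using x[of "Transposition.transpose m n _"] by (simp add: mem_box_cart)
          then show "x \<in> ?h ` cbox a b" using inv[of x] by (metis image_eqI)
        qed
      qed
      moreover have "(\<Prod>i\<in>UNIV. ?h b $ i - ?h a $ i) = (\<Prod>i\<in>UNIV. b $ i - a $ i)"
        using prod.permute[OF permutes_swap_id[of m UNIV n], of "\<lambda>i. b $ i - a $ i"] by (simp add: o_def)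
      moreover have "cbox a b = {} \<longleftrightarrow> cbox (?h a) (?h b) = {}" using calculation(1) by (metis image_is_empty)
      ultimately show "measure lebesgue (?h ` cbox a b) = measure lebesgue (cbox a b)"
        by (simp add: content_cbox_if_cart)
    qed
  next
    fix m n :: 'n assume mn: "m \<noteq> n"
    let ?h = "\<lambda>x :: real^'n. \<chi> i. if i = m then x $ m + x $ n else x $ i"
    have lin: "linear ?h" by (rule linearI) (auto simp: algebra_simps vec_eq_iff)
    have "matrix ?h = (\<chi> k. if k = m then row m (mat 1) + 1 *s row n (mat 1) else row k (mat 1))"
      by (auto simp: matrix_def vec_eq_iff row_def mat_def axis_def)
    then have "det (matrix ?h) = det (mat 1 :: real^'n^'n)" by (simp only: det_row_operation[OF mn])
    then have d: "\<bar>det (matrix ?h)\<bar> = 1" by simp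
    show "P ?h"
    proof (rule unit[OF lin _ d])
      fix a b :: "real^'n"
      let ?w = "axis n (a $ n)"
      show "measure lebesgue (?h ` cbox a b) = measure lebesgue (cbox a b)"
      proof (cases "cbox a b = {}")
        case False
        have e: "cbox a b = (+) ?w ` cbox (a - ?w) (b - ?w)" by (simp add: cbox_translation[symmetric])
        then have ne: "cbox (a - ?w) (b - ?w) \<noteq> {}" using False by auto
        have "?h ` cbox a b = (\<lambda>x. ?h (?w + x)) ` cbox (a - ?w) (b - ?w)" by (subst e) (simp add: image_image)
        also have "\<dots> = (\<lambda>x. ?h ?w + ?h x) ` cbox (a - ?w) (b - ?w)"
          by (intro image_cong refl) (rule linear_add[OF lin])
        also have "\<dots> = (+) (?h ?w) ` ?h ` cbox (a - ?w) (b - ?w)" by (simp add: image_image)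
        finally have "measure lebesgue (?h ` cbox a b) = measure lebesgue (?h ` cbox (a - ?w) (b - ?w))" by (simp only: measure_translation)
        also have "\<dots> = measure lebesgue (cbox (a - ?w) (b - ?w))"
          using mn ne by (intro measure_shear_interval) auto
        also have "\<dots> = measure lebesgue (cbox a b)" using arg_cong[OF e, of "measure lebesgue"] by (simp only: measure_translation)
        finally show ?thesis .
      qed simp
    qed
  qed
  then show ?thesis using assms(2) by (simp add: P_def)
qed

lemma inner_transpose: "x \<bullet> (transpose A *v y) = (A *v x) \<bullet> (y :: real^'n)"
  by (simp add: dot_lmul_matrix inner_commute[of x] inner_commute[of y])

text \<open>A set that is orthonormal for the form \<open>V\<close> and of maximal size spans the space, because any vector outside its span could be
orthogonalised and added.  The inverse of the matrix of its elements is the factor \<open>A\<close>.\<close>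

lemma posdef_factorization:
  fixes V :: "real^'n^'n"
  assumes sym: "\<And>x y. x \<bullet> (V *v y) = y \<bullet> (V *v x)" and pos: "\<And>x. x \<noteq> 0 \<Longrightarrow> 0 < x \<bullet> (V *v x)"
  obtains A :: "real^'n^'n" where "invertible A" "V = transpose A ** A"
proof -
  define orth where "orth S \<longleftrightarrow> finite S \<and> (\<forall>x\<in>S. \<forall>y\<in>S. x \<bullet> (V *v y) = (if x = y then 1 else 0))" for S :: "(real^'n) set"
  have lin: "linear ((*v) V)" by (rule matrix_vector_mul_linear)
  have coef: "y \<bullet> (V *v (\<Sum>x\<in>S. c x *\<^sub>R x)) = c y" if "orth S" "y \<in> S" for S c and y :: "real^'n"
  proof -
    have "y \<bullet> (V *v (\<Sum>x\<in>S. c x *\<^sub>R x)) = (\<Sum>x\<in>S. c x * (y \<bullet> (V *v x)))"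
      unfolding linear_sum[OF lin] linear_cmul[OF lin] inner_sum_right inner_scaleR_right ..
    also have "\<dots> = (\<Sum>x\<in>S. if x = y then c x else 0)" using that by (intro sum.cong) (auto simp: orth_def)
    also have "\<dots> = c y" using that by (simp add: orth_def)
    finally show ?thesis .
  qed
  have indep: "independent S" if S: "orth S" for S
    unfolding independent_explicit
  proof (intro conjI allI impI ballI)
    show "finite S" using S by (simp add: orth_def)
    fix c y assume "(\<Sum>v\<in>S. c v *\<^sub>R v) = 0" "y \<in> S"
    then show "c y = 0" using coef[OF S, of y c] by simp
  qed
  have bnd: "card S \<le> DIM(real^'n)" if "orth S" for S using independent_bound[OF indep[OF that]] by simp
  have "orth {}" by (simp add: orth_def)
  then obtain S where S: "orth S" and mx: "\<And>S'. orth S' \<Longrightarrow> card S' \<le> card S"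
    using ex_has_greatest_nat[of orth "{}" card "Suc DIM(real^'n)"] bnd by (metis le_imp_less_Suc)
  have fS: "finite S" using S by (simp add: orth_def)
  have "span S = UNIV"
  proof (rule ccontr)
    assume "span S \<noteq> UNIV"
    then obtain x where x: "x \<notin> span S" by auto
    define y where "y = x - (\<Sum>e\<in>S. (e \<bullet> (V *v x)) *\<^sub>R e)"
    have "(\<Sum>e\<in>S. (e \<bullet> (V *v x)) *\<^sub>R e) \<in> span S" by (intro span_sum span_scale span_base)
    then have y0: "y \<noteq> 0" using x by (auto simp: y_def)
    have ey: "e \<bullet> (V *v y) = 0" if "e \<in> S" for e
      unfolding y_def by (simp add: matrix_vector_mult_diff_distrib inner_diff_right coef[OF S that])
    define z where "z = (1 / sqrt (y \<bullet> (V *v y))) *\<^sub>R y"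
    have zz: "z \<bullet> (V *v z) = 1"
      using pos[OF y0] by (simp add: z_def matrix_vector_mult_scaleR)
    have ez: "e \<bullet> (V *v z) = 0" if "e \<in> S" for e using ey[OF that] by (simp add: z_def matrix_vector_mult_scaleR)
    have ze: "z \<bullet> (V *v e) = 0" if "e \<in> S" for e using ez[OF that] sym[of z e] by simp
    have zS: "z \<notin> S" using zz ez by force
    have "orth (insert z S)"
      using S zz ez ze by (auto simp: orth_def)
    from mx[OF this] zS fS show False by simp
  qed
  then have "card S = DIM(real^'n)" using basis_card_eq_dim[of S UNIV] indep[OF S] by simp
  then have "card S = card (UNIV :: 'n set)" by simp
  then obtain f where f: "bij_betw f (UNIV :: 'n set) S" using fS finite_same_card_bij[of "UNIV :: 'n set" S] by auto
  define E :: "real^'n^'n" where "E = (\<chi> i j. f j $ i)"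
  have col: "E *v axis j 1 = f j" for j by (simp add: E_def matrix_vector_mult_def axis_def vec_eq_iff if_distrib cong: if_cong)
  have ETVE: "transpose E ** V ** E = mat 1"
  proof -
    have "(transpose E ** V ** E) $ i $ j = axis i 1 \<bullet> ((transpose E ** V ** E) *v axis j 1)" for i j
      by (simp add: inner_axis' matrix_vector_mult_basis column_def)
    also have "axis i 1 \<bullet> ((transpose E ** V ** E) *v axis j 1) = f i \<bullet> (V *v f j)" for i j
      by (simp only: matrix_vector_mul_assoc[symmetric] inner_transpose col)
    also have "f i \<bullet> (V *v f j) = mat 1 $ i $ j" for i j
      using S f bij_betwE[OF f] by (auto simp: orth_def mat_def bij_betw_def inj_on_def)
    finally show ?thesis by (simp add: vec_eq_iff)
  qed
  then have "det (transpose E) * det V * det E = 1" by (metis det_I det_mul)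
  then have "invertible E" unfolding invertible_det_nz by auto
  then obtain A where A: "E ** A = mat 1" "A ** E = mat 1" unfolding invertible_def by auto
  have "transpose A ** A = transpose A ** (transpose E ** V ** E) ** A" by (simp add: ETVE)
  also have "\<dots> = (transpose A ** transpose E) ** V ** (E ** A)" by (simp add: matrix_mul_assoc)
  also have "\<dots> = V" using A by (simp add: matrix_transpose_mul[symmetric])
  finally have "V = transpose A ** A" by simp
  moreover have "invertible A" using A unfolding invertible_def by auto
  ultimately show ?thesis using that by blast
qed

lemma quadratic_factor:
  fixes A :: "real^'n^'n"
  shows "x \<bullet> ((transpose A ** A) *v x) = (norm (A *v x))\<^sup>2" "det (transpose A ** A) = (det A)\<^sup>2"
  unfolding matrix_vector_mul_assoc[symmetric] inner_transpose power2_norm_eq_inner det_mul det_transpose power2_eq_square[of "det A"] by simp_all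

lemma invertible_matrix_preimage:
  fixes A :: "real^'n^'n"
  assumes "invertible A"
  obtains B where "A ** B = mat 1" "B ** A = mat 1" "\<And>x. A *v (B *v x) = x" "\<And>x. B *v (A *v x) = x" "\<bar>det B\<bar> = 1 / \<bar>det A\<bar>"
proof -
  obtain B where B: "A ** B = mat 1" "B ** A = mat 1" using assms unfolding invertible_def by auto
  have "det A * det B = 1" by (metis B(1) det_I det_mul)
  then have "\<bar>det A\<bar> * \<bar>det B\<bar> = 1" by (metis abs_mult abs_one)
  then have "\<bar>det B\<bar> = 1 / \<bar>det A\<bar>" by (cases "det A = 0") (simp_all add: eq_divide_eq mult.commute)
  then show ?thesis using that B by (simp add: matrix_vector_mul_assoc)
qed

lemma measure_ellipsoid:
  fixes A :: "real^'n^'n"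
  assumes A: "invertible A" and r: "0 \<le> r"
  shows "emeasure lebesgue {x. norm (A *v (x - c)) \<le> r} = ennreal (measure lebesgue (ball (0::real^'n) 1) * r ^ CARD('n) / \<bar>det A\<bar>)"
    and "{x. norm (A *v (x - c)) \<le> r} \<in> sets lebesgue"
proof -
  obtain B where B: "\<And>x. A *v (B *v x) = x" "\<And>x. B *v (A *v x) = x" "\<bar>det B\<bar> = 1 / \<bar>det A\<bar>"
    using invertible_matrix_preimage[OF A] by metis
  have eq: "{x. norm (A *v (x - c)) \<le> r} = (+) c ` ((*v) B ` cball 0 r)"
  proof (intro set_eqI iffI)
    fix x assume "x \<in> {x. norm (A *v (x - c)) \<le> r}"
    then have "A *v (x - c) \<in> cball 0 r" "x = c + B *v (A *v (x - c))" by (simp_all add: B)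
    then show "x \<in> (+) c ` ((*v) B ` cball 0 r)" by blast
  qed (auto simp: B)
  have m: "(*v) B ` cball 0 r \<in> lmeasurable \<and> measure lebesgue ((*v) B ` cball 0 r) = \<bar>det B\<bar> * measure lebesgue (cball (0::real^'n) r)"
    using measure_linear_image_finite[of "(*v) B" "cball 0 r"] by simp
  have b: "measure lebesgue (cball (0::real^'n) r) = measure lebesgue (ball (0::real^'n) 1) * r ^ CARD('n)"
    using r content_cball[OF r, of "0::real^'n"] content_ball[of 1 "0::real^'n"] by simp
  have l: "{x. norm (A *v (x - c)) \<le> r} \<in> lmeasurable" unfolding eq using m measurable_translation by blast
  then show "{x. norm (A *v (x - c)) \<le> r} \<in> sets lebesgue" by (rule fmeasurableD)
  have "measure lebesgue {x. norm (A *v (x - c)) \<le> r} = measure lebesgue (ball (0::real^'n) 1) * r ^ CARD('n) / \<bar>det A\<bar>"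
    unfolding eq measure_translation using m b B(3) by simp
  then show "emeasure lebesgue {x. norm (A *v (x - c)) \<le> r} = ennreal (measure lebesgue (ball (0::real^'n) 1) * r ^ CARD('n) / \<bar>det A\<bar>)"
    using emeasure_eq_measure2[OF l] by simp
qed

text \<open>Comparison of the volumes of the ellipsoids on which \<open>B\<close> and \<open>A\<close> are bounded: the first is contained in the second.\<close>

lemma det_le_of_contraction:
  fixes A B :: "real^'n^'n"
  assumes B: "invertible B" and r: "0 \<le> r" and le: "\<And>x. norm (A *v x) \<le> r * norm (B *v x)"
  shows "\<bar>det A\<bar> \<le> r ^ CARD('n) * \<bar>det B\<bar>"
proof (cases "invertible A")
  case False
  then have "det A = 0" by (simp add: invertible_det_nz)
  then show ?thesis using r by simp
next
  case A: True
  let ?w = "measure lebesgue (ball (0::real^'n) 1)"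
  have w: "0 < ?w" by (simp add: content_ball unit_ball_vol_pos)
  have dA: "0 < \<bar>det A\<bar>" and dB: "0 < \<bar>det B\<bar>" using A B by (simp_all add: invertible_det_nz)
  have "emeasure lebesgue {x. norm (B *v (x - 0)) \<le> 1} \<le> emeasure lebesgue {x. norm (A *v (x - 0)) \<le> r}"
  proof (intro emeasure_mono measure_ellipsoid A r subsetI CollectI)
    fix x assume "x \<in> {x. norm (B *v (x - 0)) \<le> 1}"
    then have "r * norm (B *v x) \<le> r * 1" using r by (intro mult_left_mono) auto
    then show "norm (A *v (x - 0)) \<le> r" using le[of x] by simp
  qed
  then have "?w / \<bar>det B\<bar> \<le> ?w * r ^ CARD('n) / \<bar>det A\<bar>"
    using measure_ellipsoid(1)[OF A r, of 0] measure_ellipsoid(1)[OF B, of 1 0] r w dA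
    by (simp add: ennreal_le_iff)
  then show ?thesis using w dA dB by (simp add: field_simps)
qed

section \<open>Exponential moments of increments\<close>

text \<open>Jensen's inequality for the exponential, without any assumption on the finiteness of the right-hand side.\<close>

lemma ennreal_exp_integral_le:
  fixes g :: "'a \<Rightarrow> real"
  assumes M: "prob_space M" and g: "integrable M g"
  shows "ennreal (exp (\<integral>x. g x \<partial>M)) \<le> (\<integral>\<^sup>+x. ennreal (exp (g x)) \<partial>M)"
proof -
  interpret prob_space M by (rule M)
  let ?m = "\<integral>x. g x \<partial>M"
  have i: "integrable M (\<lambda>x. exp ?m * (1 + (g x - ?m)))" using g by simp
  have "(\<integral>x. exp ?m * (1 + (g x - ?m)) \<partial>M) = exp ?m" using g by (simp add: prob_space)
  then have "ennreal (exp ?m) = ennreal (\<integral>x. exp ?m * (1 + (g x - ?m)) \<partial>M)" by simp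
  also have "\<dots> \<le> (\<integral>\<^sup>+x. ennreal (exp (g x)) \<partial>M)"
  proof (rule ennreal_integral_le_nn_integral[OF i])
    fix x
    have "exp ?m * (1 + (g x - ?m)) \<le> exp ?m * exp (g x - ?m)" by (intro mult_left_mono exp_ge_add_one_self) auto
    then show "exp ?m * (1 + (g x - ?m)) \<le> exp (g x)" by (simp add: exp_add[symmetric])
  qed
  finally show ?thesis .
qed

text \<open>Jensen's inequality applied to the increment, which is the mean of the derivative over the unit interval.  The derivative need
not be continuous.  It is jointly measurable as a limit of difference quotients, its exponential moments make it Lebesgue
integrable along almost every path, and then its Lebesgue integral agrees with the gauge integral for which the fundamental
theorem of calculus holds.\<close>

lemma increment_exponential_moment:
  fixes f f' :: "'y \<Rightarrow> real \<Rightarrow> real"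
  assumes P: "prob_space P"
    and meas: "\<And>s. s \<in> {0..1} \<Longrightarrow> (\<lambda>y. f y s) \<in> borel_measurable P"
    and deriv: "\<And>y s. y \<in> space P \<Longrightarrow> s \<in> {0..1} \<Longrightarrow> (f y has_vector_derivative f' y s) (at s within {0..1})"
    and up: "\<And>s. s \<in> {0..1} \<Longrightarrow> (\<integral>\<^sup>+y. ennreal (exp (f' y s)) \<partial>P) \<le> ennreal B"
    and down: "\<And>s. s \<in> {0..1} \<Longrightarrow> (\<integral>\<^sup>+y. ennreal (exp (- f' y s)) \<partial>P) \<le> ennreal B"
  shows "(\<integral>\<^sup>+y. ennreal (exp (f y 1 - f y 0)) \<partial>P) \<le> ennreal B"
proof -
  interpret prob_space P by (rule P)
  define U where "U = (uniform_measure lborel {0..1} :: real measure)"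
  interpret U: prob_space U unfolding U_def by (rule prob_space_uniform_measure) auto
  interpret PU: pair_prob_space P U ..
  have sU [measurable_cong]: "sets U = sets borel" by (simp add: U_def)
  have spU: "space U = UNIV" by (simp add: U_def)
  have nnU: "(\<integral>\<^sup>+s. h s \<partial>U) = (\<integral>\<^sup>+s. h s * indicator {0..1} s \<partial>lborel)" if "h \<in> borel_measurable borel" for h :: "real \<Rightarrow> ennreal"
    unfolding U_def using that by (subst nn_integral_uniform_measure) (auto simp: divide_ennreal_def)
  \<comment> \<open>Clamping the path to the unit interval makes it continuous on the whole line.\<close>
  define c where "c s = max 0 (min 1 (s::real))" for s
  have c01: "c s \<in> {0..1}" for s by (auto simp: c_def)
  have cid: "c s = s" if "s \<in> {0..1}" for s using that by (auto simp: c_def)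
  have cc: "continuous_on UNIV c" unfolding c_def by (intro continuous_intros)
  have contf: "continuous_on {0..1} (f y)" if "y \<in> space P" for y
    unfolding continuous_on_eq_continuous_within using has_vector_derivative_continuous[OF deriv[OF that]] by blast
  define F where "F y s = f y (c s)" for y s
  have F [measurable]: "(\<lambda>x. F (fst x) (snd x)) \<in> borel_measurable (P \<Otimes>\<^sub>M borel)"
  proof -
    have "continuous_on UNIV (\<lambda>s. F y s)" if "y \<in> space P" for y
      unfolding F_def using c01 by (intro continuous_on_compose2[OF contf[OF that] cc]) auto
    moreover have "(\<lambda>y. F y s) \<in> borel_measurable P" for s unfolding F_def by (rule meas[OF c01])
    ultimately show ?thesis using borel_measurable_caratheodory[of P "\<lambda>s y. F y s"] by simp
  qed
  define G where "G x = lim (\<lambda>n. real (Suc n) * (F (fst x) (snd x + 1 / real (Suc n)) - F (fst x) (snd x)))" for x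
  have [measurable]: "G \<in> borel_measurable (P \<Otimes>\<^sub>M borel)" unfolding G_def[abs_def]
  proof (rule borel_measurable_lim_metric)
    fix n
    have "(\<lambda>x. F (fst x) (snd x + 1 / real (Suc n))) \<in> borel_measurable (P \<Otimes>\<^sub>M borel)"
      using measurable_compose[OF _ F, of "\<lambda>x. (fst x, snd x + 1 / real (Suc n))" "P \<Otimes>\<^sub>M borel"] by simp
    then show "(\<lambda>x. real (Suc n) * (F (fst x) (snd x + 1 / real (Suc n)) - F (fst x) (snd x))) \<in> borel_measurable (P \<Otimes>\<^sub>M borel)" by measurable
  qed
  have GF: "G (y, s) = f' y s" if y: "y \<in> space P" and s: "s \<in> {0..<1}" for y s
  proof -
    let ?e = "\<lambda>n. 1 / real (Suc n)"
    have e0: "?e \<longlonglongrightarrow> 0" using LIMSEQ_inverse_real_of_nat by (simp add: inverse_eq_divide)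
    have "(f y has_field_derivative f' y s) (at s within {0..1})"
      using deriv[OF y, of s] s by (simp add: has_real_derivative_iff_has_vector_derivative)
    then have lim: "((\<lambda>t. (f y t - f y s) / (t - s)) \<longlongrightarrow> f' y s) (at s within {0..1})"
      by (simp add: has_field_derivative_iff)
    have ev: "\<forall>\<^sub>F n in sequentially. s + ?e n < 1"
      using order_tendstoD(2)[OF tendsto_add[OF tendsto_const e0, of s], of 1] s by simp
    have "filterlim (\<lambda>n. s + ?e n) (at s within {0..1}) sequentially"
      unfolding filterlim_at
    proof (intro conjI)
      show "(\<lambda>n. s + ?e n) \<longlonglongrightarrow> s" using tendsto_add[OF tendsto_const e0, of s] by simp
      show "\<forall>\<^sub>F n in sequentially. s + ?e n \<in> {0..1} \<and> s + ?e n \<noteq> s" using ev by eventually_elim (use s in auto)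
    qed
    from filterlim_compose[OF lim this]
    have "(\<lambda>n. (f y (s + ?e n) - f y s) / (s + ?e n - s)) \<longlonglongrightarrow> f' y s" by simp
    moreover have "\<forall>\<^sub>F n in sequentially. (f y (s + ?e n) - f y s) / (s + ?e n - s) = real (Suc n) * (F y (s + ?e n) - F y s)"
      using ev by eventually_elim (use s in \<open>simp add: F_def cid\<close>)
    ultimately have "(\<lambda>n. real (Suc n) * (F y (s + ?e n) - F y s)) \<longlonglongrightarrow> f' y s" by (rule Lim_transform_eventually)
    then show ?thesis unfolding G_def by (simp add: limI)
  qed
  have Gint: "(\<integral>\<^sup>+y. ennreal (exp (a * G (y, s))) \<partial>P) \<le> ennreal B" if a: "a = 1 \<or> a = -1" and s: "s \<in> {0..<1}" for a s
  proof -
    have "(\<integral>\<^sup>+y. ennreal (exp (a * G (y, s))) \<partial>P) = (\<integral>\<^sup>+y. ennreal (exp (a * f' y s)) \<partial>P)"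
      by (intro nn_integral_cong) (subst GF[OF _ s], auto)
    also have "\<dots> \<le> ennreal B" using a up[of s] down[of s] s by auto
    finally show ?thesis .
  qed
  have aeU: "AE s in U. s \<in> {0..<1}"
  proof -
    have "AE s in lborel. s \<in> {0..1} \<longrightarrow> s \<in> {0..<(1::real)}" by (rule AE_mp[OF AE_lborel_singleton[of 1]]) (auto intro!: AE_I2)
    then show ?thesis unfolding U_def by (intro AE_uniform_measureI) auto
  qed
  have joint: "(\<integral>\<^sup>+y. (\<integral>\<^sup>+s. ennreal (exp (a * G (y, s))) \<partial>U) \<partial>P) \<le> ennreal B" if a: "a = 1 \<or> a = -1" for a
  proof -
    have "(\<integral>\<^sup>+y. (\<integral>\<^sup>+s. ennreal (exp (a * G (y, s))) \<partial>U) \<partial>P) = (\<integral>\<^sup>+s. (\<integral>\<^sup>+y. ennreal (exp (a * G (y, s))) \<partial>P) \<partial>U)"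
      by (subst PU.Fubini') auto
    also have "\<dots> \<le> (\<integral>\<^sup>+s. ennreal B \<partial>U)"
      by (rule nn_integral_mono_AE, rule AE_mp[OF aeU]) (use Gint[OF a] in \<open>auto intro!: AE_I2\<close>)
    finally show ?thesis by (simp add: U.emeasure_space_1)
  qed
  have abs: "(\<integral>\<^sup>+y. (\<integral>\<^sup>+s. ennreal \<bar>G (y, s)\<bar> \<partial>U) \<partial>P) < \<infinity>"
  proof -
    have "(\<integral>\<^sup>+y. (\<integral>\<^sup>+s. ennreal \<bar>G (y, s)\<bar> \<partial>U) \<partial>P) \<le> (\<integral>\<^sup>+y. (\<integral>\<^sup>+s. ennreal (exp (1 * G (y, s))) + ennreal (exp (-1 * G (y, s))) \<partial>U) \<partial>P)"
    proof (intro nn_integral_mono)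
      fix y s
      have "\<bar>G (y, s)\<bar> \<le> exp \<bar>G (y, s)\<bar>" using exp_ge_add_one_self[of "\<bar>G (y, s)\<bar>"] by linarith
      also have "\<dots> \<le> exp (1 * G (y, s)) + exp (-1 * G (y, s))" by (cases "0 \<le> G (y, s)") auto
      finally have "ennreal \<bar>G (y, s)\<bar> \<le> ennreal (exp (1 * G (y, s)) + exp (-1 * G (y, s)))" by (rule ennreal_leI)
      then show "ennreal \<bar>G (y, s)\<bar> \<le> ennreal (exp (1 * G (y, s))) + ennreal (exp (-1 * G (y, s)))" by (subst (asm) ennreal_plus) auto
    qed
    also have "\<dots> = (\<integral>\<^sup>+y. (\<integral>\<^sup>+s. ennreal (exp (1 * G (y, s))) \<partial>U) \<partial>P) + (\<integral>\<^sup>+y. (\<integral>\<^sup>+s. ennreal (exp (-1 * G (y, s))) \<partial>U) \<partial>P)"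
    proof -
      have m: "(\<lambda>y. \<integral>\<^sup>+s. ennreal (exp (a * G (y, s))) \<partial>U) \<in> borel_measurable P" for a by measurable
      have "(\<integral>\<^sup>+s. ennreal (exp (1 * G (y, s))) + ennreal (exp (-1 * G (y, s))) \<partial>U) = (\<integral>\<^sup>+s. ennreal (exp (1 * G (y, s))) \<partial>U) + (\<integral>\<^sup>+s. ennreal (exp (-1 * G (y, s))) \<partial>U)"
        if "y \<in> space P" for y using that by (intro nn_integral_add) measurable
      then show ?thesis by (subst nn_integral_add[symmetric, OF m m]) (rule nn_integral_cong)
    qed
    also have "\<dots> \<le> ennreal B + ennreal B" using joint[of 1] joint[of "-1"] by (intro add_mono) auto
    also have "\<dots> < \<infinity>" by simp
    finally show ?thesis .
  qed
  have ae: "AE y in P. (\<integral>\<^sup>+s. ennreal \<bar>G (y, s)\<bar> \<partial>U) \<noteq> \<infinity>"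
    using abs by (intro nn_integral_PInf_AE) auto
  have "(\<integral>\<^sup>+y. ennreal (exp (f y 1 - f y 0)) \<partial>P) \<le> (\<integral>\<^sup>+y. (\<integral>\<^sup>+s. ennreal (exp (1 * G (y, s))) \<partial>U) \<partial>P)"
  proof (rule nn_integral_mono_AE, rule AE_mp[OF ae], intro AE_I2 impI)
    fix y assume y: "y \<in> space P" and fin: "(\<integral>\<^sup>+s. ennreal \<bar>G (y, s)\<bar> \<partial>U) \<noteq> \<infinity>"
    have Gy [measurable]: "(\<lambda>s. G (y, s)) \<in> borel_measurable borel" using y by measurable
    have iU: "integrable U (\<lambda>s. G (y, s))"
      using fin by (intro integrableI_bounded) (auto simp: less_top sU cong: measurable_cong_sets)
    have fin2: "(\<integral>\<^sup>+s. ennreal \<bar>G (y, s)\<bar> * indicator {0..1} s \<partial>lborel) \<noteq> \<infinity>"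
      using fin by (subst (asm) nnU) auto
    have iL: "integrable lborel (\<lambda>s. indicator {0..1} s * G (y, s))"
    proof (rule integrableI_bounded)
      have "(\<integral>\<^sup>+s. ennreal (norm (indicator {0..1} s * G (y, s))) \<partial>lborel) = (\<integral>\<^sup>+s. ennreal \<bar>G (y, s)\<bar> * indicator {0..1} s \<partial>lborel)"
        by (intro nn_integral_cong) (simp add: indicator_def)
      then show "(\<integral>\<^sup>+s. ennreal (norm (indicator {0..1} s * G (y, s))) \<partial>lborel) < \<infinity>" using fin2 by (simp add: less_top)
    qed measurable
    have "((\<lambda>s. f' y s) has_integral (f y 1 - f y 0)) {0..1}"
      by (rule fundamental_theorem_of_calculus) (use deriv[OF y] in auto)
    then have h1: "((\<lambda>s. G (y, s)) has_integral (f y 1 - f y 0)) {0..1}"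
      by (rule has_integral_spike[where S="{1}", rotated 2]) (auto simp: GF y)
    have "((\<lambda>s. indicator {0..1} s * G (y, s)) has_integral (\<integral>s. indicator {0..1} s * G (y, s) \<partial>lborel)) UNIV"
      using has_integral_integral_lborel[OF iL] .
    then have h2: "((\<lambda>s. G (y, s)) has_integral (\<integral>s. indicator {0..1} s * G (y, s) \<partial>lborel)) {0..1}"
    proof -
      have "(\<lambda>s. if s \<in> {0..1} then G (y, s) else 0) = (\<lambda>s. indicator {0..1} s * G (y, s))" by (auto simp: indicator_def)
      then show ?thesis
        using \<open>((\<lambda>s. indicator {0..1} s * G (y, s)) has_integral _) UNIV\<close> by (subst has_integral_restrict_UNIV[symmetric]) simp
    qed
    have "(\<integral>s. G (y, s) \<partial>U) = (\<integral>s. indicator {0..1} s * G (y, s) \<partial>lborel)"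
    proof -
      have "U = density lborel (\<lambda>s. ennreal (indicator {0..1} s))"
        unfolding U_def uniform_measure_def by (intro density_cong) (auto simp: indicator_def divide_ennreal_def)
      then show ?thesis by (simp add: integral_density)
    qed
    then have eq: "(\<integral>s. G (y, s) \<partial>U) = f y 1 - f y 0" using has_integral_unique[OF h1 h2] by simp
    show "ennreal (exp (f y 1 - f y 0)) \<le> (\<integral>\<^sup>+s. ennreal (exp (1 * G (y, s))) \<partial>U)"
      using ennreal_exp_integral_le[OF U.prob_space_axioms iU] unfolding eq by simp
  qed
  also have "\<dots> \<le> ennreal B" by (rule joint) simp
  finally show ?thesis .
qed

lemma iid_product_moment:
  assumes M: "prob_space M" and ind: "prob_space.indep_vars M (\<lambda>_. P) Y {..<n}" and id: "\<And>i. i < n \<Longrightarrow> distr M P (Y i) = P"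
    and g [measurable]: "g \<in> borel_measurable P"
  shows "(\<integral>\<^sup>+w. ennreal (exp (\<Sum>i<n. g (Y i w))) \<partial>M) = (\<integral>\<^sup>+y. ennreal (exp (g y)) \<partial>P) ^ n"
proof -
  interpret prob_space M by (rule M)
  have Y: "Y i \<in> measurable M P" if "i < n" for i using ind that by (auto simp: indep_vars_def)
  have "(\<integral>\<^sup>+w. ennreal (exp (\<Sum>i<n. g (Y i w))) \<partial>M) = (\<integral>\<^sup>+w. (\<Prod>i<n. ennreal (exp (g (Y i w)))) \<partial>M)"
    by (simp add: exp_sum prod_ennreal)
  also have "\<dots> = (\<Prod>i<n. \<integral>\<^sup>+w. ennreal (exp (g (Y i w))) \<partial>M)"
  proof (rule indep_vars_nn_integral)
    show "indep_vars (\<lambda>_. borel) (\<lambda>i w. ennreal (exp (g (Y i w)))) {..<n}"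
      using indep_vars_compose2[OF ind, where Y="\<lambda>_ y. ennreal (exp (g y))" and N="\<lambda>_. borel"] by simp
  qed auto
  also have "\<dots> = (\<Prod>i<n. \<integral>\<^sup>+y. ennreal (exp (g y)) \<partial>P)"
  proof (rule prod.cong[OF refl])
    fix i assume "i \<in> {..<n}"
    then have i: "i < n" by simp
    have "(\<integral>\<^sup>+y. ennreal (exp (g y)) \<partial>P) = (\<integral>\<^sup>+y. ennreal (exp (g y)) \<partial>distr M P (Y i))" unfolding id[OF i] ..
    also have "\<dots> = (\<integral>\<^sup>+w. ennreal (exp (g (Y i w))) \<partial>M)" by (rule nn_integral_distr[OF Y[OF i]]) simp
    finally show "(\<integral>\<^sup>+w. ennreal (exp (g (Y i w))) \<partial>M) = (\<integral>\<^sup>+y. ennreal (exp (g y)) \<partial>P)" by simp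
  qed
  finally show ?thesis by simp
qed

section \<open>Metric entropy of the unit ball\<close>

lemma cover_number_le:
  assumes "finite C" "cball (0::real^'p) 1 \<subseteq> (\<Union>c\<in>C. cball c (1 / 2 ^ k))"
  shows "cover_number TYPE('p) k \<le> card C"
  unfolding cover_number_def using assms by (intro Least_le) blast

lemma cover_number_attained:
  obtains C :: "(real^'p) set" where "finite C" "card C = cover_number TYPE('p) k" "cball 0 1 \<subseteq> (\<Union>c\<in>C. cball c (1 / 2 ^ k))"
proof -
  have "compact (cball (0::real^'p) 1)" by simp
  then obtain C where C: "finite C" "cball (0::real^'p) 1 \<subseteq> (\<Union>c\<in>C. ball c (1 / 2 ^ k))"
    unfolding compact_eq_totally_bounded by (elim conjE allE[of _ "1 / 2 ^ k"]) auto
  have "cball (0::real^'p) 1 \<subseteq> (\<Union>c\<in>C. cball c (1 / 2 ^ k))" by (rule order_trans[OF C(2)]) (intro UN_mono subset_refl ball_subset_cball)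
  then have "\<exists>m. \<exists>C :: (real^'p) set. finite C \<and> card C = m \<and> cball 0 1 \<subseteq> (\<Union>c\<in>C. cball c (1 / 2 ^ k))"
    using C(1) by (intro exI[of _ "card C"] exI[of _ C] conjI refl)
  from LeastI_ex[OF this] obtain C' :: "(real^'p) set" where "finite C'" "card C' = cover_number TYPE('p) k" "cball 0 1 \<subseteq> (\<Union>c\<in>C'. cball c (1 / 2 ^ k))"
    unfolding cover_number_def by (elim exE conjE)
  then show ?thesis by (rule that)
qed

lemma cover_number_ge: "2 ^ (k * CARD('p)) \<le> cover_number TYPE('p::finite) k"
proof -
  obtain C :: "(real^'p) set" where C: "finite C" "card C = cover_number TYPE('p) k" "cball 0 1 \<subseteq> (\<Union>c\<in>C. cball c (1 / 2 ^ k))"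
    by (rule cover_number_attained)
  let ?w = "unit_ball_vol (real CARD('p))"
  have w: "0 < ?w" by (simp add: unit_ball_vol_pos)
  have "measure lebesgue (cball (0::real^'p) 1) \<le> measure lebesgue (\<Union>c\<in>C. cball c (1 / 2 ^ k))"
    using C by (intro measure_mono_fmeasurable fmeasurable.finite_UN) auto
  also have "\<dots> \<le> (\<Sum>c\<in>C. measure lebesgue (cball c (1 / 2 ^ k)))"
    using C by (intro measure_UNION_le) auto
  also have "\<dots> = real (card C) * (?w * (1 / 2 ^ k) ^ CARD('p))" by (simp add: content_cball)
  finally have "?w \<le> real (card C) * (?w * (1 / 2 ^ k) ^ CARD('p))" by (simp add: content_cball)
  then have "?w * 2 ^ (k * CARD('p)) \<le> ?w * real (card C)" by (simp add: field_simps power_mult[symmetric] power_one_over)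
  then have "2 ^ (k * CARD('p)) \<le> real (card C)" using w by simp
  then have "real (2 ^ (k * CARD('p))) \<le> real (card C)" by simp
  then show ?thesis unfolding C(2) of_nat_le_iff .
qed

text \<open>Cover each ball of a cover by a scaled copy of a cover with half the radius.\<close>

lemma cover_number_Suc_le: "cover_number TYPE('p::finite) (Suc k) \<le> cover_number TYPE('p) k * cover_number TYPE('p) 1"
proof -
  obtain C :: "(real^'p) set" where C: "finite C" "card C = cover_number TYPE('p) k" "cball 0 1 \<subseteq> (\<Union>c\<in>C. cball c (1 / 2 ^ k))"
    by (rule cover_number_attained)
  obtain D :: "(real^'p) set" where D: "finite D" "card D = cover_number TYPE('p) 1" "cball 0 1 \<subseteq> (\<Union>c\<in>D. cball c (1 / 2 ^ 1))"
    by (rule cover_number_attained)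
  let ?f = "\<lambda>x :: (real^'p) \<times> (real^'p). fst x + (1 / 2 ^ k) *\<^sub>R snd x"
  have "cball (0::real^'p) 1 \<subseteq> (\<Union>c\<in>?f ` (C \<times> D). cball c (1 / 2 ^ Suc k))"
  proof
    fix x :: "real^'p" assume "x \<in> cball 0 1"
    then obtain c where c: "c \<in> C" "dist c x \<le> 1 / 2 ^ k" using C(3) by auto
    define z where "z = 2 ^ k *\<^sub>R (x - c)"
    have "norm z = 2 ^ k * dist c x" by (simp add: z_def dist_norm norm_minus_commute)
    also have "\<dots> \<le> 2 ^ k * (1 / 2 ^ k)" using c by (intro mult_left_mono) auto
    finally have "z \<in> cball 0 1" by simp
    then obtain e where e: "e \<in> D" "dist e z \<le> 1 / 2" using D(3) by auto
    have x: "x = c + (1 / 2 ^ k) *\<^sub>R z" by (simp add: z_def)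
    have "dist (?f (c, e)) x = (1 / 2 ^ k) * dist e z" unfolding x dist_norm by (simp add: scaleR_diff_right[symmetric])
    also have "\<dots> \<le> (1 / 2 ^ k) * (1 / 2)" using e by (intro mult_left_mono) auto
    finally have "x \<in> cball (?f (c, e)) (1 / 2 ^ Suc k)" by (simp add: mult.commute)
    then show "x \<in> (\<Union>c\<in>?f ` (C \<times> D). cball c (1 / 2 ^ Suc k))" using c(1) e(1) by blast
  qed
  then have "cover_number TYPE('p) (Suc k) \<le> card (?f ` (C \<times> D))" using C(1) D(1) by (intro cover_number_le) auto
  also have "\<dots> \<le> card (C \<times> D)" using C(1) D(1) by (intro card_image_le) auto
  finally show ?thesis unfolding card_cartesian_product C(2) D(2) .
qed

lemma cover_number_le_power: "cover_number TYPE('p::finite) k \<le> cover_number TYPE('p) 1 ^ k"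
proof (induction k)
  case 0
  show ?case using cover_number_le[of "{0::real^'p}" 0] by simp
next
  case (Suc k)
  have "cover_number TYPE('p) (Suc k) \<le> cover_number TYPE('p) k * cover_number TYPE('p) 1" by (rule cover_number_Suc_le)
  also have "\<dots> \<le> cover_number TYPE('p) 1 ^ k * cover_number TYPE('p) 1" using Suc by (rule mult_right_mono) simp
  finally show ?case by (simp add: mult.commute)
qed

text \<open>Submultiplicativity makes the entropy series converge, so that the volume bound for each term carries over to the sum.\<close>

lemma entropy_Q_ge: "2 * real CARD('p) * ln 2 \<le> entropy_Q TYPE('p::finite)"
proof -
  have s: "(\<lambda>k. real (Suc k) / 2 ^ Suc k) sums 2"
    using sums_mult[OF geometric_deriv_sums[of "1/2::real"], of "1/2"] by (simp add: power_one_over field_simps)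
  have pos: "1 \<le> cover_number TYPE('p) k" for k using order_trans[OF one_le_power[of "2::nat"] cover_number_ge[where 'p='p, of k]] by simp
  let ?a = "\<lambda>k. ln (real (cover_number TYPE('p) (Suc k))) / 2 ^ Suc k"
  have up: "?a k \<le> ln (real (cover_number TYPE('p) 1)) * (real (Suc k) / 2 ^ Suc k)" for k
  proof -
    have "real (cover_number TYPE('p) (Suc k)) \<le> real (cover_number TYPE('p) 1) ^ Suc k"
      unfolding of_nat_power[symmetric] of_nat_le_iff by (rule cover_number_le_power)
    then have "ln (real (cover_number TYPE('p) (Suc k))) \<le> ln (real (cover_number TYPE('p) 1) ^ Suc k)"
      using pos[of 1] pos[of "Suc k"] by (subst ln_le_cancel_iff) (auto simp: Suc_le_eq)
    also have "\<dots> = real (Suc k) * ln (real (cover_number TYPE('p) 1))" using pos[of 1] by (simp add: ln_realpow del: power_Suc)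
    finally show ?thesis by (simp add: field_simps del: power_Suc)
  qed
  have low: "(real CARD('p) * ln 2) * (real (Suc k) / 2 ^ Suc k) \<le> ?a k" for k
  proof -
    have "2 ^ (Suc k * CARD('p)) \<le> real (cover_number TYPE('p) (Suc k))"
      using of_nat_mono[OF cover_number_ge[where 'p='p, of "Suc k"], where 'a=real] by simp
    then have "ln (2 ^ (Suc k * CARD('p))) \<le> ln (real (cover_number TYPE('p) (Suc k)))"
      using pos[of "Suc k"] by (subst ln_le_cancel_iff) (auto simp: Suc_le_eq)
    then have "real (Suc k) * real CARD('p) * ln 2 \<le> ln (real (cover_number TYPE('p) (Suc k)))"
      by (simp only: ln_realpow[of 2] zero_less_numeral of_nat_mult)
    then have "real (Suc k) * real CARD('p) * ln 2 / 2 ^ Suc k \<le> ?a k" by (rule divide_right_mono) simp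
    then show ?thesis by (simp only: times_divide_eq_right mult_ac)
  qed
  have "summable ?a"
  proof (rule summable_comparison_test')
    show "summable (\<lambda>k. ln (real (cover_number TYPE('p) 1)) * (real (Suc k) / 2 ^ Suc k))"
      using s by (intro summable_mult) (auto simp: sums_iff)
    show "norm (?a k) \<le> ln (real (cover_number TYPE('p) 1)) * (real (Suc k) / 2 ^ Suc k)" if "0 \<le> k" for k
      using up[of k] pos[of "Suc k"] by (simp add: ln_ge_zero del: power_Suc)
  qed
  moreover have "(\<lambda>k. (real CARD('p) * ln 2) * (real (Suc k) / 2 ^ Suc k)) sums ((real CARD('p) * ln 2) * 2)"
    using s by (rule sums_mult)
  ultimately have "(real CARD('p) * ln 2) * 2 \<le> suminf ?a"
    using low suminf_le[of "\<lambda>k. (real CARD('p) * ln 2) * (real (Suc k) / 2 ^ Suc k)" ?a] by (simp only: sums_iff)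
  then show ?thesis unfolding entropy_Q_def by simp
qed

section \<open>The statistical model\<close>

lemma elog_leD: "elog x \<le> ereal c \<Longrightarrow> x \<le> ennreal (exp c)"
proof -
  assume a: "elog x \<le> ereal c"
  show ?thesis
  proof (cases x)
    case (real r)
    show ?thesis
    proof (cases "r = 0")
      case False
      then have "ln r \<le> c" using a real by (simp add: elog_def)
      then have "exp (ln r) \<le> exp c" by simp
      then show ?thesis using real False by (simp add: ennreal_leI)
    qed (use real in simp)
  qed (use a in \<open>simp add: elog_def\<close>)
qed

lemma elog_leI: "x \<le> ennreal (exp c) \<Longrightarrow> elog x \<le> ereal c"
proof -
  assume a: "x \<le> ennreal (exp c)"
  show ?thesis
  proof (cases x)
    case (real r)
    show ?thesis
    proof (cases "r = 0")
      case False
      then have r: "0 < r" "r \<le> exp c" using real a by auto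
      then have "ln r \<le> c" using ln_le_cancel_iff[of r "exp c"] by simp
      then show ?thesis using real r by (simp add: elog_def)
    qed (use real in \<open>simp add: elog_def\<close>)
  qed (use a in \<open>simp add: top_unique\<close>)
qed

lemma outer_mult: "outer g *v x = (x \<bullet> g) *\<^sub>R g"
  by (simp add: outer_def matrix_vector_mult_def vec_eq_iff inner_vec_def sum_distrib_right sum_distrib_left mult_ac)

lemma quad_outer: "quad (outer g) x = (x \<bullet> g)\<^sup>2"
  by (simp add: quad_def outer_mult power2_eq_square)

lemma bounded_linear_mult_vec: "bounded_linear (\<lambda>A :: real^'n^'m. A *v x)"
  by (rule linear_conv_bounded_linear[THEN iffD1], rule linearI)
     (simp_all add: matrix_vector_mult_add_rdistrib scaleR_matrix_vector_assoc)

lemma quad_scaleR: "quad (c *\<^sub>R A) x = c * quad A x" "quad A (c *\<^sub>R x) = c\<^sup>2 * quad A x"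
  by (simp_all add: quad_def scaleR_matrix_vector_assoc[symmetric] matrix_vector_mult_scaleR power2_eq_square)

lemma quad_minus: "quad A (- x) = quad A x"
  using quad_scaleR(2)[of A "-1" x] by simp

lemma quad_bound: "\<exists>C>0. \<forall>x. quad A x \<le> C * (norm x)\<^sup>2"
proof -
  obtain C where C: "0 < C" "\<And>x. norm (A *v x) \<le> C * norm x"
    using linear_bounded_pos[OF matrix_vector_mul_linear[of A]] by blast
  have "quad A x \<le> C * (norm x)\<^sup>2" for x
  proof -
    have "quad A x \<le> norm x * norm (A *v x)" unfolding quad_def by (rule norm_cauchy_schwarz)
    also have "\<dots> \<le> norm x * (C * norm x)" by (intro mult_left_mono C) auto
    finally show ?thesis by (simp add: power2_eq_square mult_ac)
  qed
  then show ?thesis using C(1) by blast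
qed

text \<open>The smoothness and moment assumptions under which the local arguments work.  The parameter set turns out to be open, since it
contains an ellipsoid around each of its points.\<close>

locale regular_model =
  fixes M :: "'w measure" and Y :: "nat \<Rightarrow> 'w \<Rightarrow> 'y" and n :: nat
    and P :: "'y measure" and \<Theta> :: "(real ^ 'p) set" and p :: "'y \<Rightarrow> real ^ 'p \<Rightarrow> real"
    and \<mu> :: "real ^ 'p \<Rightarrow> real" and \<theta>0 :: "real ^ 'p"
    and \<delta>bar \<nu>0 \<nu>1 \<epsilon> :: real
  assumes M: "prob_space M" and n: "n \<ge> 1"
    and indep: "prob_space.indep_vars M (\<lambda>_. P) Y {..<n}"
    and ident: "\<And>i. i < n \<Longrightarrow> distr M P (Y i) = P"
    and \<Theta>: "convex \<Theta>" "\<theta>0 \<in> \<Theta>"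
    and p [measurable]: "\<And>\<theta>. \<theta> \<in> \<Theta> \<Longrightarrow> (\<lambda>y. p y \<theta>) \<in> borel_measurable P"
    and int_exp: "\<And>\<theta>. \<theta> \<in> \<Theta> \<Longrightarrow> integrable P (\<lambda>y. exp (\<mu> \<theta> * loglik_diff p y \<theta> \<theta>0))"
    and diff_loglik: "\<And>y. y \<in> space P \<Longrightarrow> loglik p y differentiable_on \<Theta>"
    and diff_\<mu>: "\<mu> differentiable_on \<Theta>"
    and diff_zeta: "\<And>y. y \<in> space P \<Longrightarrow> zeta1 P p \<mu> \<theta>0 y differentiable_on \<Theta>"
    and int_outer: "\<And>\<theta>. \<theta> \<in> \<Theta> \<Longrightarrow> integrable P (\<lambda>y. outer (grad_zeta1 \<Theta> P p \<mu> \<theta>0 y \<theta>))"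
    and nondeg: "\<And>\<theta>. \<theta> \<in> \<Theta> \<Longrightarrow> invertible (vmat \<Theta> P p \<mu> \<theta>0 \<theta>)"
    and exp_moment: "\<And>\<delta>. \<bar>\<delta>\<bar> \<le> \<delta>bar \<Longrightarrow>
           (SUP \<theta>\<in>\<Theta>. SUP \<gamma>\<in>sphere 0 1. hfun \<Theta> P p \<mu> \<theta>0 \<delta> \<gamma> \<theta>) \<le> ereal (2 * \<nu>0\<^sup>2 * \<delta>\<^sup>2)"
    and \<epsilon>: "\<epsilon> > 0" and \<nu>1: "\<nu>1 \<ge> 1"
    and calB'_sub: "\<And>\<theta>. \<theta> \<in> \<Theta> \<Longrightarrow> calB' (\<lambda>\<theta>. real n *\<^sub>R vmat \<Theta> P p \<mu> \<theta>0 \<theta>) \<epsilon> \<theta> \<subseteq> \<Theta>"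
    and frakA_le: "\<And>\<theta>. \<theta> \<in> \<Theta> \<Longrightarrow> frakA n (vmat \<Theta> P p \<mu> \<theta>0) \<epsilon> \<theta> \<le> ereal \<nu>1"
begin

abbreviation v where "v \<equiv> vmat \<Theta> P p \<mu> \<theta>0"
abbreviation V where "V \<equiv> \<lambda>\<theta>. real n *\<^sub>R v \<theta>"
abbreviation grad where "grad \<equiv> grad_zeta1 \<Theta> P p \<mu> \<theta>0"
abbreviation zeta where "zeta \<equiv> zeta1 P p \<mu> \<theta>0"

lemma prob_P: "prob_space P"
proof -
  interpret prob_space M by (rule M)
  have "Y 0 \<in> measurable M P" using indep n by (auto simp: indep_vars_def)
  from prob_space_distr[OF this] show ?thesis using ident[of 0] n by simp
qed

lemma Y_measurable [measurable]: "i < n \<Longrightarrow> Y i \<in> measurable M P"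
  using indep M by (auto simp: prob_space.indep_vars_def)

lemma loglik_measurable [measurable]: "\<theta> \<in> \<Theta> \<Longrightarrow> (\<lambda>y. loglik p y \<theta>) \<in> borel_measurable P"
  unfolding loglik_def by measurable

lemma loglik_diff_measurable [measurable]: "\<theta> \<in> \<Theta> \<Longrightarrow> (\<lambda>y. loglik_diff p y \<theta> \<theta>0) \<in> borel_measurable P"
  unfolding loglik_diff_def using \<Theta> by measurable

lemma zeta_measurable [measurable]: "\<theta> \<in> \<Theta> \<Longrightarrow> (\<lambda>y. zeta y \<theta>) \<in> borel_measurable P"
  unfolding zeta1_def by measurable

lemma quad_v: 
  assumes \<theta>: "\<theta> \<in> \<Theta>"
  shows "integrable P (\<lambda>y. (x \<bullet> grad y \<theta>)\<^sup>2)" "quad (v \<theta>) x = (\<integral>y. (x \<bullet> grad y \<theta>)\<^sup>2 \<partial>P)"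
proof -
  have b: "bounded_linear (\<lambda>A :: real^'p^'p. quad A x)"
    unfolding quad_def by (rule bounded_linear_compose[OF bounded_linear_inner_right bounded_linear_mult_vec])
  from integrable_bounded_linear[OF b int_outer[OF \<theta>]]
  show "integrable P (\<lambda>y. (x \<bullet> grad y \<theta>)\<^sup>2)" by (simp add: quad_outer)
  from integral_bounded_linear[OF b int_outer[OF \<theta>]]
  show "quad (v \<theta>) x = (\<integral>y. (x \<bullet> grad y \<theta>)\<^sup>2 \<partial>P)" by (simp add: quad_outer vmat_def)
qed

lemma v_mult: 
  assumes \<theta>: "\<theta> \<in> \<Theta>"
  shows "integrable P (\<lambda>y. (x \<bullet> grad y \<theta>) *\<^sub>R grad y \<theta>)" "v \<theta> *v x = (\<integral>y. (x \<bullet> grad y \<theta>) *\<^sub>R grad y \<theta> \<partial>P)"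
proof -
  from integrable_bounded_linear[OF bounded_linear_mult_vec int_outer[OF \<theta>], of x]
  show "integrable P (\<lambda>y. (x \<bullet> grad y \<theta>) *\<^sub>R grad y \<theta>)" by (simp add: outer_mult)
  from integral_bounded_linear[OF bounded_linear_mult_vec int_outer[OF \<theta>], of x]
  show "v \<theta> *v x = (\<integral>y. (x \<bullet> grad y \<theta>) *\<^sub>R grad y \<theta> \<partial>P)" by (simp add: outer_mult vmat_def)
qed

lemma quad_v_nonneg: "\<theta> \<in> \<Theta> \<Longrightarrow> 0 \<le> quad (v \<theta>) x"
  unfolding quad_v(2) by (rule Bochner_Integration.integral_nonneg) simp

text \<open>A Gram matrix that annihilates the quadratic form of \<open>x\<close> annihilates \<open>x\<close> itself, since \<open>x \<bullet> grad\<close> vanishes almost surely.\<close>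

lemma quad_v_pos:
  assumes \<theta>: "\<theta> \<in> \<Theta>" and x: "x \<noteq> 0"
  shows "0 < quad (v \<theta>) x"
proof (rule ccontr)
  assume "\<not> 0 < quad (v \<theta>) x"
  then have "(\<integral>y. (x \<bullet> grad y \<theta>)\<^sup>2 \<partial>P) = 0" using quad_v_nonneg[OF \<theta>, of x] unfolding quad_v(2)[OF \<theta>] by simp
  then have ae: "AE y in P. (x \<bullet> grad y \<theta>)\<^sup>2 = 0"
    by (subst (asm) integral_nonneg_eq_0_iff_AE[OF quad_v(1)[OF \<theta>]]) auto
  have "v \<theta> *v x = (\<integral>y. 0 \<partial>P)"
    unfolding v_mult(2)[OF \<theta>]
    by (rule integral_cong_AE) (use v_mult(1)[OF \<theta>, of x] ae in \<open>auto elim!: eventually_mono\<close>)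
  then have "v \<theta> *v x = 0" by simp
  moreover obtain B where "B ** v \<theta> = mat 1" using nondeg[OF \<theta>] unfolding invertible_def by blast
  ultimately have "x = 0" by (metis matrix_vector_mul_assoc matrix_vector_mul_lid matrix_vector_mult_0_right)
  with x show False by simp
qed

lemma v_sym: "\<theta> \<in> \<Theta> \<Longrightarrow> x \<bullet> (v \<theta> *v y) = y \<bullet> (v \<theta> *v x)"
proof -
  assume \<theta>: "\<theta> \<in> \<Theta>"
  have "x \<bullet> (v \<theta> *v y) = (\<integral>z. (y \<bullet> grad z \<theta>) * (x \<bullet> grad z \<theta>) \<partial>P)" for x y
    unfolding v_mult(2)[OF \<theta>] by (subst integral_inner_right[symmetric]) (use v_mult(1)[OF \<theta>] in auto)
  then show ?thesis by (simp add: mult.commute)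
qed

lemma V_factor:
  assumes \<theta>: "\<theta> \<in> \<Theta>"
  shows "\<exists>A :: real^'p^'p. invertible A \<and> (\<forall>x. quad (V \<theta>) x = (norm (A *v x))\<^sup>2) \<and> det (V \<theta>) = (det A)\<^sup>2"
proof -
  have "x \<bullet> (V \<theta> *v y) = y \<bullet> (V \<theta> *v x)" for x y
    using v_sym[OF \<theta>, of x y] by (simp add: scaleR_matrix_vector_assoc[symmetric])
  moreover have "0 < x \<bullet> (V \<theta> *v x)" if "x \<noteq> 0" for x
    using quad_v_pos[OF \<theta> that] n unfolding quad_def by (simp add: scaleR_matrix_vector_assoc[symmetric])
  ultimately obtain A :: "real^'p^'p" where A: "invertible A" "V \<theta> = transpose A ** A" by (rule posdef_factorization)
  then show ?thesis by (intro exI[of _ A]) (simp add: A(2) quad_def quadratic_factor)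
qed

lemma open_\<Theta>: "open \<Theta>"
  unfolding open_contains_ball
proof
  fix \<theta> assume \<theta>: "\<theta> \<in> \<Theta>"
  obtain C where C: "0 < C" "\<And>x. quad (V \<theta>) x \<le> C * (norm x)\<^sup>2" using quad_bound[of "V \<theta>"] by blast
  have "ball \<theta> (\<epsilon> / sqrt C) \<subseteq> calB' V \<epsilon> \<theta>"
  proof
    fix x assume "x \<in> ball \<theta> (\<epsilon> / sqrt C)"
    then have "norm (x - \<theta>) \<le> \<epsilon> / sqrt C" by (simp add: dist_norm norm_minus_commute)
    then have "(norm (x - \<theta>))\<^sup>2 \<le> (\<epsilon> / sqrt C)\<^sup>2" by (intro power_mono) auto
    also have "\<dots> = \<epsilon>\<^sup>2 / C" using C by (simp add: power_divide)
    finally have "C * (norm (x - \<theta>))\<^sup>2 \<le> \<epsilon>\<^sup>2" using C by (simp add: field_simps)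
    then show "x \<in> calB' V \<epsilon> \<theta>" using C(2)[of "x - \<theta>"] by (simp add: calB'_def)
  qed
  then show "\<exists>e>0. ball \<theta> e \<subseteq> \<Theta>"
    using calB'_sub[OF \<theta>] C \<epsilon> by (intro exI[of _ "\<epsilon> / sqrt C"]) auto
qed

lemma grad_derivative:
  assumes y: "y \<in> space P" and \<theta>: "\<theta> \<in> \<Theta>"
  shows "(zeta y has_derivative (\<lambda>h. h \<bullet> grad y \<theta>)) (at \<theta>)"
proof -
  have at: "at \<theta> within \<Theta> = at \<theta>" using \<theta> open_\<Theta> by (rule at_within_open)
  obtain f' where f': "(zeta y has_derivative f') (at \<theta>)"
    using diff_zeta[OF y] \<theta> unfolding differentiable_on_def differentiable_def at[symmetric] by blast
  have lin: "linear f'" using f' by (rule has_derivative_linear)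
  define D where "D = (\<Sum>b\<in>Basis. f' b *\<^sub>R b)"
  have "f' = (\<lambda>h. h \<bullet> D)"
  proof
    fix h
    have "f' h = f' (\<Sum>b\<in>Basis. (h \<bullet> b) *\<^sub>R b)" by (simp add: euclidean_representation)
    also have "\<dots> = (\<Sum>b\<in>Basis. (h \<bullet> b) * f' b)" by (simp only: linear_sum[OF lin] linear_cmul[OF lin] real_scaleR_def)
    also have "\<dots> = h \<bullet> D" by (simp add: D_def inner_sum_right mult.commute)
    finally show "f' h = h \<bullet> D" .
  qed
  then have D: "(zeta y has_derivative (\<lambda>h. h \<bullet> D)) (at \<theta>)" using f' by simp
  have uniq: "D' = D" if "(zeta y has_derivative (\<lambda>h. h \<bullet> D')) (at \<theta>)" for D'
  proof -
    have "(\<lambda>h. h \<bullet> D') = (\<lambda>h. h \<bullet> D)" by (rule has_derivative_unique[OF that D])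
    then have "(D' - D) \<bullet> D' = (D' - D) \<bullet> D" by metis
    then have "(D' - D) \<bullet> (D' - D) = 0" by (simp add: inner_diff_right)
    then show ?thesis by simp
  qed
  have "grad y \<theta> = D" unfolding grad_zeta1_def grad_within_def at by (rule the_equality[where P="\<lambda>D'. (zeta y has_derivative (\<lambda>h. h \<bullet> D')) (at \<theta>)", OF D uniq])
  with D show ?thesis by simp
qed

text \<open>The assumption on \<open>hfun\<close> in homogeneous form: \<open>D\<close> is normalised to a unit direction, and \<open>\<delta>\<close> absorbs its length in the metric of
\<open>v \<theta>\<close>.\<close>

lemma directional_moment:
  assumes \<theta>: "\<theta> \<in> \<Theta>" and small: "\<bar>a\<bar> * sqrt (quad (v \<theta>) D) \<le> \<delta>bar"
  shows "(\<integral>\<^sup>+y. ennreal (exp (2 * a * (D \<bullet> grad y \<theta>))) \<partial>P) \<le> ennreal (exp (2 * \<nu>0\<^sup>2 * (a\<^sup>2 * quad (v \<theta>) D)))"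
proof (cases "D = 0")
  case True
  interpret prob_space P by (rule prob_P)
  have "quad (v \<theta>) D = 0" by (simp add: True quad_def)
  then show ?thesis by (simp add: True emeasure_space_1)
next
  case False
  define \<gamma> where "\<gamma> = (1 / norm D) *\<^sub>R D"
  define \<delta> where "\<delta> = a * sqrt (quad (v \<theta>) D)"
  have q: "0 < quad (v \<theta>) D" by (rule quad_v_pos[OF \<theta> False])
  have \<delta>: "\<bar>\<delta>\<bar> \<le> \<delta>bar" using small q by (simp add: \<delta>_def abs_mult)
  have "hfun \<Theta> P p \<mu> \<theta>0 \<delta> \<gamma> \<theta> \<le> (SUP \<theta>\<in>\<Theta>. SUP \<gamma>\<in>sphere 0 1. hfun \<Theta> P p \<mu> \<theta>0 \<delta> \<gamma> \<theta>)"
    using \<theta> False by (intro SUP_upper2[of \<theta>] SUP_upper) (auto simp: \<gamma>_def)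
  also have "\<dots> \<le> ereal (2 * \<nu>0\<^sup>2 * \<delta>\<^sup>2)" by (rule exp_moment[OF \<delta>])
  finally have h: "(\<integral>\<^sup>+ y. ennreal (exp (2 * \<delta> * ((\<gamma> \<bullet> grad y \<theta>) / sqrt (quad (v \<theta>) \<gamma>)))) \<partial>P) \<le> ennreal (exp (2 * \<nu>0\<^sup>2 * \<delta>\<^sup>2))"
    unfolding hfun_def by (rule elog_leD)
  have "sqrt (quad (v \<theta>) \<gamma>) = sqrt (quad (v \<theta>) D) / norm D"
    unfolding \<gamma>_def quad_scaleR by (simp add: real_sqrt_mult real_sqrt_divide power_divide)
  then have "2 * \<delta> * ((\<gamma> \<bullet> grad y \<theta>) / sqrt (quad (v \<theta>) \<gamma>)) = 2 * a * (D \<bullet> grad y \<theta>)" for y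
    using False q by (simp add: \<delta>_def \<gamma>_def)
  moreover have "\<delta>\<^sup>2 = a\<^sup>2 * quad (v \<theta>) D" using q by (simp add: \<delta>_def power_mult_distrib)
  ultimately show ?thesis using h by simp
qed

lemma v_comparable:
  assumes \<theta>c: "\<theta>c \<in> \<Theta>" and \<theta>: "\<theta> \<in> calB' V \<epsilon> \<theta>c" and \<theta>': "\<theta>' \<in> calB' V \<epsilon> \<theta>c"
  shows "quad (v \<theta>) x \<le> \<nu>1 * quad (v \<theta>') x"
proof (cases "x = 0")
  case True
  then show ?thesis by (simp add: quad_def)
next
  case False
  define \<gamma> where "\<gamma> = (1 / norm x) *\<^sub>R x"
  have g: "\<gamma> \<in> sphere 0 1" "\<gamma> \<noteq> 0" using False by (auto simp: \<gamma>_def)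
  have \<theta>'\<Theta>: "\<theta>' \<in> \<Theta>" using calB'_sub[OF \<theta>c] \<theta>' by blast
  have "ereal (quad (v \<theta>) \<gamma> / quad (v \<theta>') \<gamma>) \<le> frakA n v \<epsilon> \<theta>c"
    unfolding frakA_def Let_def using \<theta> \<theta>' g by (intro SUP_upper2[of \<theta>] SUP_upper2[of \<theta>'] SUP_upper) auto
  then have "ereal (quad (v \<theta>) \<gamma> / quad (v \<theta>') \<gamma>) \<le> ereal \<nu>1" using frakA_le[OF \<theta>c] by (rule order_trans)
  then have "quad (v \<theta>) \<gamma> \<le> \<nu>1 * quad (v \<theta>') \<gamma>" using quad_v_pos[OF \<theta>'\<Theta> g(2)] by (simp add: field_simps)
  then show ?thesis using False unfolding \<gamma>_def quad_scaleR by (simp add: field_simps)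
qed

text \<open>The ellipsoid around a centre on which the process is controlled.  The factor \<open>\<nu>1\<close> allows for the change of the metric: it makes the
ellipsoid part of \<open>calB\<close>, where the metric is taken along the whole segment (\<open>ell_calB\<close>).\<close>

definition ell :: "real^'p \<Rightarrow> (real^'p) set" where
  "ell \<theta>c = {\<theta>. quad (V \<theta>c) (\<theta> - \<theta>c) \<le> \<epsilon>\<^sup>2 / \<nu>1}"

lemma ell_calB': "ell \<theta>c \<subseteq> calB' V \<epsilon> \<theta>c"
proof -
  have "\<epsilon>\<^sup>2 / \<nu>1 \<le> \<epsilon>\<^sup>2" using \<nu>1 mult_right_mono[OF \<nu>1, of "\<epsilon>\<^sup>2"] by (simp add: field_simps)
  then show ?thesis by (auto simp: ell_def calB'_def)
qed

lemma centre_calB': "\<theta>c \<in> calB' V \<epsilon> \<theta>c"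
  by (simp add: calB'_def quad_def)

lemma ell_\<Theta>: "\<theta>c \<in> \<Theta> \<Longrightarrow> ell \<theta>c \<subseteq> \<Theta>"
  using ell_calB' calB'_sub by blast

lemma convex_ell:
  assumes \<theta>c: "\<theta>c \<in> \<Theta>" shows "convex (ell \<theta>c)"
proof -
  obtain A :: "real^'p^'p" where A: "invertible A" "\<And>x. quad (V \<theta>c) x = (norm (A *v x))\<^sup>2" "det (V \<theta>c) = (det A)\<^sup>2" using V_factor[OF \<theta>c] by blast
  have "ell \<theta>c = (\<lambda>\<theta>. A *v (\<theta> - \<theta>c)) -` cball 0 (\<epsilon> / sqrt \<nu>1)"
  proof -
    have sq: "(norm z)\<^sup>2 \<le> \<epsilon>\<^sup>2 / \<nu>1 \<longleftrightarrow> norm z \<le> \<epsilon> / sqrt \<nu>1" for z :: "real^'p"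
    proof -
      have "\<epsilon>\<^sup>2 / \<nu>1 = (\<epsilon> / sqrt \<nu>1)\<^sup>2" using \<nu>1 by (simp add: power_divide)
      then show ?thesis using \<epsilon> \<nu>1 by (simp add: power2_le_iff_abs_le)
    qed
    show ?thesis unfolding ell_def A(2) sq by (simp add: vimage_def)
  qed
  also have "\<dots> = (+) \<theta>c ` ((*v) A -` cball 0 (\<epsilon> / sqrt \<nu>1))"
  proof (intro set_eqI iffI)
    fix x assume "x \<in> (\<lambda>\<theta>. A *v (\<theta> - \<theta>c)) -` cball 0 (\<epsilon> / sqrt \<nu>1)"
    then show "x \<in> (+) \<theta>c ` ((*v) A -` cball 0 (\<epsilon> / sqrt \<nu>1))" by (intro image_eqI[of _ _ "x - \<theta>c"]) auto
  qed auto
  also have "convex \<dots>" by (intro convex_translation convex_linear_vimage matrix_vector_mul_linear) auto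
  finally show ?thesis .
qed

lemma ell_calB:
  assumes \<theta>c: "\<theta>c \<in> \<Theta>" shows "ell \<theta>c \<subseteq> calB \<Theta> V \<epsilon> \<theta>c"
proof
  fix \<theta> assume \<theta>: "\<theta> \<in> ell \<theta>c"
  have cc: "\<theta>c \<in> ell \<theta>c" using \<epsilon> \<nu>1 by (simp add: ell_def quad_def)
  have "quad (V ((1 - t) *\<^sub>R \<theta>c + t *\<^sub>R \<theta>)) (\<theta> - \<theta>c) \<le> \<epsilon>\<^sup>2" if "t \<in> {0..1}" for t
  proof -
    have "(1 - t) *\<^sub>R \<theta>c + t *\<^sub>R \<theta> \<in> ell \<theta>c" using that cc \<theta> by (intro convexD[OF convex_ell[OF \<theta>c]]) auto
    then have "quad (v ((1 - t) *\<^sub>R \<theta>c + t *\<^sub>R \<theta>)) (\<theta> - \<theta>c) \<le> \<nu>1 * quad (v \<theta>c) (\<theta> - \<theta>c)"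
      using ell_calB' centre_calB' by (intro v_comparable[OF \<theta>c]) auto
    then have "real n * quad (v ((1 - t) *\<^sub>R \<theta>c + t *\<^sub>R \<theta>)) (\<theta> - \<theta>c) \<le> real n * (\<nu>1 * quad (v \<theta>c) (\<theta> - \<theta>c))" by (intro mult_left_mono) auto
    also have "\<dots> = \<nu>1 * quad (V \<theta>c) (\<theta> - \<theta>c)" by (simp add: quad_scaleR)
    also have "\<dots> \<le> \<nu>1 * (\<epsilon>\<^sup>2 / \<nu>1)" using \<theta> \<nu>1 by (intro mult_left_mono) (auto simp: ell_def)
    finally show ?thesis using \<nu>1 by (simp add: quad_scaleR)
  qed
  then show "\<theta> \<in> calB \<Theta> V \<epsilon> \<theta>c"
    using ell_\<Theta>[OF \<theta>c] \<theta> unfolding calB_def frakS2_def by (auto intro!: SUP_least)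
qed

definition zeta_sum :: "'w \<Rightarrow> real^'p \<Rightarrow> real" where "zeta_sum w \<theta> = (\<Sum>i<n. zeta (Y i w) \<theta>)"

text \<open>Along the segment from \<open>\<theta>'\<close> to \<open>\<theta>\<close> the metric \<open>v\<close> changes at most by the factor \<open>\<nu>1\<close>, so \<open>\<theta> - \<theta>'\<close> has length at most \<open>\<epsilon> d\<close> in the metric \<open>V\<close>
at each point of the segment.  The bound for one observation is raised to the power \<open>n\<close>.\<close>

lemma zeta_sum_increment_moment:
  assumes \<theta>c: "\<theta>c \<in> \<Theta>" and \<theta>: "\<theta> \<in> ell \<theta>c" and \<theta>': "\<theta>' \<in> ell \<theta>c"
    and d: "0 < d" "quad (V \<theta>c) (\<theta> - \<theta>') \<le> \<epsilon>\<^sup>2 / \<nu>1 * d\<^sup>2"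
    and l: "0 \<le> l" "\<epsilon> * l \<le> sqrt (real n) * \<delta>bar"
  shows "(\<integral>\<^sup>+w. ennreal (exp (2 * (l * zeta_sum w \<theta> - l * zeta_sum w \<theta>') / d)) \<partial>M) \<le> ennreal (exp (2 * \<nu>0\<^sup>2 * l\<^sup>2 * \<epsilon>\<^sup>2))"
proof -
  define D where "D = \<theta> - \<theta>'"
  define pt where "pt s = \<theta>' + s *\<^sub>R D" for s
  have pt: "pt s \<in> ell \<theta>c" if "s \<in> {0..1}" for s
  proof -
    have "pt s = (1 - s) *\<^sub>R \<theta>' + s *\<^sub>R \<theta>" by (simp add: pt_def D_def algebra_simps)
    then show ?thesis using that \<theta> \<theta>' by (simp add: convexD[OF convex_ell[OF \<theta>c]])
  qed
  have pt\<Theta>: "pt s \<in> \<Theta>" if "s \<in> {0..1}" for s using pt[OF that] ell_\<Theta>[OF \<theta>c] by blast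
  have n0: "0 < real n" using n by simp
  have qD: "quad (v (pt s)) D \<le> \<epsilon>\<^sup>2 * d\<^sup>2 / real n" if s: "s \<in> {0..1}" for s
  proof -
    have "quad (v (pt s)) D \<le> \<nu>1 * quad (v \<theta>c) D"
      using pt[OF s] ell_calB' centre_calB' by (intro v_comparable[OF \<theta>c]) auto
    also have "\<dots> = \<nu>1 * quad (V \<theta>c) D / real n" using n0 by (simp add: quad_scaleR)
    also have "\<dots> \<le> \<nu>1 * (\<epsilon>\<^sup>2 / \<nu>1 * d\<^sup>2) / real n" using d(2) \<nu>1 by (intro divide_right_mono mult_left_mono) (auto simp: D_def)
    finally show ?thesis using \<nu>1 by simp
  qed
  define K where "K = exp (2 * \<nu>0\<^sup>2 * l\<^sup>2 * \<epsilon>\<^sup>2 / real n)"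
  have mom: "(\<integral>\<^sup>+y. ennreal (exp (2 * a * (D \<bullet> grad y (pt s)))) \<partial>P) \<le> ennreal K" if s: "s \<in> {0..1}" and a: "\<bar>a\<bar> = l / d" for a s
  proof -
    have q0: "0 \<le> quad (v (pt s)) D" by (rule quad_v_nonneg[OF pt\<Theta>[OF s]])
    have "sqrt (quad (v (pt s)) D) \<le> sqrt (\<epsilon>\<^sup>2 * d\<^sup>2 / real n)" using qD[OF s] by simp
    also have "\<dots> = \<epsilon> * d / sqrt (real n)" using \<epsilon> d by (simp add: real_sqrt_mult real_sqrt_divide)
    finally have "\<bar>a\<bar> * sqrt (quad (v (pt s)) D) \<le> \<bar>a\<bar> * (\<epsilon> * d / sqrt (real n))" by (intro mult_left_mono) auto
    also have "\<dots> = \<epsilon> * l / sqrt (real n)" using d(1) by (simp add: a)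
    also have "\<dots> \<le> \<delta>bar" using l(2) n0 by (simp add: field_simps)
    finally have "(\<integral>\<^sup>+y. ennreal (exp (2 * a * (D \<bullet> grad y (pt s)))) \<partial>P) \<le> ennreal (exp (2 * \<nu>0\<^sup>2 * (a\<^sup>2 * quad (v (pt s)) D)))"
      by (rule directional_moment[OF pt\<Theta>[OF s]])
    also have "\<dots> \<le> ennreal K"
      unfolding K_def
    proof (intro ennreal_leI, unfold exp_le_cancel_iff)
      have "a\<^sup>2 * quad (v (pt s)) D \<le> a\<^sup>2 * (\<epsilon>\<^sup>2 * d\<^sup>2 / real n)" by (intro mult_left_mono qD s) auto
      also have "\<dots> = l\<^sup>2 * \<epsilon>\<^sup>2 / real n"
      proof -
        have "a\<^sup>2 = (l / d)\<^sup>2" unfolding a[symmetric] by simp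
        then show ?thesis using d(1) by (simp add: power_divide)
      qed
      finally have "2 * \<nu>0\<^sup>2 * (a\<^sup>2 * quad (v (pt s)) D) \<le> 2 * \<nu>0\<^sup>2 * (l\<^sup>2 * \<epsilon>\<^sup>2 / real n)" by (intro mult_left_mono) auto
      then show "2 * \<nu>0\<^sup>2 * (a\<^sup>2 * quad (v (pt s)) D) \<le> 2 * \<nu>0\<^sup>2 * l\<^sup>2 * \<epsilon>\<^sup>2 / real n" by (simp add: mult.assoc)
    qed
    finally show ?thesis .
  qed
  let ?f = "\<lambda>y s. 2 * (l / d) * zeta y (pt s)"
  have one: "(\<integral>\<^sup>+y. ennreal (exp (?f y 1 - ?f y 0)) \<partial>P) \<le> ennreal K"
  proof (rule increment_exponential_moment[OF prob_P, where f'="\<lambda>y s. 2 * (l / d) * (D \<bullet> grad y (pt s))"])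
    show "(\<lambda>y. ?f y s) \<in> borel_measurable P" if "s \<in> {0..1}" for s using pt\<Theta>[OF that] by measurable
    show "(?f y has_vector_derivative 2 * (l / d) * (D \<bullet> grad y (pt s))) (at s within {0..1})" if y: "y \<in> space P" and s: "s \<in> {0..1}" for y s
    proof -
      have "(pt has_derivative (\<lambda>h. h *\<^sub>R D)) (at s within {0..1})" unfolding pt_def by (auto intro!: derivative_eq_intros)
      from has_derivative_compose[OF this grad_derivative[OF y pt\<Theta>[OF s]]]
      have "((\<lambda>s. zeta y (pt s)) has_derivative (\<lambda>h. (h *\<^sub>R D) \<bullet> grad y (pt s))) (at s within {0..1})" .
      from has_derivative_mult_right[OF this, of "2 * (l / d)"]
      show ?thesis unfolding has_vector_derivative_def by (rule has_derivative_eq_rhs) (simp add: fun_eq_iff mult_ac)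
    qed
    show "(\<integral>\<^sup>+y. ennreal (exp (2 * (l / d) * (D \<bullet> grad y (pt s)))) \<partial>P) \<le> ennreal K" if "s \<in> {0..1}" for s
      using mom[OF that, of "l / d"] l d by simp
    show "(\<integral>\<^sup>+y. ennreal (exp (- (2 * (l / d) * (D \<bullet> grad y (pt s))))) \<partial>P) \<le> ennreal K" if "s \<in> {0..1}" for s
      using mom[OF that, of "- (l / d)"] l d by simp
  qed
  have "(\<integral>\<^sup>+w. ennreal (exp (2 * (l * zeta_sum w \<theta> - l * zeta_sum w \<theta>') / d)) \<partial>M) = (\<integral>\<^sup>+w. ennreal (exp (\<Sum>i<n. ?f (Y i w) 1 - ?f (Y i w) 0)) \<partial>M)"
    by (intro nn_integral_cong arg_cong[where f=ennreal] arg_cong[where f=exp])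
       (simp add: zeta_sum_def pt_def D_def sum_subtractf sum_distrib_left sum_divide_distrib diff_divide_distrib right_diff_distrib mult_ac)
  also have "\<dots> = (\<integral>\<^sup>+y. ennreal (exp (?f y 1 - ?f y 0)) \<partial>P) ^ n"
    using pt\<Theta>[of 0] pt\<Theta>[of 1] by (intro iid_product_moment[OF M indep ident]) auto
  also have "\<dots> \<le> ennreal K ^ n" by (intro power_mono one) auto
  also have "\<dots> = ennreal (exp (2 * \<nu>0\<^sup>2 * l\<^sup>2 * \<epsilon>\<^sup>2))"
    using n0 by (simp add: K_def ennreal_power exp_of_nat_mult[symmetric])
  finally show ?thesis .
qed

end

section \<open>From ellipsoids to the parameter set\<close>

lemma ennreal_sum_mult: "(\<And>i. i \<in> A \<Longrightarrow> 0 \<le> f i) \<Longrightarrow> ennreal (\<Sum>i\<in>A. f i) * X = (\<Sum>i\<in>A. ennreal (f i) * X)"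
  by (simp add: sum_distrib_right[symmetric] sum_ennreal)

context regular_model
begin

abbreviation rate where "rate \<equiv> rate_m P p \<mu> \<theta>0"

text \<open>The normalisation by the rate function makes the exponential moment equal to one (\<open>stat_normalized\<close>).\<close>

definition stat :: "'w \<Rightarrow> real^'p \<Rightarrow> real" where
  "stat w \<theta> = \<mu> \<theta> * Lik_diff p Y n w \<theta> \<theta>0 + real n * rate \<theta>"

lemma Lik_diff_sum: "Lik_diff p Y n w \<theta> \<theta>0 = (\<Sum>i<n. loglik_diff p (Y i w) \<theta> \<theta>0)"
  by (simp add: Lik_diff_def Lik_def loglik_diff_def sum_subtractf)

lemma stat_zeta_sum: "stat w \<theta> = zeta_sum w \<theta> + (real n * \<mu> \<theta> * (\<integral>z. loglik_diff p z \<theta> \<theta>0 \<partial>P) + real n * rate \<theta>)"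
  by (simp add: stat_def zeta_sum_def zeta1_def Lik_diff_sum sum_distrib_left[symmetric] sum_subtractf algebra_simps)

lemma Lik_diff_measurable [measurable]: "\<theta> \<in> \<Theta> \<Longrightarrow> (\<lambda>w. Lik_diff p Y n w \<theta> \<theta>0) \<in> borel_measurable M"
  unfolding Lik_diff_sum by (intro borel_measurable_sum measurable_compose[OF Y_measurable loglik_diff_measurable]) auto

lemma stat_measurable [measurable]: "\<theta> \<in> \<Theta> \<Longrightarrow> (\<lambda>w. stat w \<theta>) \<in> borel_measurable M"
  unfolding stat_def by measurable

lemma zeta_sum_measurable [measurable]: "\<theta> \<in> \<Theta> \<Longrightarrow> (\<lambda>w. zeta_sum w \<theta>) \<in> borel_measurable M"
  unfolding zeta_sum_def by (intro borel_measurable_sum measurable_compose[OF Y_measurable zeta_measurable]) auto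

lemma stat_normalized:
  assumes \<theta>: "\<theta> \<in> \<Theta>"
  shows "(\<integral>\<^sup>+w. ennreal (exp (stat w \<theta>)) \<partial>M) = 1"
proof -
  interpret P: prob_space P by (rule prob_P)
  define E where "E = (\<integral>y. exp (\<mu> \<theta> * loglik_diff p y \<theta> \<theta>0) \<partial>P)"
  have E: "0 < E"
  proof -
    have "(\<integral>y. 0 \<partial>P) < E" unfolding E_def
      by (rule P.integral_less_AE_space[OF _ int_exp[OF \<theta>]]) (auto simp: P.emeasure_space_1)
    then show ?thesis by simp
  qed
  have "(\<integral>\<^sup>+w. ennreal (exp (stat w \<theta>)) \<partial>M) = (\<integral>\<^sup>+w. ennreal (exp (real n * rate \<theta>)) * ennreal (exp (\<Sum>i<n. \<mu> \<theta> * loglik_diff p (Y i w) \<theta> \<theta>0)) \<partial>M)"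
    by (intro nn_integral_cong) (simp add: stat_def Lik_diff_sum sum_distrib_left[symmetric] ennreal_mult[symmetric] exp_add[symmetric] add.commute)
  also have "\<dots> = ennreal (exp (real n * rate \<theta>)) * (\<integral>\<^sup>+w. ennreal (exp (\<Sum>i<n. \<mu> \<theta> * loglik_diff p (Y i w) \<theta> \<theta>0)) \<partial>M)"
    using \<theta> by (intro nn_integral_cmult measurable_compose[OF _ measurable_ennreal] borel_measurable_exp borel_measurable_sum borel_measurable_times measurable_compose[OF Y_measurable loglik_diff_measurable]) auto
  also have "(\<integral>\<^sup>+w. ennreal (exp (\<Sum>i<n. \<mu> \<theta> * loglik_diff p (Y i w) \<theta> \<theta>0)) \<partial>M) = (\<integral>\<^sup>+y. ennreal (exp (\<mu> \<theta> * loglik_diff p y \<theta> \<theta>0)) \<partial>P) ^ n"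
    using \<theta> by (intro iid_product_moment[OF M indep ident]) measurable
  also have "(\<integral>\<^sup>+y. ennreal (exp (\<mu> \<theta> * loglik_diff p y \<theta> \<theta>0)) \<partial>P) = ennreal E"
    unfolding E_def by (intro nn_integral_eq_integral int_exp \<theta>) auto
  also have "ennreal (exp (real n * rate \<theta>)) * ennreal E ^ n = 1"
  proof -
    have "rate \<theta> = - ln E" by (simp add: rate_m_def E_def)
    then have "exp (real n * rate \<theta>) = (1 / E) ^ n" using E by (simp add: exp_of_nat_mult exp_minus inverse_eq_divide power_one_over)
    then show ?thesis using E by (simp add: ennreal_power ennreal_mult[symmetric] power_one_over)
  qed
  finally show ?thesis .
qed

lemma zeta_sum_continuous: "w \<in> space M \<Longrightarrow> continuous_on \<Theta> (zeta_sum w)"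
  unfolding zeta_sum_def[abs_def]
  by (intro continuous_on_sum differentiable_imp_continuous_on diff_zeta) (auto intro: measurable_space[OF Y_measurable])

text \<open>An affine map carries the unit ball onto the ellipsoid.  The process is extended to the whole space by first projecting to
the unit ball, which does not increase distances.\<close>

lemma local_bound:
  assumes \<theta>c: "\<theta>c \<in> \<Theta>" and T: "finite T" "T \<subseteq> ell \<theta>c" and \<rho>: "0 \<le> \<rho>" "\<rho> < 1" and small: "\<epsilon> * \<rho> / (1 - \<rho>) \<le> sqrt (real n) * \<delta>bar"
  shows "(\<integral>\<^sup>+w. (SUP \<theta>\<in>T. ennreal (exp (\<rho> * stat w \<theta>))) \<partial>M) 
    \<le> ennreal (exp ((1 - \<rho>) * (2 * real CARD('p) * ln 2) + 2 * \<nu>0\<^sup>2 * \<epsilon>\<^sup>2 * \<rho>\<^sup>2 / (1 - \<rho>)))"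
proof (cases "\<rho> = 0")
  case True
  interpret prob_space M by (rule M)
  have "(\<integral>\<^sup>+w. (SUP \<theta>\<in>T. ennreal (exp (\<rho> * stat w \<theta>))) \<partial>M) \<le> (\<integral>\<^sup>+w. 1 \<partial>M)"
    by (intro nn_integral_mono SUP_least) (simp add: True)
  also have "\<dots> = ennreal 1" by (simp add: emeasure_space_1)
  also have "\<dots> \<le> ennreal (exp ((1 - \<rho>) * (2 * real CARD('p) * ln 2) + 2 * \<nu>0\<^sup>2 * \<epsilon>\<^sup>2 * \<rho>\<^sup>2 / (1 - \<rho>)))"
    by (intro ennreal_leI) (simp add: True)
  finally show ?thesis .
next
  case False
  then have \<rho>0: "0 < \<rho>" using \<rho> by simp
  define l where "l = \<rho> / (1 - \<rho>)"
  have l: "0 \<le> l" "\<epsilon> * l \<le> sqrt (real n) * \<delta>bar" using \<rho> small by (simp_all add: l_def)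
  define r where "r = \<epsilon> / sqrt \<nu>1"
  have r: "0 < r" "r\<^sup>2 = \<epsilon>\<^sup>2 / \<nu>1" using \<epsilon> \<nu>1 by (simp_all add: r_def power_divide)
  obtain A :: "real^'p^'p" where A: "invertible A" "\<And>x. quad (V \<theta>c) x = (norm (A *v x))\<^sup>2" "det (V \<theta>c) = (det A)\<^sup>2" using V_factor[OF \<theta>c] by blast
  obtain B :: "real^'p^'p" where AB: "A ** B = mat 1" "B ** A = mat 1" using A(1) unfolding invertible_def by blast
  have B: "A *v (B *v x) = x" "B *v (A *v x) = x" for x by (simp_all add: matrix_vector_mul_assoc AB)
  define cp where "cp = closest_point (cball (0::real^'p) 1)"
  have cp: "norm (cp x) \<le> 1" for x using closest_point_in_set[of "cball (0::real^'p) 1" x] by (simp add: cp_def)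
  have cp_id: "cp x = x" if "norm x \<le> 1" for x using that by (simp add: cp_def closest_point_self)
  have cp_dist: "dist (cp x) (cp y) \<le> dist x y" for x y unfolding cp_def by (intro closest_point_lipschitz) auto
  define \<phi> where "\<phi> x = \<theta>c + r *\<^sub>R (B *v cp x)" for x
  define u where "u \<theta> = (1 / r) *\<^sub>R (A *v (\<theta> - \<theta>c))" for \<theta>
  have \<phi>_ell: "\<phi> x \<in> ell \<theta>c" for x
  proof -
    have "quad (V \<theta>c) (\<phi> x - \<theta>c) = (r * norm (cp x))\<^sup>2" using r by (simp add: A(2) \<phi>_def matrix_vector_mult_scaleR B)
    also have "\<dots> \<le> r\<^sup>2" using r cp[of x] by (intro power_mono) (auto simp: mult_left_le)
    finally show ?thesis unfolding ell_def r(2) by simp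
  qed
  have \<phi>_diff: "quad (V \<theta>c) (\<phi> x - \<phi> y) \<le> \<epsilon>\<^sup>2 / \<nu>1 * d\<^sup>2" if "dist x y \<le> d" for x y d
  proof -
    have "\<phi> x - \<phi> y = r *\<^sub>R (B *v (cp x - cp y))" by (simp add: \<phi>_def matrix_vector_mult_diff_distrib scaleR_diff_right)
    then have "quad (V \<theta>c) (\<phi> x - \<phi> y) = r\<^sup>2 * (dist (cp x) (cp y))\<^sup>2"
      using r by (simp add: A(2) matrix_vector_mult_scaleR B dist_norm power_mult_distrib)
    also have "\<dots> \<le> r\<^sup>2 * d\<^sup>2" using cp_dist[of x y] that by (intro mult_left_mono power_mono) auto
    finally show ?thesis unfolding r(2) .
  qed
  have u1: "norm (u \<theta>) \<le> 1" if "\<theta> \<in> T" for \<theta>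
  proof -
    have "(norm (A *v (\<theta> - \<theta>c)))\<^sup>2 \<le> r\<^sup>2" using that T(2) by (auto simp: ell_def A(2) r(2))
    then have "norm (A *v (\<theta> - \<theta>c)) \<le> r" by (rule power2_le_imp_le) (use r in simp)
    then show ?thesis using r by (simp add: u_def)
  qed
  have \<phi>u: "\<phi> (u \<theta>) = \<theta>" if "\<theta> \<in> T" for \<theta>
    using r by (simp add: \<phi>_def cp_id[OF u1[OF that]]) (simp add: u_def matrix_vector_mult_scaleR B)
  define H where "H x w = l * zeta_sum w (\<phi> x)" for x w
  define c where "c \<theta> = real n * \<mu> \<theta> * (\<integral>z. loglik_diff p z \<theta> \<theta>0 \<partial>P) + real n * rate \<theta>" for \<theta>
  have \<phi>\<Theta>: "\<phi> x \<in> \<Theta>" for x using \<phi>_ell ell_\<Theta>[OF \<theta>c] by blast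
  have \<phi>cont: "continuous_on UNIV \<phi>"
    unfolding \<phi>_def cp_def
    by (intro continuous_intros continuous_on_closest_point linear_continuous_on_compose[OF _ matrix_vector_mul_linear]) auto
  have Z: "(1 - \<rho>) / \<rho> * H (u \<theta>) w + c \<theta> = stat w \<theta>" if "\<theta> \<in> T" for \<theta> w
    using \<rho>0 \<rho>(2) by (simp add: H_def l_def \<phi>u[OF that] stat_zeta_sum c_def)
  have "(\<integral>\<^sup>+w. (SUP \<theta>\<in>T. ennreal (exp (\<rho> * ((1 - \<rho>) / \<rho> * H (u \<theta>) w + c \<theta>)))) \<partial>M)
     \<le> ennreal (exp ((1 - \<rho>) * (2 * real DIM(real^'p) * ln 2 + 2 * \<nu>0\<^sup>2 * l\<^sup>2 * \<epsilon>\<^sup>2)))"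
  proof (rule local_maximal_inequality[OF T(1) \<rho>0 \<rho>(2) u1 M])
    show "continuous_on UNIV (\<lambda>x. H x w)" if "w \<in> space M" for w
      unfolding H_def using \<phi>\<Theta> by (intro continuous_intros continuous_on_compose2[OF zeta_sum_continuous[OF that] \<phi>cont]) auto
    show "H x \<in> borel_measurable M" for x unfolding H_def[abs_def] using \<phi>\<Theta> by measurable
    show "(\<integral>\<^sup>+w. ennreal (exp (2 * (H x w - H y w) / d)) \<partial>M) \<le> ennreal (exp (2 * \<nu>0\<^sup>2 * l\<^sup>2 * \<epsilon>\<^sup>2))" if "0 < d" "dist x y \<le> d" for x y d
      unfolding H_def by (rule zeta_sum_increment_moment[OF \<theta>c \<phi>_ell \<phi>_ell that(1) \<phi>_diff[OF that(2)] l])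
    show "(\<integral>\<^sup>+w. ennreal (exp ((1 - \<rho>) / \<rho> * H (u \<theta>) w + c \<theta>)) \<partial>M) \<le> 1" if "\<theta> \<in> T" for \<theta>
      unfolding Z[OF that] using T(2) that ell_\<Theta>[OF \<theta>c] stat_normalized[of \<theta>] by auto
  qed auto
  also have "(\<integral>\<^sup>+w. (SUP \<theta>\<in>T. ennreal (exp (\<rho> * ((1 - \<rho>) / \<rho> * H (u \<theta>) w + c \<theta>)))) \<partial>M) = (\<integral>\<^sup>+w. (SUP \<theta>\<in>T. ennreal (exp (\<rho> * stat w \<theta>))) \<partial>M)"
    by (intro nn_integral_cong SUP_cong refl) (simp only: Z)
  also have "(1 - \<rho>) * (2 * real DIM(real^'p) * ln 2 + 2 * \<nu>0\<^sup>2 * l\<^sup>2 * \<epsilon>\<^sup>2) = (1 - \<rho>) * (2 * real CARD('p) * ln 2) + 2 * \<nu>0\<^sup>2 * \<epsilon>\<^sup>2 * \<rho>\<^sup>2 / (1 - \<rho>)"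
    using \<rho> by (simp add: l_def power_divide distrib_left power2_eq_square[of "1 - \<rho>"])
  finally show ?thesis .
qed

text \<open>A set of centres whose ellipsoids \<open>ell\<close> all contain \<open>\<theta>\<close>; it is an ellipsoid in the metric at \<open>\<theta>\<close>, so its volume is explicit.\<close>

definition inner_ell :: "real^'p \<Rightarrow> (real^'p) set" where
  "inner_ell \<theta> = {x. quad (V \<theta>) (x - \<theta>) \<le> (\<epsilon> / \<nu>1)\<^sup>2}"

lemma inner_ell_calB': "inner_ell \<theta> \<subseteq> calB' V \<epsilon> \<theta>"
proof -
  have "\<epsilon> / \<nu>1 \<le> \<epsilon>" using \<nu>1 \<epsilon> by (simp add: field_simps)
  then have "(\<epsilon> / \<nu>1)\<^sup>2 \<le> \<epsilon>\<^sup>2" using \<nu>1 \<epsilon> by (intro power_mono) auto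
  then show ?thesis by (auto simp: inner_ell_def calB'_def)
qed

lemma inner_ell_swap:
  assumes \<theta>: "\<theta> \<in> \<Theta>" and x: "x \<in> inner_ell \<theta>"
  shows "\<theta> \<in> ell x" "sqrt (det (V \<theta>)) \<le> sqrt \<nu>1 ^ CARD('p) * sqrt (det (V x))"
proof -
  have xB: "x \<in> calB' V \<epsilon> \<theta>" using x inner_ell_calB' by blast
  have x\<Theta>: "x \<in> \<Theta>" using xB calB'_sub[OF \<theta>] by blast
  have "quad (V x) (\<theta> - x) = real n * quad (v x) (x - \<theta>)" using quad_minus[of "v x" "x - \<theta>"] by (simp add: quad_scaleR)
  also have "\<dots> \<le> real n * (\<nu>1 * quad (v \<theta>) (x - \<theta>))" by (intro mult_left_mono v_comparable[OF \<theta> xB centre_calB']) auto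
  also have "\<dots> = \<nu>1 * quad (V \<theta>) (x - \<theta>)" by (simp add: quad_scaleR)
  also have "\<dots> \<le> \<nu>1 * (\<epsilon> / \<nu>1)\<^sup>2" using x \<nu>1 by (intro mult_left_mono) (auto simp: inner_ell_def)
  also have "\<dots> = \<epsilon>\<^sup>2 / \<nu>1" using \<nu>1 by (simp add: power2_eq_square)
  finally show "\<theta> \<in> ell x" by (simp add: ell_def)
  obtain A :: "real^'p^'p" where A: "invertible A" "\<And>x. quad (V \<theta>) x = (norm (A *v x))\<^sup>2" "det (V \<theta>) = (det A)\<^sup>2" using V_factor[OF \<theta>] by blast
  obtain B :: "real^'p^'p" where B: "invertible B" "\<And>y. quad (V x) y = (norm (B *v y))\<^sup>2" "det (V x) = (det B)\<^sup>2" using V_factor[OF x\<Theta>] by blast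
  have "norm (A *v y) \<le> sqrt \<nu>1 * norm (B *v y)" for y
  proof (rule power2_le_imp_le)
    have "real n * quad (v \<theta>) y \<le> real n * (\<nu>1 * quad (v x) y)" by (intro mult_left_mono v_comparable[OF \<theta> centre_calB' xB]) auto
    then have "quad (V \<theta>) y \<le> \<nu>1 * quad (V x) y" by (simp add: quad_scaleR mult.left_commute)
    then show "(norm (A *v y))\<^sup>2 \<le> (sqrt \<nu>1 * norm (B *v y))\<^sup>2" unfolding A(2) B(2) using \<nu>1 by (simp add: power_mult_distrib)
  qed (use \<nu>1 in auto)
  then have "\<bar>det A\<bar> \<le> sqrt \<nu>1 ^ CARD('p) * \<bar>det B\<bar>" using \<nu>1 by (intro det_le_of_contraction[OF B(1)]) auto
  then show "sqrt (det (V \<theta>)) \<le> sqrt \<nu>1 ^ CARD('p) * sqrt (det (V x))" unfolding A(3) B(3) by simp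
qed

lemma inner_ell_volume:
  assumes \<theta>: "\<theta> \<in> \<Theta>"
  shows "inner_ell \<theta> \<in> sets lebesgue" "inner_ell \<theta> \<subseteq> \<Theta>"
    "ennreal (sqrt (det (V \<theta>))) * emeasure lebesgue (inner_ell \<theta>) = ennreal (measure lebesgue (ball (0::real^'p) 1) * (\<epsilon> / \<nu>1) ^ CARD('p))"
proof -
  obtain A :: "real^'p^'p" where A: "invertible A" "\<And>x. quad (V \<theta>) x = (norm (A *v x))\<^sup>2" "det (V \<theta>) = (det A)\<^sup>2" using V_factor[OF \<theta>] by blast
  have r: "0 \<le> \<epsilon> / \<nu>1" using \<epsilon> \<nu>1 by simp
  have eq: "inner_ell \<theta> = {x. norm (A *v (x - \<theta>)) \<le> \<epsilon> / \<nu>1}"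
    unfolding inner_ell_def A(2) using r by (simp add: power2_le_iff_abs_le)
  show "inner_ell \<theta> \<in> sets lebesgue" unfolding eq by (rule measure_ellipsoid(2)[OF A(1) r])
  show "inner_ell \<theta> \<subseteq> \<Theta>" using inner_ell_calB' calB'_sub[OF \<theta>] by blast
  have "det A \<noteq> 0" using A(1) by (simp add: invertible_det_nz)
  then show "ennreal (sqrt (det (V \<theta>))) * emeasure lebesgue (inner_ell \<theta>) = ennreal (measure lebesgue (ball (0::real^'p) 1) * (\<epsilon> / \<nu>1) ^ CARD('p))"
    unfolding eq measure_ellipsoid(1)[OF A(1) r] A(3) using r by (subst ennreal_mult[symmetric]) auto
qed

text \<open>If the infimum is \<open>-\<infinity>\<close>, the right-hand side is infinite for \<open>c > 0\<close> and one for \<open>c = 0\<close>.\<close>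

lemma eexp_rate_ge:
  assumes "\<theta> \<in> ell x" "x \<in> \<Theta>" "0 \<le> c"
  shows "ennreal (exp (- c * rate \<theta>)) \<le> eexp (ereal (- c) * rate_m_eps \<Theta> P p \<mu> \<theta>0 n \<epsilon> x)"
proof -
  have le: "rate_m_eps \<Theta> P p \<mu> \<theta>0 n \<epsilon> x \<le> ereal (rate \<theta>)"
    unfolding rate_m_eps_def using ell_calB[OF assms(2)] assms(1) by (intro INF_lower) auto
  show ?thesis
  proof (cases "rate_m_eps \<Theta> P p \<mu> \<theta>0 n \<epsilon> x")
    case (real r)
    then have "r \<le> rate \<theta>" using le by simp
    then have "- c * rate \<theta> \<le> - c * r" using assms(3) by (simp add: mult_left_mono)
    then show ?thesis by (simp add: real eexp_def ennreal_leI)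
  next
    case MInf
    show ?thesis
    proof (cases "c = 0")
      case False
      then show ?thesis using assms(3) by (simp add: MInf eexp_def)
    qed (simp add: MInf eexp_def zero_ereal_def[symmetric])
  qed (use le in simp)
qed

text \<open>Each \<open>\<theta>\<close> is charged to the centres in \<open>inner_ell \<theta>\<close>.  On this set the weight \<open>sqrt (det V)\<close> is replaced by its value at \<open>\<theta>\<close>, up to a power
of \<open>\<nu>1\<close>; the resulting function of the centre is a multiple of an indicator, which avoids any question of measurability of \<open>v\<close>.\<close>

lemma finite_bound:
  assumes T: "finite T" "T \<subseteq> \<Theta>" and \<rho>: "0 \<le> \<rho>" "\<rho> < 1" and small: "\<epsilon> * \<rho> / (1 - \<rho>) \<le> sqrt (real n) * \<delta>bar" and s: "0 \<le> s" "s < 1"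
    and meas: "frakH_integrand \<Theta> P p \<mu> \<theta>0 n \<epsilon> \<rho> s \<in> borel_measurable (lebesgue_on \<Theta>)"
  shows "(\<integral>\<^sup>+w. (SUP \<theta>\<in>T. ennreal (exp (\<rho> * (\<mu> \<theta> * Lik_diff p Y n w \<theta> \<theta>0 + s * real n * rate \<theta>)))) \<partial>M)
    \<le> ennreal (exp ((1 - \<rho>) * (2 * real CARD('p) * ln 2) + 2 * \<nu>0\<^sup>2 * \<epsilon>\<^sup>2 * \<rho>\<^sup>2 / (1 - \<rho>)) * (sqrt \<nu>1 ^ CARD('p) * \<nu>1 ^ CARD('p)))
      * (ennreal (1 / (measure lebesgue (ball (0::real^'p) 1) * \<epsilon> ^ CARD('p))) * (\<integral>\<^sup>+x. frakH_integrand \<Theta> P p \<mu> \<theta>0 n \<epsilon> \<rho> s x \<partial>lebesgue_on \<Theta>))"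
proof (cases "T = {}")
  case True
  then show ?thesis by (simp add: bot_ennreal)
next
  case False
  define Bd where "Bd = (1 - \<rho>) * (2 * real CARD('p) * ln 2) + 2 * \<nu>0\<^sup>2 * \<epsilon>\<^sup>2 * \<rho>\<^sup>2 / (1 - \<rho>)"
  define c where "c = \<rho> * (1 - s) * real n"
  have c: "0 \<le> c" using \<rho> s by (simp add: c_def)
  define Q where "Q \<theta> w = (if \<theta> \<in> T then \<rho> * stat w \<theta> - c * rate \<theta> else 0)" for \<theta> w
  have Q: "\<rho> * (\<mu> \<theta> * Lik_diff p Y n w \<theta> \<theta>0 + s * real n * rate \<theta>) = Q \<theta> w" if "\<theta> \<in> T" for \<theta> w
    using that by (simp add: Q_def stat_def c_def algebra_simps)
  have Qm [measurable]: "Q \<theta> \<in> borel_measurable M" for \<theta>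
    using T by (cases "\<theta> \<in> T") (auto simp: Q_def[abs_def] subset_iff)
  \<comment> \<open>\<open>a \<theta>\<close> is the part of the expected maximum that falls to \<open>\<theta>\<close>.\<close>
  obtain e :: "real^'p \<Rightarrow> 'w \<Rightarrow> real" where e': "\<forall>i\<in>T. e i \<in> borel_measurable M" "\<forall>i\<in>T. \<forall>w. 0 \<le> e i w" "\<forall>w. (\<Sum>i\<in>T. e i w) = 1"
      "\<forall>i\<in>T. \<forall>j\<in>T. \<forall>w. 0 < e i w \<longrightarrow> Q j w \<le> Q i w"
    using maximal_share[where Z=Q and M=M, OF T(1) False Qm] by (elim exE conjE)
  have em [measurable]: "\<theta> \<in> T \<Longrightarrow> e \<theta> \<in> borel_measurable M" for \<theta> using e'(1) by blast
  define a where "a \<theta> = (\<integral>\<^sup>+w. ennreal (e \<theta> w) * ennreal (exp (Q \<theta> w)) \<partial>M)" for \<theta>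
  have upper: "(\<integral>\<^sup>+w. (SUP \<theta>\<in>T. ennreal (exp (\<rho> * (\<mu> \<theta> * Lik_diff p Y n w \<theta> \<theta>0 + s * real n * rate \<theta>)))) \<partial>M) \<le> (\<Sum>\<theta>\<in>T. a \<theta>)"
  proof -
    have "(\<integral>\<^sup>+w. (SUP \<theta>\<in>T. ennreal (exp (\<rho> * (\<mu> \<theta> * Lik_diff p Y n w \<theta> \<theta>0 + s * real n * rate \<theta>)))) \<partial>M)
      \<le> (\<integral>\<^sup>+w. (\<Sum>\<theta>\<in>T. ennreal (e \<theta> w) * ennreal (exp (Q \<theta> w))) \<partial>M)"
    proof (intro nn_integral_mono SUP_least)
      fix w j assume j: "j \<in> T"
      have "ennreal (exp (Q j w)) = ennreal (\<Sum>\<theta>\<in>T. e \<theta> w) * ennreal (exp (Q j w))" using e'(3) by simp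
      also have "\<dots> = (\<Sum>\<theta>\<in>T. ennreal (e \<theta> w) * ennreal (exp (Q j w)))"
        using e'(2) by (intro ennreal_sum_mult) auto
      also have "\<dots> \<le> (\<Sum>\<theta>\<in>T. ennreal (e \<theta> w) * ennreal (exp (Q \<theta> w)))"
      proof (rule sum_mono)
        fix \<theta> assume \<theta>: "\<theta> \<in> T"
        show "ennreal (e \<theta> w) * ennreal (exp (Q j w)) \<le> ennreal (e \<theta> w) * ennreal (exp (Q \<theta> w))"
        proof (cases "0 < e \<theta> w")
          case True
          then have "Q j w \<le> Q \<theta> w" using e'(4) \<theta> j by blast
          then show ?thesis by (intro mult_left_mono ennreal_leI) auto
        qed (simp add: ennreal_neg)
      qed
      finally show "ennreal (exp (\<rho> * (\<mu> j * Lik_diff p Y n w j \<theta>0 + s * real n * rate j))) \<le> (\<Sum>\<theta>\<in>T. ennreal (e \<theta> w) * ennreal (exp (Q \<theta> w)))"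
        unfolding Q[OF j] .
    qed
    also have "\<dots> = (\<Sum>\<theta>\<in>T. a \<theta>)" unfolding a_def by (intro nn_integral_sum) measurable
    finally show ?thesis .
  qed
  define k where "k \<theta> = ennreal (sqrt (det (V \<theta>)) / sqrt \<nu>1 ^ CARD('p))" for \<theta>
  have sn: "0 < sqrt \<nu>1 ^ CARD('p)" using \<nu>1 by simp
  have point: "(\<Sum>\<theta>\<in>T. a \<theta> * (k \<theta> * indicator (inner_ell \<theta>) x)) \<le> ennreal (exp Bd) * frakH_integrand \<Theta> P p \<mu> \<theta>0 n \<epsilon> \<rho> s x" if x: "x \<in> \<Theta>" for x
  proof -
    define T' where "T' = {\<theta>\<in>T. x \<in> inner_ell \<theta>}"
    have T': "finite T'" "T' \<subseteq> T" using T by (auto simp: T'_def)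
    have T'ell: "T' \<subseteq> ell x" using inner_ell_swap(1) T by (auto simp: T'_def)
    define R where "R = eexp (ereal (- c) * rate_m_eps \<Theta> P p \<mu> \<theta>0 n \<epsilon> x)"
    have "(\<Sum>\<theta>\<in>T. a \<theta> * (k \<theta> * indicator (inner_ell \<theta>) x)) = (\<Sum>\<theta>\<in>T'. a \<theta> * k \<theta>)"
      using T by (intro sum.mono_neutral_cong_right) (auto simp: T'_def)
    also have "\<dots> \<le> (\<Sum>\<theta>\<in>T'. a \<theta> * ennreal (sqrt (det (V x))))"
    proof (intro sum_mono mult_left_mono)
      fix \<theta> assume "\<theta> \<in> T'"
      then have "sqrt (det (V \<theta>)) \<le> sqrt \<nu>1 ^ CARD('p) * sqrt (det (V x))" using T by (intro inner_ell_swap(2)) (auto simp: T'_def)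
      then show "k \<theta> \<le> ennreal (sqrt (det (V x)))" unfolding k_def using sn by (intro ennreal_leI) (simp add: field_simps)
    qed auto
    also have "\<dots> = ennreal (sqrt (det (V x))) * (\<Sum>\<theta>\<in>T'. a \<theta>)"
      unfolding sum_distrib_left by (intro sum.cong refl mult.commute)
    finally have outer: "(\<Sum>\<theta>\<in>T. a \<theta> * (k \<theta> * indicator (inner_ell \<theta>) x)) \<le> ennreal (sqrt (det (V x))) * (\<Sum>\<theta>\<in>T'. a \<theta>)" .
    have "(\<Sum>\<theta>\<in>T'. a \<theta>) = (\<integral>\<^sup>+w. (\<Sum>\<theta>\<in>T'. ennreal (e \<theta> w) * ennreal (exp (Q \<theta> w))) \<partial>M)"
      unfolding a_def using T'(2) by (intro nn_integral_sum[symmetric]) (auto intro!: borel_measurable_times)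
    also have "\<dots> \<le> (\<integral>\<^sup>+w. R * (SUP \<theta>\<in>T'. ennreal (exp (\<rho> * stat w \<theta>))) \<partial>M)"
    proof (rule nn_integral_mono)
      fix w
      let ?S = "SUP \<theta>\<in>T'. ennreal (exp (\<rho> * stat w \<theta>))"
      have "(\<Sum>\<theta>\<in>T'. ennreal (e \<theta> w) * ennreal (exp (Q \<theta> w))) \<le> (\<Sum>\<theta>\<in>T'. ennreal (e \<theta> w) * (R * ?S))"
      proof (intro sum_mono mult_left_mono)
        fix \<theta> assume \<theta>: "\<theta> \<in> T'"
        have "ennreal (exp (Q \<theta> w)) = ennreal (exp (- c * rate \<theta>)) * ennreal (exp (\<rho> * stat w \<theta>))"
          using \<theta> T' by (auto simp: Q_def ennreal_mult[symmetric] exp_add[symmetric] subset_iff)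
        also have "\<dots> \<le> R * ?S"
          unfolding R_def using \<theta> T'ell by (intro mult_mono eexp_rate_ge x c SUP_upper) auto
        finally show "ennreal (exp (Q \<theta> w)) \<le> R * ?S" .
      qed auto
      also have "\<dots> = ennreal (\<Sum>\<theta>\<in>T'. e \<theta> w) * (R * ?S)"
        using e'(2) T'(2) by (intro ennreal_sum_mult[symmetric]) auto
      also have "\<dots> \<le> 1 * (R * ?S)"
      proof (rule mult_right_mono)
        have "(\<Sum>\<theta>\<in>T'. e \<theta> w) \<le> (\<Sum>\<theta>\<in>T. e \<theta> w)" using e'(2) T T' by (intro sum_mono2) auto
        then show "ennreal (\<Sum>\<theta>\<in>T'. e \<theta> w) \<le> 1" using e'(3) by (simp add: ennreal_le_1)
      qed simp
      finally show "(\<Sum>\<theta>\<in>T'. ennreal (e \<theta> w) * ennreal (exp (Q \<theta> w))) \<le> R * ?S" by simp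
    qed
    also have "\<dots> = R * (\<integral>\<^sup>+w. (SUP \<theta>\<in>T'. ennreal (exp (\<rho> * stat w \<theta>))) \<partial>M)"
      using T T' by (intro nn_integral_cmult borel_measurable_SUP countable_finite) auto
    also have "\<dots> \<le> R * ennreal (exp Bd)"
      unfolding Bd_def by (intro mult_left_mono local_bound[OF x T'(1) T'ell \<rho> small]) auto
    finally have "ennreal (sqrt (det (V x))) * (\<Sum>\<theta>\<in>T'. a \<theta>) \<le> ennreal (sqrt (det (V x))) * (R * ennreal (exp Bd))"
      by (rule mult_left_mono) simp
    also have "\<dots> = ennreal (exp Bd) * frakH_integrand \<Theta> P p \<mu> \<theta>0 n \<epsilon> \<rho> s x"
      unfolding frakH_integrand_def R_def c_def by (simp only: mult_ac)
    finally show ?thesis by (rule order_trans[OF outer])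
  qed
  let ?w = "measure lebesgue (ball (0::real^'p) 1)"
  have w: "0 < ?w" by (simp add: content_ball unit_ball_vol_pos)
  define \<kappa> where "\<kappa> = ?w * (\<epsilon> / \<nu>1) ^ CARD('p) / sqrt \<nu>1 ^ CARD('p)"
  have \<kappa>: "0 < \<kappa>" using w \<epsilon> \<nu>1 by (simp add: \<kappa>_def)
  have \<Theta>s: "\<Theta> \<in> sets lebesgue" using open_\<Theta> by (intro sets_completionI_sets) simp
  have cell: "(\<integral>\<^sup>+x. k \<theta> * indicator (inner_ell \<theta>) x \<partial>lebesgue_on \<Theta>) = ennreal \<kappa>" if "\<theta> \<in> T" for \<theta>
  proof -
    have \<theta>: "\<theta> \<in> \<Theta>" using that T by blast
    note vol = inner_ell_volume[OF \<theta>]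
    have "(\<integral>\<^sup>+x. k \<theta> * indicator (inner_ell \<theta>) x \<partial>lebesgue_on \<Theta>) = k \<theta> * emeasure (lebesgue_on \<Theta>) (inner_ell \<theta>)"
      using vol \<Theta>s by (intro nn_integral_cmult_indicator) (auto simp: sets_restrict_space_iff)
    also have "emeasure (lebesgue_on \<Theta>) (inner_ell \<theta>) = emeasure lebesgue (inner_ell \<theta>)"
      using vol \<Theta>s by (intro emeasure_restrict_space) auto
    also have "k \<theta> * emeasure lebesgue (inner_ell \<theta>) = ennreal (1 / sqrt \<nu>1 ^ CARD('p)) * (ennreal (sqrt (det (V \<theta>))) * emeasure lebesgue (inner_ell \<theta>))"
    proof -
      have "k \<theta> = ennreal (1 / sqrt \<nu>1 ^ CARD('p)) * ennreal (sqrt (det (V \<theta>)))"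
        unfolding k_def using sn by (subst ennreal_mult'[symmetric]) auto
      then show ?thesis by (simp add: mult.assoc)
    qed
    also have "\<dots> = ennreal \<kappa>"
      unfolding vol(3) \<kappa>_def using sn w \<epsilon> \<nu>1 by (subst ennreal_mult[symmetric]) auto
    finally show ?thesis .
  qed
  have "ennreal \<kappa> * (\<Sum>\<theta>\<in>T. a \<theta>) = (\<Sum>\<theta>\<in>T. a \<theta> * (\<integral>\<^sup>+x. k \<theta> * indicator (inner_ell \<theta>) x \<partial>lebesgue_on \<Theta>))"
    unfolding sum_distrib_left by (intro sum.cong refl) (simp add: cell mult.commute)
  also have "\<dots> = (\<integral>\<^sup>+x. (\<Sum>\<theta>\<in>T. a \<theta> * (k \<theta> * indicator (inner_ell \<theta>) x)) \<partial>lebesgue_on \<Theta>)"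
  proof -
    have m: "(\<lambda>x. k \<theta> * indicator (inner_ell \<theta>) x) \<in> borel_measurable (lebesgue_on \<Theta>)" if "\<theta> \<in> T" for \<theta>
      using that T inner_ell_volume[of \<theta>] \<Theta>s by (intro borel_measurable_times_ennreal borel_measurable_const borel_measurable_indicator) (auto simp: sets_restrict_space_iff)
    have "(\<integral>\<^sup>+x. (\<Sum>\<theta>\<in>T. a \<theta> * (k \<theta> * indicator (inner_ell \<theta>) x)) \<partial>lebesgue_on \<Theta>) = (\<Sum>\<theta>\<in>T. \<integral>\<^sup>+x. a \<theta> * (k \<theta> * indicator (inner_ell \<theta>) x) \<partial>lebesgue_on \<Theta>)"
      by (rule nn_integral_sum) (intro borel_measurable_times_ennreal borel_measurable_const m)
    also have "\<dots> = (\<Sum>\<theta>\<in>T. a \<theta> * (\<integral>\<^sup>+x. k \<theta> * indicator (inner_ell \<theta>) x \<partial>lebesgue_on \<Theta>))"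
      by (intro sum.cong refl nn_integral_cmult m)
    finally show ?thesis by simp
  qed
  also have "\<dots> \<le> (\<integral>\<^sup>+x. ennreal (exp Bd) * frakH_integrand \<Theta> P p \<mu> \<theta>0 n \<epsilon> \<rho> s x \<partial>lebesgue_on \<Theta>)"
    using point by (intro nn_integral_mono) (simp add: space_restrict_space)
  also have "\<dots> = ennreal (exp Bd) * (\<integral>\<^sup>+x. frakH_integrand \<Theta> P p \<mu> \<theta>0 n \<epsilon> \<rho> s x \<partial>lebesgue_on \<Theta>)"
    by (rule nn_integral_cmult[OF meas])
  finally have main: "ennreal \<kappa> * (\<Sum>\<theta>\<in>T. a \<theta>) \<le> ennreal (exp Bd) * (\<integral>\<^sup>+x. frakH_integrand \<Theta> P p \<mu> \<theta>0 n \<epsilon> \<rho> s x \<partial>lebesgue_on \<Theta>)" (is "_ \<le> _ * ?J") .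
  have "(\<Sum>\<theta>\<in>T. a \<theta>) = ennreal (1 / \<kappa>) * (ennreal \<kappa> * (\<Sum>\<theta>\<in>T. a \<theta>))"
    using \<kappa> by (simp add: mult.assoc[symmetric] ennreal_mult[symmetric])
  also have "\<dots> \<le> ennreal (1 / \<kappa>) * (ennreal (exp Bd) * ?J)" by (intro mult_left_mono main) auto
  also have "\<dots> = ennreal (exp Bd * (sqrt \<nu>1 ^ CARD('p) * \<nu>1 ^ CARD('p))) * (ennreal (1 / (?w * \<epsilon> ^ CARD('p))) * ?J)"
  proof -
    have "1 / \<kappa> * exp Bd = exp Bd * (sqrt \<nu>1 ^ CARD('p) * \<nu>1 ^ CARD('p)) * (1 / (?w * \<epsilon> ^ CARD('p)))"
      using w \<epsilon> \<nu>1 by (simp add: \<kappa>_def power_divide field_simps)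
    then have "ennreal (1 / \<kappa>) * ennreal (exp Bd) = ennreal (exp Bd * (sqrt \<nu>1 ^ CARD('p) * \<nu>1 ^ CARD('p))) * ennreal (1 / (?w * \<epsilon> ^ CARD('p)))"
      using w \<epsilon> \<nu>1 \<kappa> by (subst (1 2) ennreal_mult[symmetric]) auto
    then show ?thesis by (simp add: mult.assoc[symmetric])
  qed
  finally show ?thesis using upper unfolding Bd_def by (rule order_trans[rotated])
qed

text \<open>The rate function need not be continuous, but its graph has a countable dense subset.  Along a sequence in this subset both the
parameter and the rate converge, so the supremum over countably many parameters is the full supremum.\<close>

lemma sup_bound:
  assumes \<rho>: "0 \<le> \<rho>" "\<rho> < 1" and small: "\<epsilon> * \<rho> / (1 - \<rho>) \<le> sqrt (real n) * \<delta>bar" and s: "0 \<le> s" "s < 1"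
    and meas: "frakH_integrand \<Theta> P p \<mu> \<theta>0 n \<epsilon> \<rho> s \<in> borel_measurable (lebesgue_on \<Theta>)"
  shows "frakQ \<Theta> M Y P p \<mu> \<theta>0 n \<rho> s
    \<le> ennreal (exp ((1 - \<rho>) * (2 * real CARD('p) * ln 2) + 2 * \<nu>0\<^sup>2 * \<epsilon>\<^sup>2 * \<rho>\<^sup>2 / (1 - \<rho>)) * (sqrt \<nu>1 ^ CARD('p) * \<nu>1 ^ CARD('p)))
      * (ennreal (1 / (measure lebesgue (ball (0::real^'p) 1) * \<epsilon> ^ CARD('p))) * (\<integral>\<^sup>+x. frakH_integrand \<Theta> P p \<mu> \<theta>0 n \<epsilon> \<rho> s x \<partial>lebesgue_on \<Theta>))"
    (is "_ \<le> ?B")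
proof -
  define F where "F \<theta> w = ennreal (exp (\<rho> * (\<mu> \<theta> * Lik_diff p Y n w \<theta> \<theta>0 + s * real n * rate \<theta>)))" for \<theta> w
  obtain G where G: "countable G" "G \<subseteq> (\<lambda>\<theta>. (\<theta>, rate \<theta>)) ` \<Theta>" "(\<lambda>\<theta>. (\<theta>, rate \<theta>)) ` \<Theta> \<subseteq> closure G"
    by (rule separable)
  define D where "D = fst ` G"
  have D: "countable D" "D \<subseteq> \<Theta>" using G by (auto simp: D_def)
  have D0: "D \<noteq> {}" using G(3) \<Theta>(2) by (auto simp: D_def)
  have Lcont: "continuous_on \<Theta> (\<lambda>\<theta>. \<mu> \<theta> * Lik_diff p Y n w \<theta> \<theta>0)" if w: "w \<in> space M" for w
    unfolding Lik_diff_def Lik_def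
    by (intro continuous_intros differentiable_imp_continuous_on diff_\<mu> diff_loglik) (auto intro: measurable_space[OF Y_measurable] w)
  have dense: "F \<theta> w \<le> (SUP \<theta>\<in>D. F \<theta> w)" if \<theta>: "\<theta> \<in> \<Theta>" and w: "w \<in> space M" for \<theta> w
  proof -
    have "(\<theta>, rate \<theta>) \<in> closure G" using G(3) \<theta> by blast
    then obtain g where g: "\<And>k. g k \<in> G" "g \<longlonglongrightarrow> (\<theta>, rate \<theta>)" unfolding closure_sequential by blast
    define t where "t k = fst (g k)" for k
    have tD: "t k \<in> D" for k using g(1)[of k] by (simp add: t_def D_def)
    have t1: "t \<longlonglongrightarrow> \<theta>" unfolding t_def using tendsto_fst[OF g(2)] by simp
    have "snd (g k) = rate (t k)" for k using g(1)[of k] G(2) by (auto simp: t_def)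
    then have t2: "(\<lambda>k. rate (t k)) \<longlonglongrightarrow> rate \<theta>" using tendsto_snd[OF g(2)] by simp
    have t3: "(\<lambda>k. \<mu> (t k) * Lik_diff p Y n w (t k) \<theta>0) \<longlonglongrightarrow> \<mu> \<theta> * Lik_diff p Y n w \<theta> \<theta>0"
      by (rule continuous_on_tendsto_compose[OF Lcont[OF w] t1 \<theta>]) (use tD D(2) in \<open>auto intro!: always_eventually\<close>)
    have "(\<lambda>k. F (t k) w) \<longlonglongrightarrow> F \<theta> w"
      unfolding F_def by (intro tendsto_ennrealI tendsto_exp tendsto_intros t2 t3)
    then show ?thesis by (rule LIMSEQ_le_const2) (auto intro!: exI[of _ 0] SUP_upper tD)
  qed
  define d where "d = from_nat_into D"
  have dD: "range d = D" unfolding d_def using D0 D(1) by (rule range_from_nat_into)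
  define T where "T k = d ` {..k}" for k :: nat
  have T: "finite (T k)" "T k \<subseteq> \<Theta>" for k using dD D(2) by (auto simp: T_def)
  have "frakQ \<Theta> M Y P p \<mu> \<theta>0 n \<rho> s = (\<integral>\<^sup>+w. (SUP \<theta>\<in>\<Theta>. F \<theta> w) \<partial>M)" by (simp add: frakQ_def F_def)
  also have "\<dots> \<le> (\<integral>\<^sup>+w. (SUP k. SUP \<theta>\<in>T k. F \<theta> w) \<partial>M)"
  proof (rule nn_integral_mono, rule SUP_least)
    fix w \<theta> assume w: "w \<in> space M" and \<theta>: "\<theta> \<in> \<Theta>"
    have "(SUP \<theta>\<in>D. F \<theta> w) \<le> (SUP k. SUP \<theta>\<in>T k. F \<theta> w)"
    proof (rule SUP_least)
      fix x assume "x \<in> D"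
      then obtain k where "x = d k" using dD by blast
      then have "x \<in> T k" by (simp add: T_def)
      then show "F x w \<le> (SUP k. SUP \<theta>\<in>T k. F \<theta> w)" by (intro SUP_upper2[of k] SUP_upper) auto
    qed
    then show "F \<theta> w \<le> (SUP k. SUP \<theta>\<in>T k. F \<theta> w)" using dense[OF \<theta> w] by (rule order_trans[rotated])
  qed
  also have "\<dots> = (SUP k. \<integral>\<^sup>+w. (SUP \<theta>\<in>T k. F \<theta> w) \<partial>M)"
  proof (rule nn_integral_monotone_convergence_SUP)
    show "incseq (\<lambda>k w. SUP \<theta>\<in>T k. F \<theta> w)"
      by (intro monoI le_funI SUP_subset_mono) (auto simp: T_def)
    show "(\<lambda>w. SUP \<theta>\<in>T k. F \<theta> w) \<in> borel_measurable M" for k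
      using T(2)[of k] unfolding F_def
      by (intro borel_measurable_SUP countable_finite T(1)) (auto simp: subset_iff)
  qed
  also have "\<dots> \<le> ?B"
    unfolding F_def by (intro SUP_least finite_bound T \<rho> small s meas)
  finally show ?thesis .
qed

end

section \<open>The exponential bound\<close>

theorem theorem3p1:
  fixes M :: "'w measure" and Y :: "nat \<Rightarrow> 'w \<Rightarrow> 'y" and n :: nat
    and P P0 :: "'y measure" and Pfam :: "real ^ 'p \<Rightarrow> 'y measure"
    and \<Theta> :: "(real ^ 'p) set" and p :: "'y \<Rightarrow> real ^ 'p \<Rightarrow> real"
    and \<mu> :: "real ^ 'p \<Rightarrow> real" and \<theta>0 :: "real ^ 'p"
    and \<delta>bar \<nu>0 \<nu>1 \<epsilon> s \<rho> :: real
  defines "v \<equiv> vmat \<Theta> P p \<mu> \<theta>0"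
  \<comment> \<open>i.i.d. sample\<close>
  assumes "prob_space M" and "n \<ge> 1"
    and "prob_space.indep_vars M (\<lambda>_. P) Y {..<n}"
    and "\<And>i. i < n \<Longrightarrow> distr M P (Y i) = P"
  \<comment> \<open>dominated parametric family\<close>
    and "convex \<Theta>"
    and "sets P = sets P0" and "absolutely_continuous P0 P"
    and "\<And>\<theta>. \<theta> \<in> \<Theta> \<Longrightarrow> prob_space (Pfam \<theta>)"
    and "\<And>\<theta>. \<theta> \<in> \<Theta> \<Longrightarrow> (\<lambda>y. p y \<theta>) \<in> borel_measurable P0"
    and "\<And>\<theta> y. \<theta> \<in> \<Theta> \<Longrightarrow> y \<in> space P0 \<Longrightarrow> p y \<theta> > 0"
    and "\<And>\<theta>. \<theta> \<in> \<Theta> \<Longrightarrow> Pfam \<theta> = density P0 (\<lambda>y. ennreal (p y \<theta>))"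
  \<comment> \<open>log-likelihood, target parameter and rate function\<close>
    and "\<And>\<theta>. \<theta> \<in> \<Theta> \<Longrightarrow> integrable P (\<lambda>y. loglik p y \<theta>)"
    and "\<theta>0 \<in> \<Theta>"
    and "\<And>\<theta>. \<theta> \<in> \<Theta> \<Longrightarrow> (\<integral>\<omega>. Lik p Y n \<omega> \<theta> \<partial>M) \<le> (\<integral>\<omega>. Lik p Y n \<omega> \<theta>0 \<partial>M)"
    and "\<And>\<theta>. \<theta> \<in> \<Theta> \<Longrightarrow> \<mu> \<theta> > 0"
    and "\<And>\<theta>. \<theta> \<in> \<Theta> \<Longrightarrow> integrable P (\<lambda>y. exp (\<mu> \<theta> * loglik_diff p y \<theta> \<theta>0))"
  \<comment> \<open>smoothness; existence and non-degeneracy of the matrices\<close>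
    and "\<And>y. y \<in> space P \<Longrightarrow> loglik p y differentiable_on \<Theta>"
    and "\<mu> differentiable_on \<Theta>"
    and "\<And>y. y \<in> space P \<Longrightarrow> zeta1 P p \<mu> \<theta>0 y differentiable_on \<Theta>"
    and "\<And>\<theta>. \<theta> \<in> \<Theta> \<Longrightarrow> integrable P (\<lambda>y. outer (grad_zeta1 \<Theta> P p \<mu> \<theta>0 y \<theta>))"
    and "\<And>\<theta>. \<theta> \<in> \<Theta> \<Longrightarrow> invertible (v \<theta>)"
  \<comment> \<open>exponential moments\<close>
    and "\<delta>bar > 0" and "\<nu>0 \<ge> 1"
    and "\<And>\<delta>. \<bar>\<delta>\<bar> \<le> \<delta>bar \<Longrightarrow>
           (SUP \<theta>\<in>\<Theta>. SUP \<gamma>\<in>sphere 0 1. hfun \<Theta> P p \<mu> \<theta>0 \<delta> \<gamma> \<theta>) \<le> ereal (2 * \<nu>0\<^sup>2 * \<delta>\<^sup>2)"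
  \<comment> \<open>local regularity; \<open>v\<close> has to be defined on the ellipsoids over which \<open>frakA\<close> ranges\<close>
    and "\<epsilon> > 0" and "\<nu>1 \<ge> 1"
    and "\<And>\<theta>. \<theta> \<in> \<Theta> \<Longrightarrow> calB' (\<lambda>\<theta>. real n *\<^sub>R v \<theta>) \<epsilon> \<theta> \<subseteq> \<Theta>"
    and "\<And>\<theta>. \<theta> \<in> \<Theta> \<Longrightarrow> frakA n v \<epsilon> \<theta> \<le> ereal \<nu>1"
  \<comment> \<open>the entropy-type integral\<close>
    and "0 \<le> s" and "s < 1" and "0 \<le> \<rho>" and "\<rho> < 1"
    and "\<epsilon> * \<rho> / (1 - \<rho>) \<le> sqrt (real n) * \<delta>bar"
    and "frakH_integrand \<Theta> P p \<mu> \<theta>0 n \<epsilon> \<rho> s \<in> borel_measurable (lebesgue_on \<Theta>)"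
    and "frakH \<Theta> P p \<mu> \<theta>0 n \<epsilon> \<rho> s < \<infinity>"
  shows "elog (frakQ \<Theta> M Y P p \<mu> \<theta>0 n \<rho> s) \<le>
           ereal ((1 - \<rho>) * entropy_Q TYPE('p) + 2 * \<nu>0\<^sup>2 * \<epsilon>\<^sup>2 * \<rho>\<^sup>2 / (1 - \<rho>)
                  + 2 * real CARD('p) * ln \<nu>1)
           + frakH \<Theta> P p \<mu> \<theta>0 n \<epsilon> \<rho> s"
proof -
  have spP: "space P = space P0" using \<open>sets P = sets P0\<close> by (rule sets_eq_imp_space_eq)
  note A = assms[unfolded v_def]
  interpret regular_model M Y n P \<Theta> p \<mu> \<theta>0 \<delta>bar \<nu>0 \<nu>1 \<epsilon>
  proof (rule regular_model.intro)
    show "(\<lambda>y. p y \<theta>) \<in> borel_measurable P" if "\<theta> \<in> \<Theta>" for \<theta>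
      using \<open>\<And>\<theta>. \<theta> \<in> \<Theta> \<Longrightarrow> (\<lambda>y. p y \<theta>) \<in> borel_measurable P0\<close>[OF that] by (simp add: measurable_cong_sets[OF \<open>sets P = sets P0\<close> refl])
  qed (fact A)+
  let ?w = "measure lebesgue (ball (0::real^'p) 1)"
  define W where "W = ennreal (1 / (?w * \<epsilon> ^ CARD('p))) * (\<integral>\<^sup>+x. frakH_integrand \<Theta> P p \<mu> \<theta>0 n \<epsilon> \<rho> s x \<partial>lebesgue_on \<Theta>)"
  have H: "frakH \<Theta> P p \<mu> \<theta>0 n \<epsilon> \<rho> s = elog W" by (simp add: frakH_def W_def)
  define c where "c = (1 - \<rho>) * (2 * real CARD('p) * ln 2) + 2 * \<nu>0\<^sup>2 * \<epsilon>\<^sup>2 * \<rho>\<^sup>2 / (1 - \<rho>)"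
  have bound: "frakQ \<Theta> M Y P p \<mu> \<theta>0 n \<rho> s \<le> ennreal (exp c * (sqrt \<nu>1 ^ CARD('p) * \<nu>1 ^ CARD('p))) * W"
    unfolding W_def c_def by (rule sup_bound) (fact A)+
  show ?thesis
  proof (cases W)
    case top
    then show ?thesis using \<open>frakH \<Theta> P p \<mu> \<theta>0 n \<epsilon> \<rho> s < \<infinity>\<close> by (simp add: H elog_def)
  next
    case (real w)
    show ?thesis
    proof (cases "w = 0")
      case True
      then have "frakQ \<Theta> M Y P p \<mu> \<theta>0 n \<rho> s = 0" using bound real by simp
      then show ?thesis by (simp add: elog_def)
    next
      case False
      then have w: "0 < w" using real by simp
      have n1: "0 < \<nu>1" "0 \<le> ln \<nu>1" using \<nu>1 by auto
      \<comment> \<open>The power \<open>3 p / 2\<close> of \<open>\<nu>1\<close> is made of \<open>p\<close> from the volume of \<open>inner_ell\<close> and \<open>p / 2\<close> from the determinant.\<close>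
      define R where "R = (1 - \<rho>) * entropy_Q TYPE('p) + 2 * \<nu>0\<^sup>2 * \<epsilon>\<^sup>2 * \<rho>\<^sup>2 / (1 - \<rho>) + 2 * real CARD('p) * ln \<nu>1"
      have "exp c * (sqrt \<nu>1 ^ CARD('p) * \<nu>1 ^ CARD('p)) * w = exp (c + (3/2 * real CARD('p) * ln \<nu>1) + ln w)"
      proof -
        have "sqrt \<nu>1 ^ CARD('p) * \<nu>1 ^ CARD('p) = exp (real CARD('p) * (ln \<nu>1 / 2)) * exp (real CARD('p) * ln \<nu>1)"
          using n1 by (simp add: exp_of_nat_mult ln_sqrt[symmetric])
        also have "\<dots> = exp (3/2 * real CARD('p) * ln \<nu>1)" by (simp add: exp_add[symmetric])
        finally show ?thesis using w by (simp add: exp_add)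
      qed
      also have "\<dots> \<le> exp (R + ln w)"
      proof (unfold exp_le_cancel_iff)
        have "(1 - \<rho>) * (2 * real CARD('p) * ln 2) \<le> (1 - \<rho>) * entropy_Q TYPE('p)"
          using \<open>\<rho> < 1\<close> by (intro mult_left_mono entropy_Q_ge) auto
        moreover have "3/2 * real CARD('p) * ln \<nu>1 \<le> 2 * real CARD('p) * ln \<nu>1" using n1 by (intro mult_right_mono) auto
        ultimately show "c + (3/2 * real CARD('p) * ln \<nu>1) + ln w \<le> R + ln w" unfolding c_def R_def by linarith
      qed
      finally have "exp c * (sqrt \<nu>1 ^ CARD('p) * \<nu>1 ^ CARD('p)) * w \<le> exp (R + ln w)" .
      moreover have "ennreal (exp c * (sqrt \<nu>1 ^ CARD('p) * \<nu>1 ^ CARD('p))) * W = ennreal (exp c * (sqrt \<nu>1 ^ CARD('p) * \<nu>1 ^ CARD('p)) * w)"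
        unfolding real(2) using w n1 by (subst ennreal_mult[symmetric]) auto
      ultimately have "frakQ \<Theta> M Y P p \<mu> \<theta>0 n \<rho> s \<le> ennreal (exp (R + ln w))" using order_trans[OF bound] ennreal_leI by simp
      then have "elog (frakQ \<Theta> M Y P p \<mu> \<theta>0 n \<rho> s) \<le> ereal (R + ln w)" by (rule elog_leI)
      also have "ereal (R + ln w) = ereal R + elog W" using w real by (simp add: elog_def)
      finally show ?thesis unfolding H R_def .
    qed
  qed
qed

end
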